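(* If $H$ is a non-metrizable compact group, then $H$ has a dense subgroup $G$ such that $\widehat G$, equipped with the Fell topology, is not discrete.
   Context: All topological groups are assumed Hausdorff; a subgroup $G$ of $H$ carries the subspace topology. A unitary representation of a topological group $G$ is a continuous homomorphism $\rho:G\to U(\mathcal H)$, where $\mathcal H$ is a complex Hilbert space and the unitary group $U(\mathcal H)$ carries the strong operator topology. It is irreducible if there is no closed $\rho(G)$-invariant subspace $E$ with $\{0\}\subsetneq E\subsetneq\mathcal H$. The dual object $\widehat G$ is the set of (unitary) equivalence classes of irreducible unitary representations of $G$. For a unitary representation $\rho$ of $G$ on $\mathcal H$, $P_\rho'$ is the set of functions $g\mapsto(\rho(g)v,v)$ on $G$ with $v\in\mathcal H$, and $P_\rho$ is the set of finite sums of elements of $P_\rho'$; these depend only on the equivalence class $[\rho]$. Fell topology on a set $\mathcal R$ of equivalence classes of unitary representations of $G$: the basic neighborhoods of $[\rho]\in\mathcal R$ are the sets $$W(f_1,\dots,f_n,C,\epsilon)=\{[\sigma]\in\mathcal R:\ \exists g_1,\dots,g_n\in P_\sigma\ \ \forall x\in C\ \ \forall i\ \ |f_i(x)-g_i(x)|<\epsilon\},$$ where $f_1,\dots,f_n\in P_\rho$, $C$ is a compact subset of $G$ and $\epsilon>0$. *)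

theory Defs
  imports "HOL-Analysis.Analysis" "HOL-Algebra.Module" "HOL-Algebra.Bij"
begin

section \<open>Topological groups\<close>

text \<open>As usual in this area, Hausdorffness is part of the definition.\<close>

locale topological_group = group G for G :: "('a, 'm) monoid_scheme" (structure) +
  fixes T :: "'a topology"
  assumes topspace_eq: "topspace T = carrier G"
    and continuous_mult: "continuous_map (prod_topology T T) T (\<lambda>(x, y). x \<otimes> y)"
    and continuous_inv: "continuous_map T T (\<lambda>x. inv x)"
    and Hausdorff: "Hausdorff_space T"


section \<open>Complex Hilbert spaces\<close>

definition complex_ring :: "complex ring" where
  "complex_ring = \<lparr>carrier = UNIV, mult = (*), one = 1, zero = 0, add = (+)\<rparr>"

text \<open>The fields \<^const>\<open>mult\<close> and \<^const>\<open>one\<close> that a \<^type>\<open>module\<close> record inherits from rings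
  play no role.\<close>

record 'v hilbert = "(complex, 'v) module" +
  hinner :: "'v \<Rightarrow> 'v \<Rightarrow> complex"

text \<open>The library's \<^locale>\<open>Metric_space\<close> wants a distance that is nonnegative and symmetric even
  off the carrier, hence the default value.\<close>

definition hdist :: "'v hilbert \<Rightarrow> 'v \<Rightarrow> 'v \<Rightarrow> real" where
  "hdist V x y =
    (if x \<in> carrier V \<and> y \<in> carrier V
     then sqrt (Re (hinner V (x \<ominus>\<^bsub>V\<^esub> y) (x \<ominus>\<^bsub>V\<^esub> y))) else 0)"

definition norm_topology :: "'v hilbert \<Rightarrow> 'v topology" where
  "norm_topology V = Metric_space.mtopology (carrier V) (hdist V)"

locale complex_inner_space = module complex_ring V for V :: "'v hilbert" (structure) +
  assumes hinner_add_left: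
      "\<lbrakk>x \<in> carrier V; y \<in> carrier V; z \<in> carrier V\<rbrakk>
        \<Longrightarrow> hinner V (x \<oplus> y) z = hinner V x z + hinner V y z"
    and hinner_scale_left:
      "\<lbrakk>x \<in> carrier V; z \<in> carrier V\<rbrakk> \<Longrightarrow> hinner V (c \<odot> x) z = c * hinner V x z"
    and hinner_commute:
      "\<lbrakk>x \<in> carrier V; y \<in> carrier V\<rbrakk> \<Longrightarrow> hinner V x y = cnj (hinner V y x)"
    and hinner_nonneg: "x \<in> carrier V \<Longrightarrow> 0 \<le> Re (hinner V x x)"
    and hinner_definite: "\<lbrakk>x \<in> carrier V; hinner V x x = 0\<rbrakk> \<Longrightarrow> x = \<zero>"

locale hilbert_space = complex_inner_space +
  assumes complete: "Metric_space.mcomplete (carrier V) (hdist V)"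


section \<open>The unitary group\<close>

definition unitary_iso :: "'v hilbert \<Rightarrow> 'w hilbert \<Rightarrow> ('v \<Rightarrow> 'w) \<Rightarrow> bool" where
  "unitary_iso V W u \<longleftrightarrow>
    bij_betw u (carrier V) (carrier W) \<and>
    (\<forall>x\<in>carrier V. \<forall>y\<in>carrier V. u (x \<oplus>\<^bsub>V\<^esub> y) = u x \<oplus>\<^bsub>W\<^esub> u y) \<and>
    (\<forall>c. \<forall>x\<in>carrier V. u (c \<odot>\<^bsub>V\<^esub> x) = c \<odot>\<^bsub>W\<^esub> u x) \<and>
    (\<forall>x\<in>carrier V. \<forall>y\<in>carrier V. hinner W (u x) (u y) = hinner V x y)"

definition unitary_group :: "'v hilbert \<Rightarrow> ('v \<Rightarrow> 'v) monoid" where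
  "unitary_group V =
    BijGroup (carrier V) \<lparr>carrier := {u \<in> Bij (carrier V). unitary_iso V V u}\<rparr>"

text \<open>The strong operator topology is the topology of pointwise convergence with respect to the
  norm; operators are extensional functions on the carrier, i.e. points of the product space.\<close>

definition strong_operator_topology :: "'v hilbert \<Rightarrow> ('v \<Rightarrow> 'v) topology" where
  "strong_operator_topology V =
    subtopology (product_topology (\<lambda>_. norm_topology V) (carrier V)) (carrier (unitary_group V))"


section \<open>Unitary representations\<close>

definition unitary_rep ::
  "('g, 'm) monoid_scheme \<Rightarrow> 'g topology \<Rightarrow> 'v hilbert \<Rightarrow> ('g \<Rightarrow> 'v \<Rightarrow> 'v) \<Rightarrow> bool" where
  "unitary_rep G T V \<rho> \<longleftrightarrow>
    hilbert_space V \<and> \<rho> \<in> hom G (unitary_group V) \<and>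
    continuous_map T (strong_operator_topology V) \<rho>"

definition closed_invariant_subspace ::
  "('g, 'm) monoid_scheme \<Rightarrow> 'v hilbert \<Rightarrow> ('g \<Rightarrow> 'v \<Rightarrow> 'v) \<Rightarrow> 'v set \<Rightarrow> bool" where
  "closed_invariant_subspace G V \<rho> E \<longleftrightarrow>
    submodule E complex_ring V \<and> closedin (norm_topology V) E \<and>
    (\<forall>g\<in>carrier G. \<rho> g ` E \<subseteq> E)"

text \<open>By convention the zero space is not irreducible. (Its only positive definite function is
  \<open>0\<close>, so as a point of the dual object it would have no neighbourhood besides the whole dual.)\<close>

definition irreducible_rep ::
  "('g, 'm) monoid_scheme \<Rightarrow> 'g topology \<Rightarrow> 'v hilbert \<Rightarrow> ('g \<Rightarrow> 'v \<Rightarrow> 'v) \<Rightarrow> bool" where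
  "irreducible_rep G T V \<rho> \<longleftrightarrow>
    unitary_rep G T V \<rho> \<and> carrier V \<noteq> {\<zero>\<^bsub>V\<^esub>} \<and>
    \<not> (\<exists>E. closed_invariant_subspace G V \<rho> E \<and> {\<zero>\<^bsub>V\<^esub>} \<subset> E \<and> E \<subset> carrier V)"

definition unitarily_equivalent ::
  "('g, 'm) monoid_scheme \<Rightarrow> 'v hilbert \<Rightarrow> ('g \<Rightarrow> 'v \<Rightarrow> 'v) \<Rightarrow>
    'w hilbert \<Rightarrow> ('g \<Rightarrow> 'w \<Rightarrow> 'w) \<Rightarrow> bool" where
  "unitarily_equivalent G V \<rho> W \<sigma> \<longleftrightarrow>
    (\<exists>u. unitary_iso V W u \<and> (\<forall>g\<in>carrier G. \<forall>x\<in>carrier V. u (\<rho> g x) = \<sigma> g (u x)))"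

type_synonym ('g, 'v) rep = "'v hilbert \<times> ('g \<Rightarrow> 'v \<Rightarrow> 'v)"

definition rep_rel ::
  "('g, 'm) monoid_scheme \<Rightarrow> 'g topology \<Rightarrow> (('g, 'v) rep \<times> ('g, 'v) rep) set" where
  "rep_rel G T =
    {((V, \<rho>), (W, \<sigma>)). unitary_rep G T V \<rho> \<and> unitary_rep G T W \<sigma> \<and>
      unitarily_equivalent G V \<rho> W \<sigma>}"

text \<open>HOL has no collection of all Hilbert spaces, so the dual object is formed from Hilbert
  spaces with carrier in the type \<open>'g \<Rightarrow> complex\<close> and arbitrary operations. No irreducible
  representation is lost in this way: see \<open>irreducible_rep_small\<close> below.\<close>

definition dual_object ::
  "('g, 'm) monoid_scheme \<Rightarrow> 'g topology \<Rightarrow> ('g, 'g \<Rightarrow> complex) rep set set" where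
  "dual_object G T = {(V, \<rho>). irreducible_rep G T V \<rho>} // rep_rel G T"


section \<open>The Fell topology\<close>

definition elementary_pos_def_funs ::
  "('g, 'm) monoid_scheme \<Rightarrow> ('g, 'v) rep \<Rightarrow> ('g \<Rightarrow> complex) set" where
  "elementary_pos_def_funs G = (\<lambda>(V, \<rho>).
    {\<lambda>g\<in>carrier G. hinner V (\<rho> g v) v | v. v \<in> carrier V})"

definition pos_def_funs ::
  "('g, 'm) monoid_scheme \<Rightarrow> ('g, 'v) rep \<Rightarrow> ('g \<Rightarrow> complex) set" where
  "pos_def_funs G \<pi> =
    {\<lambda>g\<in>carrier G. \<Sum>i<n. p i g | (n::nat) p. \<forall>i<n. p i \<in> elementary_pos_def_funs G \<pi>}"

text \<open>All members of a class contribute the same functions; see \<open>class_pos_def_funs_eq\<close>.\<close>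

definition class_pos_def_funs ::
  "('g, 'm) monoid_scheme \<Rightarrow> ('g, 'v) rep set \<Rightarrow> ('g \<Rightarrow> complex) set" where
  "class_pos_def_funs G c = (\<Union>\<pi>\<in>c. pos_def_funs G \<pi>)"

definition fell_nbhd ::
  "('g, 'm) monoid_scheme \<Rightarrow> ('g, 'v) rep set set \<Rightarrow>
    nat \<Rightarrow> (nat \<Rightarrow> 'g \<Rightarrow> complex) \<Rightarrow> 'g set \<Rightarrow> real \<Rightarrow> ('g, 'v) rep set set" where
  "fell_nbhd G R n f C \<epsilon> =
    {s \<in> R. \<exists>h. (\<forall>i<n. h i \<in> class_pos_def_funs G s) \<and>
      (\<forall>x\<in>C. \<forall>i<n. cmod (f i x - h i x) < \<epsilon>)}"

definition fell_topology ::
  "('g, 'm) monoid_scheme \<Rightarrow> 'g topology \<Rightarrow> ('g, 'v) rep set set \<Rightarrow> ('g, 'v) rep set topology"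
  where
  "fell_topology G T R = topology (\<lambda>U. U \<subseteq> R \<and>
    (\<forall>r\<in>U. \<exists>n f C \<epsilon>. (\<forall>i<n. f i \<in> class_pos_def_funs G r) \<and> compactin T C \<and> \<epsilon> > 0 \<and>
      fell_nbhd G R n f C \<epsilon> \<subseteq> U))"

abbreviation dual_space ::
  "('g, 'm) monoid_scheme \<Rightarrow> 'g topology \<Rightarrow> ('g, 'g \<Rightarrow> complex) rep set topology" where
  "dual_space G T \<equiv> fell_topology G T (dual_object G T)"


section \<open>Basic facts\<close>

subsection \<open>The Fell topology is a topology\<close>

lemma openin_fell_topology:
  fixes R :: "('g, 'v) rep set set"
  shows "openin (fell_topology G T R) U \<longleftrightarrow> U \<subseteq> R \<and>
    (\<forall>r\<in>U. \<exists>n f C \<epsilon>. (\<forall>i<n. f i \<in> class_pos_def_funs G r) \<and> compactin T C \<and> \<epsilon> > 0 \<and>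
      fell_nbhd G R n f C \<epsilon> \<subseteq> U)"
proof -
  define nb where "nb r A \<longleftrightarrow> (\<exists>n f C \<epsilon>. (\<forall>i<n. f i \<in> class_pos_def_funs G r) \<and> compactin T C \<and>
    \<epsilon> > 0 \<and> fell_nbhd G R n f C \<epsilon> \<subseteq> A)" for r :: "('g, 'v) rep set" and A
  have nbI: "nb r A" if "\<forall>i<n. f i \<in> class_pos_def_funs G r" "compactin T C" "\<epsilon> > 0"
      "fell_nbhd G R n f C \<epsilon> \<subseteq> A" for r A n f C \<epsilon>
    unfolding nb_def by (rule exI[of _ n], rule exI[of _ f], rule exI[of _ C], rule exI[of _ \<epsilon>])
      (intro conjI that)
  have nb_mono: "nb r B" if "nb r A" and AB: "A \<subseteq> B" for r A B
  proof -
    obtain n f C e where 1: "\<forall>i<n. f i \<in> class_pos_def_funs G r" "compactin T C" "e > 0"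
        "fell_nbhd G R n f C e \<subseteq> A"
      using \<open>nb r A\<close> unfolding nb_def by blast
    show ?thesis
      by (rule nbI[OF 1(1-3)]) (use 1(4) AB in blast)
  qed
  have nb_Int: "nb r (A \<inter> B)" if A: "nb r A" and B: "nb r B" for r A B
  proof -
    obtain n f C e where 1: "\<forall>i<n. f i \<in> class_pos_def_funs G r" "compactin T C" "e > 0"
        "fell_nbhd G R n f C e \<subseteq> A"
      using A unfolding nb_def by blast
    obtain m f' C' e' where 2: "\<forall>i<m. f' i \<in> class_pos_def_funs G r" "compactin T C'" "e' > 0"
        "fell_nbhd G R m f' C' e' \<subseteq> B"
      using B unfolding nb_def by blast
    define k where "k = (\<lambda>i. if i < n then f i else f' (i - n))"
    have "s \<in> A \<inter> B" if s: "s \<in> fell_nbhd G R (n + m) k (C \<union> C') (min e e')" for s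
    proof -
      obtain h where h: "s \<in> R" "\<forall>i<n+m. h i \<in> class_pos_def_funs G s"
        "\<forall>x\<in>C\<union>C'. \<forall>i<n+m. cmod (k i x - h i x) < min e e'"
        using s unfolding fell_nbhd_def by blast
      have "cmod (f i x - h i x) < e" if "x \<in> C" "i < n" for i x
        using h(3)[rule_format, of x i] that by (simp add: k_def)
      then have "s \<in> fell_nbhd G R n f C e"
        unfolding fell_nbhd_def using h(1,2) by (intro CollectI conjI exI[of _ h]) simp_all
      moreover have "cmod (f' i x - h (n + i) x) < e'" if "x \<in> C'" "i < m" for i x
        using h(3)[rule_format, of x "n + i"] that by (simp add: k_def)
      then have "s \<in> fell_nbhd G R m f' C' e'"
        unfolding fell_nbhd_def using h(1,2)
        by (intro CollectI conjI exI[of _ "\<lambda>i. h (n + i)"]) simp_all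
      ultimately show ?thesis using 1(4) 2(4) by blast
    qed
    then have "fell_nbhd G R (n + m) k (C \<union> C') (min e e') \<subseteq> A \<inter> B"
      by blast
    moreover have "\<forall>i<n+m. k i \<in> class_pos_def_funs G r"
      using 1(1) 2(1) by (auto simp: k_def)
    moreover have "compactin T (C \<union> C')" "min e e' > 0"
      using 1(2,3) 2(2,3) by (simp_all add: compactin_Un)
    ultimately show ?thesis
      by (intro nbI)
  qed
  have "istopology (\<lambda>U. U \<subseteq> R \<and> (\<forall>r\<in>U. nb r U))"
    unfolding istopology_def
  proof (rule conjI; intro allI impI)
    fix A B assume "A \<subseteq> R \<and> (\<forall>r\<in>A. nb r A)" "B \<subseteq> R \<and> (\<forall>r\<in>B. nb r B)"
    then show "A \<inter> B \<subseteq> R \<and> (\<forall>r\<in>A \<inter> B. nb r (A \<inter> B))"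
      using nb_Int by blast
  next
    fix \<K> assume "\<forall>K\<in>\<K>. K \<subseteq> R \<and> (\<forall>r\<in>K. nb r K)"
    then have "\<Union>\<K> \<subseteq> R" "\<And>r K. \<lbrakk>K \<in> \<K>; r \<in> K\<rbrakk> \<Longrightarrow> nb r (\<Union>\<K>)"
      by (blast, metis Union_upper nb_mono)
    then show "\<Union>\<K> \<subseteq> R \<and> (\<forall>r\<in>\<Union>\<K>. nb r (\<Union>\<K>))"
      by blast
  qed
  then show ?thesis
    unfolding fell_topology_def nb_def by (simp add: topology_inverse')
qed

lemma topspace_fell_topology: "topspace (fell_topology G T R) = R"
proof -
  have "openin (fell_topology G T R) R"
    unfolding openin_fell_topology
  proof (intro conjI ballI)
    fix r assume "r \<in> R"
    show "\<exists>n f C \<epsilon>. (\<forall>i<n. f i \<in> class_pos_def_funs G r) \<and> compactin T C \<and>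
          \<epsilon> > 0 \<and> fell_nbhd G R n f C \<epsilon> \<subseteq> R"
      by (rule exI[of _ 0], rule exI, rule exI[of _ "{}"], rule exI[of _ 1])
         (auto simp: fell_nbhd_def)
  qed simp
  then show ?thesis
    by (metis openin_fell_topology openin_subset openin_topspace subset_antisym)
qed


subsection \<open>Inner product spaces\<close>

lemma complex_ring_simps [simp]:
  "carrier complex_ring = UNIV" "x \<otimes>\<^bsub>complex_ring\<^esub> y = x * y" "\<one>\<^bsub>complex_ring\<^esub> = 1"
  "x \<oplus>\<^bsub>complex_ring\<^esub> y = x + y" "\<zero>\<^bsub>complex_ring\<^esub> = 0"
  by (simp_all add: complex_ring_def)

lemma cring_complex_ring: "cring complex_ring"
proof (rule cringI)
  show "abelian_group complex_ring"
  proof (rule abelian_groupI)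
    fix x :: complex
    show "\<exists>y\<in>carrier complex_ring. y \<oplus>\<^bsub>complex_ring\<^esub> x = \<zero>\<^bsub>complex_ring\<^esub>"
      by (rule bexI[of _ "- x"]) auto
  qed (auto simp: algebra_simps)
  show "Group.comm_monoid complex_ring"
    by (rule comm_monoidI) (auto simp: algebra_simps)
qed (auto simp: algebra_simps)

context complex_inner_space
begin

lemma hinner_add_right:
  "\<lbrakk>x \<in> carrier V; y \<in> carrier V; z \<in> carrier V\<rbrakk>
    \<Longrightarrow> hinner V z (x \<oplus> y) = hinner V z x + hinner V z y"
  by (metis M.a_closed complex_cnj_add hinner_add_left hinner_commute)

lemma hinner_scale_right:
  "\<lbrakk>x \<in> carrier V; z \<in> carrier V\<rbrakk> \<Longrightarrow> hinner V z (c \<odot> x) = cnj c * hinner V z x"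
  by (metis UNIV_I complex_cnj_mult complex_ring_simps(1) hinner_commute hinner_scale_left
      smult_closed)

lemma scale_zero: "x \<in> carrier V \<Longrightarrow> 0 \<odot> x = \<zero>"
  using smult_l_null by simp

lemma scale_one: "x \<in> carrier V \<Longrightarrow> 1 \<odot> x = x"
  using smult_one by simp

lemma scale_closed: "x \<in> carrier V \<Longrightarrow> c \<odot> x \<in> carrier V"
  using smult_closed by simp

lemma scale_add_left: "x \<in> carrier V \<Longrightarrow> (a + b) \<odot> x = a \<odot> x \<oplus> b \<odot> x"
  using smult_l_distr[of a b x] by simp

lemma uminus_eq: "x \<in> carrier V \<Longrightarrow> \<ominus> x = (- 1) \<odot> x"
  using scale_add_left[of x "-1" 1] scale_zero scale_one scale_closed M.minus_equality[of "(-1) \<odot> x" x]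
  by simp

lemma hinner_zero_left: "x \<in> carrier V \<Longrightarrow> hinner V \<zero> x = 0"
  by (metis M.zero_closed hinner_scale_left mult_zero_left scale_zero)

lemma hinner_zero_right: "x \<in> carrier V \<Longrightarrow> hinner V x \<zero> = 0"
  by (metis M.zero_closed complex_cnj_zero hinner_commute hinner_zero_left)

lemma hinner_diff_left:
  "\<lbrakk>x \<in> carrier V; y \<in> carrier V; z \<in> carrier V\<rbrakk>
    \<Longrightarrow> hinner V (x \<ominus> y) z = hinner V x z - hinner V y z"
  by (simp add: a_minus_def hinner_add_left hinner_scale_left uminus_eq scale_closed)

lemma hinner_diff_right:
  "\<lbrakk>x \<in> carrier V; y \<in> carrier V; z \<in> carrier V\<rbrakk>
    \<Longrightarrow> hinner V z (x \<ominus> y) = hinner V z x - hinner V z y"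
  by (simp add: a_minus_def hinner_add_right hinner_scale_right uminus_eq scale_closed)

lemma hinner_self: "x \<in> carrier V \<Longrightarrow> hinner V x x = of_real (Re (hinner V x x))"
  using hinner_commute[of x x] by (simp add: complex_eq_iff)

lemma diff_eq_zero:
  assumes "x \<in> carrier V" "y \<in> carrier V"
  shows "x \<ominus> y = \<zero> \<longleftrightarrow> x = y"
proof
  have "x = (x \<ominus> y) \<oplus> y"
    using assms by (simp add: a_minus_def M.a_assoc M.l_neg)
  then show "x = y" if "x \<ominus> y = \<zero>"
    using assms that by simp
qed (use assms in \<open>simp add: a_minus_def M.r_neg\<close>)

lemma cauchy_schwarz:
  assumes x: "x \<in> carrier V" and y: "y \<in> carrier V"
  shows "cmod (hinner V x y) \<le> sqrt (Re (hinner V x x)) * sqrt (Re (hinner V y y))"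
proof (cases "hinner V y y = 0")
  case True
  then show ?thesis
    using hinner_definite[OF y] x by (simp add: hinner_zero_right)
next
  case False
  define r where "r = Re (hinner V y y)"
  have yy: "hinner V y y = of_real r"
    using hinner_self[OF y] by (simp add: r_def)
  have r: "r > 0"
    using False hinner_nonneg[OF y] yy by (metis r_def less_eq_real_def of_real_0)
  define c where "c = hinner V x y / r"
  have "hinner V (x \<ominus> c \<odot> y) (x \<ominus> c \<odot> y) =
      hinner V x x - cnj c * hinner V x y - c * hinner V y x + c * cnj c * hinner V y y"
    using x y by (simp add: hinner_diff_left hinner_diff_right hinner_scale_left
        hinner_scale_right scale_closed algebra_simps)
  also have "\<dots> = hinner V x x - hinner V x y * cnj (hinner V x y) / r"
    using r hinner_commute[OF y x] by (simp add: c_def yy field_simps)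
  also have "\<dots> = hinner V x x - of_real ((cmod (hinner V x y))\<^sup>2 / r)"
    by (simp flip: complex_norm_square)
  finally have "0 \<le> Re (hinner V x x) - (cmod (hinner V x y))\<^sup>2 / r"
    using hinner_nonneg[of "x \<ominus> c \<odot> y"] x y scale_closed by (metis M.minus_closed Re_complex_of_real minus_complex.sel(1))
  then have "(cmod (hinner V x y))\<^sup>2 \<le> Re (hinner V x x) * r"
    using r by (simp add: field_simps)
  then show ?thesis
    unfolding r_def by (metis real_le_rsqrt real_sqrt_mult)
qed

lemma norm_triangle:
  assumes x: "x \<in> carrier V" and y: "y \<in> carrier V"
  shows "sqrt (Re (hinner V (x \<oplus> y) (x \<oplus> y))) \<le>
    sqrt (Re (hinner V x x)) + sqrt (Re (hinner V y y))"
proof (rule real_le_lsqrt)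
  have "Re (hinner V (x \<oplus> y) (x \<oplus> y)) =
      Re (hinner V x x) + Re (hinner V y y) + 2 * Re (hinner V x y)"
    using hinner_commute[OF y x] x y by (simp add: hinner_add_left hinner_add_right)
  also have "\<dots> \<le> Re (hinner V x x) + Re (hinner V y y) +
      2 * (sqrt (Re (hinner V x x)) * sqrt (Re (hinner V y y)))"
    using cauchy_schwarz[OF x y] complex_Re_le_cmod[of "hinner V x y"] by linarith
  also have "\<dots> = (sqrt (Re (hinner V x x)) + sqrt (Re (hinner V y y)))\<^sup>2"
    using hinner_nonneg x y by (simp add: power2_sum)
  finally show "Re (hinner V (x \<oplus> y) (x \<oplus> y)) \<le>
    (sqrt (Re (hinner V x x)) + sqrt (Re (hinner V y y)))\<^sup>2" .
qed (use hinner_nonneg x y in auto)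

lemma Metric_space_hdist: "Metric_space (carrier V) (hdist V)"
proof
  show "0 \<le> hdist V x y" for x y
    by (simp add: hdist_def hinner_nonneg)
  show "hdist V x y = hdist V y x" for x y
    by (auto simp: hdist_def hinner_diff_left hinner_diff_right)
  show "hdist V x y = 0 \<longleftrightarrow> x = y" if "x \<in> carrier V" "y \<in> carrier V" for x y
  proof -
    have "hdist V x y = 0 \<longleftrightarrow> hinner V (x \<ominus> y) (x \<ominus> y) = 0"
      using that hinner_self[of "x \<ominus> y"] by (simp add: hdist_def) (metis of_real_0 zero_complex.sel(1))
    also have "\<dots> \<longleftrightarrow> x \<ominus> y = \<zero>"
      using that hinner_definite[of "x \<ominus> y"] hinner_zero_left[of \<zero>] by auto
    finally show ?thesis
      using that by (simp add: diff_eq_zero)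
  qed
  show "hdist V x z \<le> hdist V x y + hdist V y z"
    if xyz: "x \<in> carrier V" "y \<in> carrier V" "z \<in> carrier V" for x y z
  proof -
    have "(x \<ominus> y) \<oplus> (y \<ominus> z) = x \<ominus> z"
      using xyz by (simp add: a_minus_def M.a_assoc M.r_neg1 M.r_neg2)
    then show ?thesis
      using norm_triangle[of "x \<ominus> y" "y \<ominus> z"] xyz by (simp add: hdist_def)
  qed
qed

end


subsection \<open>Unitary equivalence\<close>

lemma unitary_iso_comp:
  "\<lbrakk>unitary_iso V W u; unitary_iso W X w\<rbrakk> \<Longrightarrow> unitary_iso V X (w \<circ> u)"
  unfolding unitary_iso_def by (auto intro: bij_betw_trans dest: bij_betwE)

lemma unitary_iso_inv:
  assumes V: "complex_inner_space V" and u: "unitary_iso V W u"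
  shows "unitary_iso W V (inv_into (carrier V) u)"
proof -
  interpret V: complex_inner_space V by fact
  have bij: "bij_betw u (carrier V) (carrier W)" using u by (simp add: unitary_iso_def)
  let ?w = "inv_into (carrier V) u"
  have inv: "\<And>x. x \<in> carrier V \<Longrightarrow> ?w (u x) = x"
    using bij by (simp add: bij_betw_inv_into_left)
  have W: "carrier W = u ` carrier V" using bij by (simp add: bij_betw_def)
  have "?w (u x \<oplus>\<^bsub>W\<^esub> u y) = x \<oplus>\<^bsub>V\<^esub> y" "?w (c \<odot>\<^bsub>W\<^esub> u x) = c \<odot>\<^bsub>V\<^esub> x"
    if "x \<in> carrier V" "y \<in> carrier V" for x y c
    using that u inv[of "x \<oplus>\<^bsub>V\<^esub> y"] inv[of "c \<odot>\<^bsub>V\<^esub> x"]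
    by (simp_all add: unitary_iso_def V.scale_closed)
  then show ?thesis
    using u bij_betw_inv_into[OF bij] unfolding unitary_iso_def W by (simp add: inv)
qed

lemma unitarily_equivalent_refl: "unitarily_equivalent G V \<rho> V \<rho>"
  unfolding unitarily_equivalent_def unitary_iso_def by (rule exI[of _ id]) auto

lemma unitary_rep_closed:
  "\<lbrakk>unitary_rep G T V \<rho>; g \<in> carrier G; x \<in> carrier V\<rbrakk> \<Longrightarrow> \<rho> g x \<in> carrier V"
  unfolding unitary_rep_def unitary_group_def hom_def Bij_def by (auto dest!: bij_betwE)

lemma unitarily_equivalent_sym:
  assumes "unitary_rep G T V \<rho>" and "unitarily_equivalent G V \<rho> W \<sigma>"
  shows "unitarily_equivalent G W \<sigma> V \<rho>"
proof -
  obtain u where u: "unitary_iso V W u"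
      "\<And>g x. \<lbrakk>g \<in> carrier G; x \<in> carrier V\<rbrakk> \<Longrightarrow> u (\<rho> g x) = \<sigma> g (u x)"
    using assms unfolding unitarily_equivalent_def by blast
  have V: "complex_inner_space V"
    using assms by (simp add: unitary_rep_def hilbert_space_def)
  have bij: "bij_betw u (carrier V) (carrier W)" using u by (simp add: unitary_iso_def)
  have "inv_into (carrier V) u (\<sigma> g y) = \<rho> g (inv_into (carrier V) u y)"
    if g: "g \<in> carrier G" and y: "y \<in> carrier W" for g y
  proof -
    obtain x where x: "x \<in> carrier V" "y = u x"
      using bij y by (auto simp: bij_betw_def)
    show ?thesis
      using u(2)[OF g x(1)] x bij unitary_rep_closed[OF assms(1) g x(1)]
      by (metis bij_betw_inv_into_left)
  qed
  then show ?thesis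
    using unitary_iso_inv[OF V u(1)] unfolding unitarily_equivalent_def by blast
qed

lemma unitarily_equivalent_trans:
  assumes "unitarily_equivalent G V \<rho> W \<sigma>" and "unitarily_equivalent G W \<sigma> X \<tau>"
  shows "unitarily_equivalent G V \<rho> X \<tau>"
proof -
  obtain u where u: "unitary_iso V W u" "\<forall>g\<in>carrier G. \<forall>x\<in>carrier V. u (\<rho> g x) = \<sigma> g (u x)"
    using assms unfolding unitarily_equivalent_def by blast
  obtain w where w: "unitary_iso W X w" "\<forall>g\<in>carrier G. \<forall>x\<in>carrier W. w (\<sigma> g x) = \<tau> g (w x)"
    using assms unfolding unitarily_equivalent_def by blast
  have "u x \<in> carrier W" if "x \<in> carrier V" for x
    using u that by (auto simp: unitary_iso_def dest: bij_betwE)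
  then show ?thesis
    unfolding unitarily_equivalent_def
    using unitary_iso_comp[OF u(1) w(1)] u w by (auto intro!: exI[of _ "w \<circ> u"])
qed

lemma equiv_rep_rel: "equiv {(V, \<rho>). unitary_rep G T V \<rho>} (rep_rel G T)"
proof (rule equivI)
  show "rep_rel G T \<subseteq> {(V, \<rho>). unitary_rep G T V \<rho>} \<times> {(V, \<rho>). unitary_rep G T V \<rho>}"
    by (auto simp: rep_rel_def)
  show "refl_on {(V, \<rho>). unitary_rep G T V \<rho>} (rep_rel G T)"
    by (auto simp: rep_rel_def refl_on_def unitarily_equivalent_refl)
  show "sym (rep_rel G T)"
    by (rule symI) (clarsimp simp: rep_rel_def, erule (1) unitarily_equivalent_sym)
  show "trans (rep_rel G T)"
    by (rule transI) (clarsimp simp: rep_rel_def, erule (1) unitarily_equivalent_trans)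
qed

lemma pos_def_funs_mono:
  assumes "unitary_rep G T V \<rho>" and "unitarily_equivalent G V \<rho> W \<sigma>"
  shows "pos_def_funs G (V, \<rho>) \<subseteq> pos_def_funs G (W, \<sigma>)"
proof -
  obtain u where u: "unitary_iso V W u" "\<forall>g\<in>carrier G. \<forall>x\<in>carrier V. u (\<rho> g x) = \<sigma> g (u x)"
    using assms unfolding unitarily_equivalent_def by blast
  have "elementary_pos_def_funs G (V, \<rho>) \<subseteq> elementary_pos_def_funs G (W, \<sigma>)"
  proof
    fix f assume "f \<in> elementary_pos_def_funs G (V, \<rho>)"
    then obtain v where v: "v \<in> carrier V" "f = (\<lambda>g\<in>carrier G. hinner V (\<rho> g v) v)"
      by (auto simp: elementary_pos_def_funs_def)
    have "hinner W (\<sigma> g (u v)) (u v) = hinner V (\<rho> g v) v" if g: "g \<in> carrier G" for g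
    proof -
      have "\<sigma> g (u v) = u (\<rho> g v)"
        using u(2) v(1) g by simp
      then show ?thesis
        using u(1) v(1) unitary_rep_closed[OF assms(1) g v(1)] by (simp add: unitary_iso_def)
    qed
    then have "f = (\<lambda>g\<in>carrier G. hinner W (\<sigma> g (u v)) (u v))"
      using v by (auto intro!: restrict_ext)
    moreover have "u v \<in> carrier W"
      using u v by (auto simp: unitary_iso_def dest: bij_betwE)
    ultimately show "f \<in> elementary_pos_def_funs G (W, \<sigma>)"
      unfolding elementary_pos_def_funs_def by blast
  qed
  note elem = subsetD[OF this]
  show ?thesis
    unfolding pos_def_funs_def
  proof (rule Collect_mono, intro impI, elim exE conjE)
    fix f p and n :: nat
    assume f: "f = (\<lambda>g\<in>carrier G. \<Sum>i<n. p i g)"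
      and p: "\<forall>i<n. p i \<in> elementary_pos_def_funs G (V, \<rho>)"
    have "\<forall>i<n. p i \<in> elementary_pos_def_funs G (W, \<sigma>)"
      using p elem by simp
    with f show "\<exists>(n::nat) p. f = (\<lambda>g\<in>carrier G. \<Sum>i<n. p i g) \<and>
        (\<forall>i<n. p i \<in> elementary_pos_def_funs G (W, \<sigma>))"
      by blast
  qed
qed

lemma class_pos_def_funs_eq:
  assumes "unitary_rep G T V \<rho>"
  shows "class_pos_def_funs G (rep_rel G T `` {(V, \<rho>)}) = pos_def_funs G (V, \<rho>)"
proof -
  have "pos_def_funs G (W, \<sigma>) = pos_def_funs G (V, \<rho>)"
    if "((V, \<rho>), (W, \<sigma>)) \<in> rep_rel G T" for W \<sigma>
  proof -
    have W: "unitary_rep G T W \<sigma>" "unitarily_equivalent G V \<rho> W \<sigma>"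
      using that by (auto simp: rep_rel_def)
    show ?thesis
      using pos_def_funs_mono[OF assms W(2)]
        pos_def_funs_mono[OF W(1) unitarily_equivalent_sym[OF assms W(2)]] by blast
  qed
  moreover have "((V, \<rho>), (V, \<rho>)) \<in> rep_rel G T"
    using assms unitarily_equivalent_refl by (auto simp: rep_rel_def)
  ultimately have c: "(V, \<rho>) \<in> rep_rel G T `` {(V, \<rho>)}"
    and P: "\<And>\<pi>. \<pi> \<in> rep_rel G T `` {(V, \<rho>)} \<Longrightarrow> pos_def_funs G \<pi> = pos_def_funs G (V, \<rho>)"
    by (blast, metis Image_singleton_iff surj_pair)
  have "class_pos_def_funs G (rep_rel G T `` {(V, \<rho>)}) =
      (\<Union>\<pi>\<in>rep_rel G T `` {(V, \<rho>)}. pos_def_funs G (V, \<rho>))"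
    unfolding class_pos_def_funs_def by (rule SUP_cong[OF refl P])
  then show ?thesis
    using c by (metis UN_constant empty_iff)
qed


subsection \<open>Every irreducible representation is accounted for in the dual object\<close>

lemma unitary_iso_hdist:
  assumes "complex_inner_space V" and "complex_inner_space W" and u: "unitary_iso V W u"
    and x: "x \<in> carrier V" and y: "y \<in> carrier V"
  shows "hdist W (u x) (u y) = hdist V x y"
proof -
  interpret V: complex_inner_space V by fact
  interpret W: complex_inner_space W by fact
  have "u x \<in> carrier W" "u y \<in> carrier W"
    using u x y by (auto simp: unitary_iso_def dest: bij_betwE)
  then show ?thesis
    using u x y by (simp add: hdist_def V.hinner_diff_left V.hinner_diff_right
        W.hinner_diff_left W.hinner_diff_right unitary_iso_def)
qed

lemma unitary_iso_continuous_map: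
  assumes V: "complex_inner_space V" and W: "complex_inner_space W" and u: "unitary_iso V W u"
  shows "continuous_map (norm_topology V) (norm_topology W) u"
proof -
  have "u ` carrier V \<subseteq> carrier W"
    using u by (auto simp: unitary_iso_def dest: bij_betwE)
  then show ?thesis
    unfolding norm_topology_def
      Metric_space.metric_continuous_map[OF complex_inner_space.Metric_space_hdist[OF V]
        complex_inner_space.Metric_space_hdist[OF W]]
    using unitary_iso_hdist[OF V W u] by auto
qed

lemma unitary_iso_hilbert_space:
  assumes V: "hilbert_space V" and W: "complex_inner_space W" and u: "unitary_iso V W u"
  shows "hilbert_space W"
proof -
  have V': "complex_inner_space V" using V by (simp add: hilbert_space_def)
  interpret MV: Metric_space "carrier V" "hdist V"
    by (rule complex_inner_space.Metric_space_hdist) fact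
  interpret MW: Metric_space "carrier W" "hdist W"
    by (rule complex_inner_space.Metric_space_hdist) fact
  let ?w = "inv_into (carrier V) u"
  have w: "unitary_iso W V ?w" by (rule unitary_iso_inv) fact+
  have bij: "bij_betw u (carrier V) (carrier W)" using u by (simp add: unitary_iso_def)
  have uw: "\<And>y. y \<in> carrier W \<Longrightarrow> u (?w y) = y"
    using bij by (simp add: bij_betw_inv_into_right)
  have "\<exists>y. limitin MW.mtopology s y sequentially" if s: "MW.MCauchy s" for s
  proof -
    have sW: "s n \<in> carrier W" for n
      using s unfolding MW.MCauchy_def by blast
    have "hdist V (?w (s m)) (?w (s n)) = hdist W (s m) (s n)" for m n
      by (rule unitary_iso_hdist) (use sW W V' w in auto)
    moreover have "?w (s n) \<in> carrier V" for n
      using w sW by (auto simp: unitary_iso_def dest: bij_betwE)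
    ultimately have "MV.MCauchy (\<lambda>n. ?w (s n))"
      using s unfolding MV.MCauchy_def MW.MCauchy_def by auto
    then obtain x where "limitin MV.mtopology (\<lambda>n. ?w (s n)) x sequentially"
      using V unfolding hilbert_space_def hilbert_space_axioms_def MV.mcomplete_def by blast
    then have "limitin MW.mtopology (u \<circ> (\<lambda>n. ?w (s n))) (u x) sequentially"
      using unitary_iso_continuous_map[OF V' W u] unfolding norm_topology_def
      by (rule continuous_map_limit[rotated])
    moreover have "u \<circ> (\<lambda>n. ?w (s n)) = s"
      using sW uw by auto
    ultimately show ?thesis by auto
  qed
  then show ?thesis
    using W by (simp add: hilbert_space_def hilbert_space_axioms_def MW.mcomplete_def)
qed

text \<open>Transport of structure along an injection.\<close>

definition transport :: "'v hilbert \<Rightarrow> ('v \<Rightarrow> 'w) \<Rightarrow> 'w hilbert" where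
  "transport V u = (let w = inv_into (carrier V) u in
    \<lparr>carrier = u ` carrier V, mult = undefined, one = undefined,
     zero = u \<zero>\<^bsub>V\<^esub>, add = (\<lambda>x y. u (w x \<oplus>\<^bsub>V\<^esub> w y)),
     smult = (\<lambda>c x. u (c \<odot>\<^bsub>V\<^esub> w x)), hinner = (\<lambda>x y. hinner V (w x) (w y))\<rparr>)"

lemma transport:
  assumes "complex_inner_space V" and inj: "inj_on u (carrier V)"
  shows "complex_inner_space (transport V u)" and "unitary_iso V (transport V u) u"
proof -
  interpret V: complex_inner_space V by fact
  let ?W = "transport V u"
  have car: "carrier ?W = u ` carrier V" by (simp add: transport_def Let_def)
  have zero: "\<zero>\<^bsub>?W\<^esub> = u \<zero>\<^bsub>V\<^esub>" by (simp add: transport_def Let_def)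
  have add: "u x \<oplus>\<^bsub>?W\<^esub> u y = u (x \<oplus>\<^bsub>V\<^esub> y)" if "x \<in> carrier V" "y \<in> carrier V" for x y
    using that inj by (simp add: transport_def Let_def)
  have scale: "c \<odot>\<^bsub>?W\<^esub> u x = u (c \<odot>\<^bsub>V\<^esub> x)" if "x \<in> carrier V" for c x
    using that inj by (simp add: transport_def Let_def)
  have inner: "hinner ?W (u x) (u y) = hinner V x y" if "x \<in> carrier V" "y \<in> carrier V" for x y
    using that inj by (simp add: transport_def Let_def)
  show "unitary_iso V ?W u"
    unfolding unitary_iso_def using inj by (simp add: car add scale inner bij_betw_def)
  have "module complex_ring ?W"
  proof (rule moduleI)
    show "abelian_group ?W"
    proof (rule abelian_groupI)
      fix x assume "x \<in> carrier ?W"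
      then obtain x' where x': "x' \<in> carrier V" "x = u x'" by (auto simp: car)
      then show "\<exists>y\<in>carrier ?W. y \<oplus>\<^bsub>?W\<^esub> x = \<zero>\<^bsub>?W\<^esub>"
        by (intro bexI[of _ "u (\<ominus>\<^bsub>V\<^esub> x')"]) (auto simp: car add zero V.M.l_neg)
    qed (auto simp: car zero add V.M.a_ac)
  qed (auto simp: car zero add scale cring_complex_ring V.scale_closed V.scale_one
      V.scale_add_left V.smult_r_distr V.smult_assoc1[simplified])
  moreover have "complex_inner_space_axioms ?W"
    by unfold_locales
      (auto simp: car zero add scale inner V.scale_closed V.hinner_add_left V.hinner_scale_left
        V.hinner_nonneg dest: V.hinner_definite intro: V.hinner_commute)
  ultimately show "complex_inner_space ?W"
    by (simp add: complex_inner_space_def)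
qed

lemma unitary_rep_iff:
  "unitary_rep G T V \<rho> \<longleftrightarrow> hilbert_space V \<and> \<rho> \<in> hom G (unitary_group V) \<and>
    (\<forall>g\<in>topspace T. \<rho> g \<in> carrier (unitary_group V)) \<and>
    (\<forall>v\<in>carrier V. continuous_map T (norm_topology V) (\<lambda>g. \<rho> g v))"
proof -
  have "\<rho> g \<in> extensional (carrier V)" if "\<rho> g \<in> carrier (unitary_group V)" for g
    using that by (simp add: unitary_group_def Bij_def)
  then show ?thesis
    unfolding unitary_rep_def strong_operator_topology_def continuous_map_in_subtopology
      continuous_map_componentwise by auto
qed

lemma carrier_unitary_group:
  "carrier (unitary_group V) = {u \<in> extensional (carrier V). unitary_iso V V u}"
  by (auto simp: unitary_group_def Bij_def unitary_iso_def)

lemma mult_unitary_group: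
  "\<lbrakk>u \<in> carrier (unitary_group V); w \<in> carrier (unitary_group V)\<rbrakk>
    \<Longrightarrow> u \<otimes>\<^bsub>unitary_group V\<^esub> w = compose (carrier V) u w"
  by (simp add: unitary_group_def BijGroup_def)

lemma unitary_rep_mult:
  assumes "unitary_rep G T V \<rho>" "g \<in> carrier G" "h \<in> carrier G" "x \<in> carrier V"
  shows "\<rho> (g \<otimes>\<^bsub>G\<^esub> h) x = \<rho> g (\<rho> h x)"
proof -
  have "\<rho> g \<in> carrier (unitary_group V)" "\<rho> h \<in> carrier (unitary_group V)"
    "\<rho> (g \<otimes>\<^bsub>G\<^esub> h) = \<rho> g \<otimes>\<^bsub>unitary_group V\<^esub> \<rho> h"
    using assms unfolding unitary_rep_def hom_def by auto
  then show ?thesis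
    using assms(4) by (simp add: mult_unitary_group compose_def)
qed

lemma unitary_rep_transport:
  assumes rep: "unitary_rep G T V \<rho>" and inj: "inj_on u (carrier V)"
  shows "\<exists>\<sigma>. unitary_rep G T (transport V u) \<sigma> \<and>
    (\<forall>g\<in>carrier G. \<forall>x\<in>carrier V. u (\<rho> g x) = \<sigma> g (u x))"
proof -
  let ?W = "transport V u"
  let ?w = "inv_into (carrier V) u"
  have V: "hilbert_space V" and V': "complex_inner_space V"
    using rep by (simp_all add: unitary_rep_def hilbert_space_def)
  have W': "complex_inner_space ?W" and u: "unitary_iso V ?W u"
    using transport[OF V' inj] by auto
  have W: "hilbert_space ?W"
    by (rule unitary_iso_hilbert_space) fact+
  have w: "unitary_iso ?W V ?w" by (rule unitary_iso_inv) fact+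
  have uV: "u x \<in> carrier ?W" if "x \<in> carrier V" for x
    using u that by (auto simp: unitary_iso_def dest: bij_betwE)
  have wW: "?w y \<in> carrier V" if "y \<in> carrier ?W" for y
    using w that by (auto simp: unitary_iso_def dest: bij_betwE)
  have wu: "?w (u x) = x" if "x \<in> carrier V" for x
    using inj that by simp
  define \<sigma> where "\<sigma> g = (\<lambda>y\<in>carrier ?W. u (\<rho> g (?w y)))" for g
  have unitary: "\<sigma> g \<in> carrier (unitary_group ?W)" if "\<rho> g \<in> carrier (unitary_group V)" for g
  proof -
    have "unitary_iso V V (\<rho> g)" using that by (simp add: carrier_unitary_group)
    then have 1: "unitary_iso ?W ?W (u \<circ> (\<rho> g \<circ> ?w))"
      using unitary_iso_comp[OF unitary_iso_comp[OF w] u] by (simp add: comp_assoc)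
    interpret W: complex_inner_space ?W by fact
    have "unitary_iso ?W ?W (\<sigma> g)"
      using 1 bij_betw_cong[of "carrier ?W" "\<sigma> g" "u \<circ> (\<rho> g \<circ> ?w)" "carrier ?W"]
      unfolding unitary_iso_def by (simp add: \<sigma>_def W.scale_closed)
    then show ?thesis
      by (simp add: carrier_unitary_group \<sigma>_def)
  qed
  have \<rho>: "\<rho> g \<in> carrier (unitary_group V)" if "g \<in> carrier G \<or> g \<in> topspace T" for g
    using that rep unfolding unitary_rep_iff hom_def by auto
  have "\<sigma> \<in> hom G (unitary_group ?W)"
  proof (rule homI)
    fix g h assume gh: "g \<in> carrier G" "h \<in> carrier G"
    have "\<sigma> (g \<otimes>\<^bsub>G\<^esub> h) y = compose (carrier ?W) (\<sigma> g) (\<sigma> h) y" for y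
    proof (cases "y \<in> carrier ?W")
      case True
      have c: "\<rho> h (?w y) \<in> carrier V"
        using unitary_rep_closed[OF rep gh(2) wW[OF True]] .
      then show ?thesis
        using True gh by (simp add: \<sigma>_def compose_def unitary_rep_mult[OF rep] wW uV wu)
    qed (simp add: \<sigma>_def compose_def)
    then show "\<sigma> (g \<otimes>\<^bsub>G\<^esub> h) = \<sigma> g \<otimes>\<^bsub>unitary_group ?W\<^esub> \<sigma> h"
      using gh \<rho> unitary by (subst mult_unitary_group) auto
  qed (use \<rho> unitary in auto)
  moreover have "continuous_map T (norm_topology ?W) (\<lambda>g. \<sigma> g y)" if y: "y \<in> carrier ?W" for y
  proof -
    have "continuous_map T (norm_topology V) (\<lambda>g. \<rho> g (?w y))"
      using rep wW[OF y] by (simp add: unitary_rep_iff)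
    then have "continuous_map T (norm_topology ?W) (u \<circ> (\<lambda>g. \<rho> g (?w y)))"
      using unitary_iso_continuous_map[OF V' W' u] continuous_map_compose by blast
    then show ?thesis
      using y by (simp add: \<sigma>_def comp_def)
  qed
  ultimately have "unitary_rep G T ?W \<sigma>"
    using W \<rho> unitary by (simp add: unitary_rep_iff)
  then show ?thesis
    by (intro exI[of _ \<sigma>]) (auto simp: \<sigma>_def uV wu)
qed

lemma irreducible_rep_equivalent:
  assumes irr: "irreducible_rep G T V \<rho>" and W: "unitary_rep G T W \<sigma>"
    and eq: "unitarily_equivalent G V \<rho> W \<sigma>"
  shows "irreducible_rep G T W \<sigma>"
proof -
  have rep: "unitary_rep G T V \<rho>" using irr by (simp add: irreducible_rep_def)
  have V': "complex_inner_space V" and W': "complex_inner_space W"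
    using rep W by (simp_all add: unitary_rep_def hilbert_space_def)
  interpret V: complex_inner_space V by fact
  interpret W: complex_inner_space W by fact
  obtain u where u: "unitary_iso V W u"
    and eqv: "\<forall>g\<in>carrier G. \<forall>x\<in>carrier V. u (\<rho> g x) = \<sigma> g (u x)"
    using eq unfolding unitarily_equivalent_def by blast
  have bij: "bij_betw u (carrier V) (carrier W)" using u by (simp add: unitary_iso_def)
  have uV: "u x \<in> carrier W" if "x \<in> carrier V" for x
    using bij that by (auto dest: bij_betwE)
  have u_add: "u (x \<oplus>\<^bsub>V\<^esub> y) = u x \<oplus>\<^bsub>W\<^esub> u y" if "x \<in> carrier V" "y \<in> carrier V" for x y
    using u that by (simp add: unitary_iso_def)
  have u_scale: "u (c \<odot>\<^bsub>V\<^esub> x) = c \<odot>\<^bsub>W\<^esub> u x" if "x \<in> carrier V" for c x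
    using u that by (simp add: unitary_iso_def)
  have u_zero: "u \<zero>\<^bsub>V\<^esub> = \<zero>\<^bsub>W\<^esub>"
    using u_scale[of "\<zero>\<^bsub>V\<^esub>" 0] by (simp add: V.scale_zero W.scale_zero uV)
  have inj: "inj_on u (carrier V)" and img: "u ` carrier V = carrier W"
    using bij by (auto simp: bij_betw_def)
  have "carrier W \<noteq> {\<zero>\<^bsub>W\<^esub>}"
  proof
    assume "carrier W = {\<zero>\<^bsub>W\<^esub>}"
    then have "carrier V = {\<zero>\<^bsub>V\<^esub>}"
    proof -
      have "x = \<zero>\<^bsub>V\<^esub>" if x: "x \<in> carrier V" for x
      proof (rule inj_onD[OF inj])
        show "u x = u \<zero>\<^bsub>V\<^esub>"
          using uV[OF x] u_zero \<open>carrier W = {\<zero>\<^bsub>W\<^esub>}\<close> by simp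
      qed (use x in auto)
      then show ?thesis by auto
    qed
    then show False using irr by (simp add: irreducible_rep_def)
  qed
  moreover have False
    if E: "closed_invariant_subspace G W \<sigma> E" and E1: "{\<zero>\<^bsub>W\<^esub>} \<subset> E" and E2: "E \<subset> carrier W" for E
  proof -
    define D where "D = {x \<in> carrier V. u x \<in> E}"
    have E': "submodule E complex_ring W" "closedin (norm_topology W) E"
      and E_inv: "\<And>g y. \<lbrakk>g \<in> carrier G; y \<in> E\<rbrakk> \<Longrightarrow> \<sigma> g y \<in> E"
      using E unfolding closed_invariant_subspace_def by auto
    note E_sub = W.submoduleE[OF E'(1)]
    have "submodule D complex_ring V"
    proof (rule V.submoduleI)
      show "D \<subseteq> carrier V" by (auto simp: D_def)
      show "\<zero>\<^bsub>V\<^esub> \<in> D" using E1 by (simp add: D_def u_zero psubset_eq)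
      show add: "x \<oplus>\<^bsub>V\<^esub> y \<in> D" if "x \<in> D" "y \<in> D" for x y
        using that E_sub(5) by (simp add: D_def u_add)
      show scale: "c \<odot>\<^bsub>V\<^esub> x \<in> D" if "x \<in> D" for c x
        using that E_sub(4) by (simp add: D_def V.scale_closed u_scale)
      show "\<ominus>\<^bsub>V\<^esub> x \<in> D" if "x \<in> D" for x
        using scale[OF that, of "- 1"] that by (simp add: D_def V.uminus_eq)
    qed
    moreover have "closedin (norm_topology V) D"
    proof -
      have "topspace (norm_topology V) = carrier V"
        unfolding norm_topology_def
        by (rule Metric_space.topspace_mtopology[OF V.Metric_space_hdist])
      then show ?thesis
        using closedin_continuous_map_preimage[OF unitary_iso_continuous_map[OF V' W' u] E'(2)]
        by (simp only: D_def)
    qed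
    moreover have "\<rho> g ` D \<subseteq> D" if g: "g \<in> carrier G" for g
    proof (rule image_subsetI)
      fix x assume "x \<in> D"
      then have x: "x \<in> carrier V" "u x \<in> E" by (simp_all add: D_def)
      have "u (\<rho> g x) = \<sigma> g (u x)" using eqv g x(1) by blast
      then show "\<rho> g x \<in> D"
        using E_inv[OF g x(2)] unitary_rep_closed[OF rep g x(1)] by (simp add: D_def)
    qed
    ultimately have "closed_invariant_subspace G V \<rho> D"
      by (simp add: closed_invariant_subspace_def)
    moreover have "{\<zero>\<^bsub>V\<^esub>} \<subset> D"
    proof -
      obtain y where y: "y \<in> E" "y \<noteq> \<zero>\<^bsub>W\<^esub>" and "\<zero>\<^bsub>W\<^esub> \<in> E" using E1 by blast
      have "y \<in> u ` carrier V" using E2 y(1) by (auto simp: img)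
      then obtain x where x: "x \<in> carrier V" "u x = y" by blast
      have "x \<in> D" using x y(1) by (simp add: D_def)
      moreover have "x \<noteq> \<zero>\<^bsub>V\<^esub>" using x(2) y(2) u_zero by metis
      moreover have "\<zero>\<^bsub>V\<^esub> \<in> D" using \<open>\<zero>\<^bsub>W\<^esub> \<in> E\<close> by (simp add: D_def u_zero)
      ultimately show ?thesis by blast
    qed
    moreover have "D \<subset> carrier V"
    proof -
      obtain y where "y \<in> carrier W" "y \<notin> E" using E2 by blast
      then have "y \<in> u ` carrier V" by (simp add: img)
      then obtain x where x: "x \<in> carrier V" "u x = y" by blast
      then have "x \<notin> D" using \<open>y \<notin> E\<close> by (simp add: D_def)
      moreover have "D \<subseteq> carrier V" by (auto simp: D_def)
      ultimately show ?thesis using x(1) by blast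
    qed
    ultimately have "\<exists>E. closed_invariant_subspace G V \<rho> E \<and> {\<zero>\<^bsub>V\<^esub>} \<subset> E \<and> E \<subset> carrier V"
      by (intro exI[of _ D]) simp
    then show False
      using irr by (simp add: irreducible_rep_def)
  qed
  ultimately show ?thesis
    using W by (auto simp only: irreducible_rep_def)
qed

lemma irreducible_rep_small:
  fixes G :: "('g, 'm) monoid_scheme" and V :: "'v hilbert"
  assumes G: "group G" and irr: "irreducible_rep G T V \<rho>"
  shows "\<exists>(W :: ('g \<Rightarrow> complex) hilbert) \<sigma>.
    irreducible_rep G T W \<sigma> \<and> unitarily_equivalent G V \<rho> W \<sigma>"
proof -
  interpret G: group G by fact
  have rep: "unitary_rep G T V \<rho>" using irr by (simp add: irreducible_rep_def)
  have V': "complex_inner_space V"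
    using rep by (simp add: unitary_rep_def hilbert_space_def)
  interpret V: complex_inner_space V by fact
  interpret M: Metric_space "carrier V" "hdist V" by (rule V.Metric_space_hdist)
  note cl = unitary_rep_closed[OF rep]
  have iso: "unitary_iso V V (\<rho> g)" if "g \<in> carrier G" for g
    using rep that by (auto simp: unitary_rep_def hom_def carrier_unitary_group)
  have one: "\<rho> \<one>\<^bsub>G\<^esub> x = x" if x: "x \<in> carrier V" for x
  proof -
    have "inj_on (\<rho> \<one>\<^bsub>G\<^esub>) (carrier V)"
      using iso[of "\<one>\<^bsub>G\<^esub>"] by (simp add: unitary_iso_def bij_betw_def)
    moreover have "\<rho> \<one>\<^bsub>G\<^esub> (\<rho> \<one>\<^bsub>G\<^esub> x) = \<rho> \<one>\<^bsub>G\<^esub> x"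
      using unitary_rep_mult[OF rep, of "\<one>\<^bsub>G\<^esub>" "\<one>\<^bsub>G\<^esub>" x] x by simp
    ultimately show ?thesis
      using x cl[of "\<one>\<^bsub>G\<^esub>" x] by (simp add: inj_on_eq_iff)
  qed
  obtain e where e: "e \<in> carrier V" "e \<noteq> \<zero>\<^bsub>V\<^esub>"
    using irr V.M.zero_closed unfolding irreducible_rep_def by blast
  define N where "N = {w \<in> carrier V. \<forall>g\<in>carrier G. hinner V (\<rho> g e) w = 0}"
  have "submodule N complex_ring V"
    by (rule V.submoduleI)
      (use cl e in \<open>auto simp: N_def V.hinner_zero_right V.hinner_add_right V.hinner_scale_right
        V.uminus_eq V.scale_closed\<close>)
  moreover have "closedin (norm_topology V) N"
    unfolding norm_topology_def M.closedin_metric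
  proof (intro conjI allI impI)
    show "N \<subseteq> carrier V" by (auto simp: N_def)
    fix x assume "x \<in> carrier V - N"
    then obtain g where x: "x \<in> carrier V" and g: "g \<in> carrier G" "hinner V (\<rho> g e) x \<noteq> 0"
      by (auto simp: N_def)
    define s where "s = sqrt (Re (hinner V (\<rho> g e) (\<rho> g e)))"
    define r where "r = cmod (hinner V (\<rho> g e) x) / (s + 1)"
    have s: "s \<ge> 0" using cl g e V.hinner_nonneg by (simp add: s_def)
    have "\<not> hdist V x y < r" if y: "y \<in> N" for y
    proof -
      have yV: "y \<in> carrier V" using y by (simp add: N_def)
      have "hinner V (\<rho> g e) (x \<ominus>\<^bsub>V\<^esub> y) = hinner V (\<rho> g e) x"
        using x y yV g e cl by (simp add: V.hinner_diff_right N_def)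
      then have "cmod (hinner V (\<rho> g e) x) \<le> s * hdist V x y"
        using V.cauchy_schwarz[of "\<rho> g e" "x \<ominus>\<^bsub>V\<^esub> y"] x yV g e cl by (simp add: s_def hdist_def)
      also have "\<dots> \<le> (s + 1) * hdist V x y"
        by (intro mult_right_mono) auto
      finally show ?thesis
        using s by (simp add: r_def not_less field_simps)
    qed
    moreover have "r > 0" using s g by (simp add: r_def)
    ultimately show "\<exists>r>0. disjnt N (M.mball x r)"
      by (intro exI[of _ r]) (auto simp: disjnt_iff)
  qed
  moreover have "\<rho> h ` N \<subseteq> N" if h: "h \<in> carrier G" for h
  proof
    fix y assume "y \<in> \<rho> h ` N"
    then obtain w where w: "w \<in> N" "y = \<rho> h w" by blast
    then have wV: "w \<in> carrier V" by (simp add: N_def)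
    have "hinner V (\<rho> g e) (\<rho> h w) = 0" if g: "g \<in> carrier G" for g
    proof -
      define k where "k = inv\<^bsub>G\<^esub> h \<otimes>\<^bsub>G\<^esub> g"
      have k: "k \<in> carrier G" "h \<otimes>\<^bsub>G\<^esub> k = g"
        using g h by (simp_all add: k_def G.m_assoc[symmetric])
      have "hinner V (\<rho> g e) (\<rho> h w) = hinner V (\<rho> h (\<rho> k e)) (\<rho> h w)"
        using unitary_rep_mult[OF rep h k(1) e(1)] k by simp
      also have "\<dots> = hinner V (\<rho> k e) w"
        using iso[OF h] cl[OF k(1) e(1)] wV by (simp add: unitary_iso_def)
      finally show ?thesis using w k by (simp add: N_def)
    qed
    then show "y \<in> N" using w wV cl h by (simp add: N_def)
  qed
  ultimately have "closed_invariant_subspace G V \<rho> N"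
    by (simp add: closed_invariant_subspace_def)
  moreover have "N \<subset> carrier V"
  proof -
    have "e \<notin> N"
      using e one V.hinner_definite[of e] G.one_closed by (force simp: N_def)
    then show ?thesis using e by (auto simp: N_def)
  qed
  moreover have "\<zero>\<^bsub>V\<^esub> \<in> N"
    using cl e by (simp add: N_def V.hinner_zero_right)
  ultimately have N: "N = {\<zero>\<^bsub>V\<^esub>}"
    using irr unfolding irreducible_rep_def by blast
  define u where "u v g = (if g \<in> carrier G then hinner V (\<rho> g e) v else 0)" for v g
  have "inj_on u (carrier V)"
  proof (rule inj_onI)
    fix v w assume vw: "v \<in> carrier V" "w \<in> carrier V" "u v = u w"
    have "hinner V (\<rho> g e) v = hinner V (\<rho> g e) w" if "g \<in> carrier G" for g
      using fun_cong[OF vw(3), of g] that by (simp add: u_def)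
    then have "v \<ominus>\<^bsub>V\<^esub> w \<in> N"
      using vw cl e by (simp add: N_def V.hinner_diff_right)
    then show "v = w"
      using vw N V.diff_eq_zero by simp
  qed
  then obtain \<sigma> where \<sigma>: "unitary_rep G T (transport V u) \<sigma>"
      "\<forall>g\<in>carrier G. \<forall>x\<in>carrier V. u (\<rho> g x) = \<sigma> g (u x)"
      "unitary_iso V (transport V u) u"
    using unitary_rep_transport[OF rep] transport(2)[OF V'] by blast
  then have "unitarily_equivalent G V \<rho> (transport V u) \<sigma>"
    unfolding unitarily_equivalent_def by blast
  then show ?thesis
    using irreducible_rep_equivalent[OF irr \<sigma>(1)] \<sigma>(1) by blast
qed

end

theory Submission
  imports Defs "HOL-Algebra.Generated_Groups" "HOL-Complex_Analysis.Great_Picard"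
begin

text \<open>
  A compact group carries an invariant mean, obtained as in von Neumann's treatment of almost
  periodic functions: averages of translates of a continuous function come arbitrarily close to
  constants. With convolution operators this yields a family of pairwise orthogonal
  finite-dimensional unitary representations that separates points.

  If the group is not metrizable, a maximal chain of metrizable quotients with compatible sequences,
  each meeting every nonempty open set infinitely often, produces an uncountable subfamily whose
  common kernel \<open>N\<close> has separable quotient. The dense subgroup is the preimage of a countable dense
  subgroup of the quotient by \<open>N\<close>. A compact subset \<open>C\<close> of it has countable image there, hence a
  countable base, so among uncountably many representations \<open>u\<close> of one dimension \<open>n\<close> two are
  uniformly close on \<open>C\<close>. For such \<open>u\<close> and \<open>v\<close> the representation \<open>A \<mapsto> u(g) A v(g)\<^sup>*\<close> on matrices has
  no nonzero fixed vector, but moves the identity matrix very little on \<open>C\<close>. As its dimension is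
  \<open>n\<^sup>2\<close>, independently of \<open>C\<close>, some irreducible constituent also has a vector that is almost fixed on
  \<open>C\<close>. Hence the trivial representation is not isolated in the dual.
\<close>


section \<open>Averages of translates\<close>

text \<open>Orthogonality of the coefficients of \<open>u\<close> and \<open>v\<close> says
  precisely that the entries of \<open>tensor u v\<close> have mean 0; this excludes vectors fixed
  by the group, and density excludes vectors fixed by the subgroup.

  The order of the choices shapes the proof. Passing to an irreducible constituent costs at most a
  factor 2 per dimension lost, so the total loss is bounded in terms of \<open>n\<close>; as
  \<open>n\<close> is fixed before the compact set, \<open>u\<close> and \<open>v\<close> can be
  taken close enough on it to absorb the loss.

  The quotient has to be separable and yet carry uncountably many representations. Countably many
  coefficients cannot separate the points of a non-metrizable compact group, so countable stages can
  always be extended; the difficulty is to keep a dense sequence through limits, and it is met by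
  carrying nested closed classes instead of points.

  The positive definite functions of the trivial representation are nonnegative constants, so a
  single unit vector almost fixed on the compact set approximates all of them after scaling.\<close>

lemma continuous_map_complex_mult:
  fixes f g :: "'a \<Rightarrow> complex"
  shows "\<lbrakk>continuous_map X euclidean f; continuous_map X euclidean g\<rbrakk>
    \<Longrightarrow> continuous_map X euclidean (\<lambda>x. f x * g x)"
  by (simp add: continuous_map_atin tendsto_mult)

lemma continuous_map_cnj:
  "continuous_map X euclidean f \<Longrightarrow> continuous_map X euclidean (\<lambda>x. cnj (f x))"
  by (simp add: continuous_map_atin tendsto_cnj)

text \<open>By continuity the set where \<open>F x y\<close> is within \<open>e\<close> of
  \<open>F x0 y\<close> is open, and it contains the slice over \<open>x0\<close>; the tube lemma
  uses that \<open>Y\<close> is compact. The uniform estimates for translates, means and kernels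
  below rest on it.\<close>

lemma continuous_map_tube:
  fixes F :: "'b \<Rightarrow> 'c \<Rightarrow> complex"
  assumes F: "continuous_map (prod_topology X Y) euclidean (\<lambda>(x, y). F x y)"
    and Y: "compact_space Y" and x0: "x0 \<in> topspace X" and e: "e > 0"
  shows "\<exists>U. openin X U \<and> x0 \<in> U \<and> (\<forall>x\<in>U. \<forall>y\<in>topspace Y. cmod (F x y - F x0 y) < e)"
proof -
  have "continuous_map (prod_topology X Y) euclidean (\<lambda>p. F (fst p) (snd p))"
    using F by (simp add: case_prod_unfold)
  moreover have "continuous_map (prod_topology X Y) euclidean (\<lambda>p. F x0 (snd p))"
  proof -
    have "continuous_map (prod_topology X Y) (prod_topology X Y) (\<lambda>p. (x0, snd p))"
      using x0 by (simp add: continuous_map_pairwise comp_def continuous_map_snd)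
    from continuous_map_compose[OF this F] show ?thesis by (simp add: comp_def)
  qed
  ultimately have "continuous_map (prod_topology X Y) euclidean
      (\<lambda>p. cmod (F (fst p) (snd p) - F x0 (snd p)))"
    by (intro continuous_map_norm continuous_map_diff)
  from openin_continuous_map_preimage[OF this, of "{..<e}"]
  have "openin (prod_topology X Y)
      {p \<in> topspace (prod_topology X Y). cmod (F (fst p) (snd p) - F x0 (snd p)) \<in> {..<e}}"
    by simp
  from tube_lemma_right[OF this, of "topspace Y" x0] Y x0 e
  have "\<exists>U V. openin X U \<and> openin Y V \<and> x0 \<in> U \<and> topspace Y \<subseteq> V \<and>
      U \<times> V \<subseteq> {p \<in> topspace (prod_topology X Y). cmod (F (fst p) (snd p) - F x0 (snd p)) < e}"
    unfolding compact_space_def by fastforce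
  then obtain U V where "openin X U" "openin Y V" "x0 \<in> U" "topspace Y \<subseteq> V"
      and UV: "U \<times> V \<subseteq> {p \<in> topspace (prod_topology X Y). cmod (F (fst p) (snd p) - F x0 (snd p)) < e}"
    by blast
  then show ?thesis by (intro exI[of _ U]) fastforce
qed


text \<open>Right averages over \<open>G\<close> are left averages over \<open>opp G\<close>, so
  each fact about left averages also yields its mirror image.\<close>

definition opp :: "('a, 'm) monoid_scheme \<Rightarrow> ('a, 'm) monoid_scheme" where
  "opp G = G\<lparr>mult := \<lambda>x y. y \<otimes>\<^bsub>G\<^esub> x\<rparr>"

lemma opp_simps [simp]:
  "carrier (opp G) = carrier G" "x \<otimes>\<^bsub>opp G\<^esub> y = y \<otimes>\<^bsub>G\<^esub> x" "\<one>\<^bsub>opp G\<^esub> = \<one>\<^bsub>G\<^esub>"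
  by (simp_all add: opp_def)

lemma (in group) group_opp: "group (opp G)"
proof (rule groupI)
  show "\<exists>y\<in>carrier (opp G). y \<otimes>\<^bsub>opp G\<^esub> x = \<one>\<^bsub>opp G\<^esub>" if "x \<in> carrier (opp G)" for x
    using that by (intro bexI[of _ "inv x"]) auto
qed (auto simp: m_assoc)

lemma (in group) inv_opp: "x \<in> carrier G \<Longrightarrow> inv\<^bsub>opp G\<^esub> x = inv x"
  using group.inv_equality[OF group_opp, of "inv x" x] by simp


section \<open>Uniform continuity and finite covers in a compact group\<close>

locale compact_group = topological_group +
  assumes compact: "compact_space T"
begin

lemma continuous_map_gmult:
  assumes "continuous_map X T f" "continuous_map X T g"
  shows "continuous_map X T (\<lambda>x. f x \<otimes> g x)"
proof -
  have "continuous_map X (prod_topology T T) (\<lambda>x. (f x, g x))"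
    using assms by (simp add: continuous_map_pairwise comp_def)
  from continuous_map_compose[OF this continuous_mult] show ?thesis
    by (simp add: comp_def)
qed

lemma continuous_map_inv:
  "continuous_map X T f \<Longrightarrow> continuous_map X T (\<lambda>x. inv (f x))"
  using continuous_map_compose[OF _ continuous_inv] by (simp add: comp_def)

lemma continuous_map_ltrans: "a \<in> carrier G \<Longrightarrow> continuous_map T T (\<lambda>x. a \<otimes> x)"
  by (intro continuous_map_gmult) (auto simp: topspace_eq)

lemma continuous_map_rtrans: "a \<in> carrier G \<Longrightarrow> continuous_map T T (\<lambda>x. x \<otimes> a)"
  by (intro continuous_map_gmult) (auto simp: topspace_eq)

lemma continuous_map_comp2:
  "continuous_map T euclidean f \<Longrightarrow> continuous_map X T g \<Longrightarrow> continuous_map X euclidean (\<lambda>x. f (g x))"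
  using continuous_map_compose[of X T g euclidean f] by (simp add: comp_def)

lemma compact_group_opp: "compact_group (opp G) T"
proof -
  have "continuous_map (prod_topology T T) T (\<lambda>(x, y). y \<otimes> x)"
    unfolding case_prod_unfold
    by (intro continuous_map_gmult) (auto simp: continuous_map_fst continuous_map_snd)
  moreover have "continuous_map T T (\<lambda>x. inv\<^bsub>opp G\<^esub> x)"
    using continuous_inv by (rule continuous_map_eq) (simp add: inv_opp topspace_eq)
  ultimately have "topological_group (opp G) T"
    using group_opp Hausdorff topspace_eq
    by (simp add: topological_group_def topological_group_axioms_def)
  then show ?thesis
    using compact by (simp add: compact_group_def compact_group_axioms_def)
qed

text \<open>The perturbation \<open>w\<close> stands on the right because left averages commute with
  right translations: the same \<open>W\<close> then serves for every average of \<open>f\<close>,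
  see \<open>lmeans_equicontinuous\<close>.\<close>

lemma uniformly_continuous_right:
  assumes "continuous_map T euclidean (f :: 'a \<Rightarrow> complex)" "e > 0"
  shows "\<exists>W. openin T W \<and> \<one> \<in> W \<and> (\<forall>w\<in>W. \<forall>x\<in>carrier G. cmod (f (x \<otimes> w) - f x) < e)"
proof -
  have "continuous_map (prod_topology T T) euclidean (\<lambda>(w, x). f (x \<otimes> w))"
    unfolding case_prod_unfold
    by (intro continuous_map_comp2[OF assms(1)] continuous_map_gmult)
      (auto simp: continuous_map_fst continuous_map_snd)
  from continuous_map_tube[OF this compact _ assms(2), of \<one>]
  obtain W where "openin T W" "\<one> \<in> W"
      "\<And>w x. \<lbrakk>w \<in> W; x \<in> carrier G\<rbrakk> \<Longrightarrow> cmod (f (x \<otimes> w) - f (x \<otimes> \<one>)) < e"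
    unfolding topspace_eq by blast
  then show ?thesis by (intro exI[of _ W]) simp
qed

text \<open>A list, and not a finite set, because an average \<open>lavg\<close> is later formed
  from it by mapping \<open>t\<close> to \<open>x0 \<otimes> inv t\<close>.\<close>

lemma finite_translates:
  assumes "openin T W" "\<one> \<in> W"
  shows "\<exists>ts. ts \<noteq> [] \<and> set ts \<subseteq> carrier G \<and> (\<forall>x\<in>carrier G. \<exists>t\<in>set ts. \<exists>w\<in>W. x = t \<otimes> w)"
proof -
  have W: "W \<subseteq> carrier G" using assms openin_subset topspace_eq by blast
  define V where "V t = {x \<in> carrier G. inv t \<otimes> x \<in> W}" for t
  have "openin T (V t)" if "t \<in> carrier G" for t
    using openin_continuous_map_preimage[OF continuous_map_ltrans assms(1), of "inv t"] that
    by (simp add: V_def topspace_eq)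
  moreover have "topspace T \<subseteq> \<Union>(V ` carrier G)"
  proof
    fix x assume "x \<in> topspace T"
    then have "x \<in> V x" "x \<in> carrier G" using assms by (auto simp: V_def topspace_eq)
    then show "x \<in> \<Union>(V ` carrier G)" by blast
  qed
  ultimately obtain \<F> where "finite \<F>" "\<F> \<subseteq> V ` carrier G" "topspace T \<subseteq> \<Union>\<F>"
    using compactinD[of T "topspace T" "V ` carrier G"] compact by (auto simp: compact_space_def)
  then obtain F where F: "finite F" "F \<subseteq> carrier G" "topspace T \<subseteq> \<Union>(V ` F)"
    by (metis finite_subset_image)
  then have "F \<noteq> {}" using topspace_eq one_closed by auto
  obtain ts where ts: "set ts = F" using F finite_list by blast
  have "\<exists>t\<in>set ts. \<exists>w\<in>W. x = t \<otimes> w" if x: "x \<in> carrier G" for x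
  proof -
    obtain t where t: "t \<in> F" "x \<in> V t" using F x topspace_eq by blast
    then have "x = t \<otimes> (inv t \<otimes> x)" "inv t \<otimes> x \<in> W"
      using F x by (auto simp: V_def m_assoc[symmetric])
    then show ?thesis using t ts by blast
  qed
  then show ?thesis using F ts \<open>F \<noteq> {}\<close> by (intro exI[of _ ts]) auto
qed

lemma continuous_bounded:
  assumes "continuous_map T euclidean (f :: 'a \<Rightarrow> complex)"
  shows "\<exists>B. \<forall>x\<in>carrier G. cmod (f x) \<le> B"
proof -
  have "compactin euclidean (f ` topspace T)"
    using assms compact image_compactin compact_space_def by blast
  then have "bounded (f ` carrier G)"
    by (simp add: topspace_eq compact_imp_bounded)
  then show ?thesis by (auto simp: bounded_iff)
qed

end


section \<open>Iterated averages over left translates\<close>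

definition lavg :: "('a, 'm) monoid_scheme \<Rightarrow> 'a list \<Rightarrow> ('a \<Rightarrow> complex) \<Rightarrow> 'a \<Rightarrow> complex" where
  "lavg G as f x = (\<Sum>a\<leftarrow>as. f (a \<otimes>\<^bsub>G\<^esub> x)) / of_nat (length as)"

text \<open>These are operators and not single averaged functions, so that one average can be
  applied to several functions at once; additivity of the mean and Fubini depend on that. Allowing
  iteration makes the set closed under composition.\<close>

inductive_set lmeans :: "('a, 'm) monoid_scheme \<Rightarrow> (('a \<Rightarrow> complex) \<Rightarrow> 'a \<Rightarrow> complex) set"
  for G where
  id: "(\<lambda>f. f) \<in> lmeans G"
| step: "\<lbrakk>as \<noteq> []; set as \<subseteq> carrier G; \<Phi> \<in> lmeans G\<rbrakk> \<Longrightarrow> (\<lambda>f. lavg G as (\<Phi> f)) \<in> lmeans G"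

lemma lavg_linear:
  "lavg G as (\<lambda>x. f x + g x) = (\<lambda>x. lavg G as f x + lavg G as g x)"
  "lavg G as (\<lambda>x. c * f x) = (\<lambda>x. c * lavg G as f x)"
  "as \<noteq> [] \<Longrightarrow> lavg G as (\<lambda>x. c) = (\<lambda>x. c)"
  "lavg G as (\<lambda>x. cnj (f x)) = (\<lambda>x. cnj (lavg G as f x))"
proof -
  have "cnj (sum_list xs) = sum_list (map cnj xs)" for xs by (induction xs) auto
  then show "lavg G as (\<lambda>x. cnj (f x)) = (\<lambda>x. cnj (lavg G as f x))"
    by (simp add: lavg_def comp_def fun_eq_iff)
qed (auto simp: lavg_def sum_list_addf add_divide_distrib sum_list_const_mult sum_list_triv)

lemma lmeans_add: "\<Phi> \<in> lmeans G \<Longrightarrow> \<Phi> (\<lambda>x. f x + g x) = (\<lambda>x. \<Phi> f x + \<Phi> g x)"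
  by (induction rule: lmeans.induct) (simp_all add: lavg_linear)

lemma lmeans_scale: "\<Phi> \<in> lmeans G \<Longrightarrow> \<Phi> (\<lambda>x. c * f x) = (\<lambda>x. c * \<Phi> f x)"
  by (induction rule: lmeans.induct) (simp_all add: lavg_linear)

lemma lmeans_const: "\<Phi> \<in> lmeans G \<Longrightarrow> \<Phi> (\<lambda>x. c) = (\<lambda>x. c)"
  by (induction rule: lmeans.induct) (simp_all add: lavg_linear)

lemma lmeans_cnj: "\<Phi> \<in> lmeans G \<Longrightarrow> \<Phi> (\<lambda>x. cnj (f x)) = (\<lambda>x. cnj (\<Phi> f x))"
  by (induction rule: lmeans.induct) (simp_all add: lavg_linear)

lemma lmeans_diff: "\<Phi> \<in> lmeans G \<Longrightarrow> \<Phi> (\<lambda>x. f x - g x) = (\<lambda>x. \<Phi> f x - \<Phi> g x)"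
  using lmeans_add[of \<Phi> G f "\<lambda>x. (-1) * g x"] lmeans_scale[of \<Phi> G "-1" g] by simp

lemma lmeans_comp: "\<lbrakk>\<Psi> \<in> lmeans G; \<Phi> \<in> lmeans G\<rbrakk> \<Longrightarrow> (\<lambda>f. \<Psi> (\<Phi> f)) \<in> lmeans G"
  by (induction rule: lmeans.induct) (simp_all add: lmeans.step)

lemma sum_list_bound:
  fixes h :: "'b \<Rightarrow> 'c::real_normed_vector"
  shows "(\<And>a. a \<in> set as \<Longrightarrow> norm (h a) \<le> B) \<Longrightarrow> norm (\<Sum>a\<leftarrow>as. h a) \<le> real (length as) * B"
proof (induction as)
  case (Cons a as)
  then have "norm (h a + (\<Sum>a\<leftarrow>as. h a)) \<le> B + real (length as) * B"
    by (intro norm_triangle_mono) auto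
  then show ?case by (simp add: algebra_simps)
qed simp

context group
begin

lemma lavg_bound:
  assumes "as \<noteq> []" "\<And>a. a \<in> set as \<Longrightarrow> cmod (f (a \<otimes> x)) \<le> B"
  shows "cmod (lavg G as f x) \<le> B"
  using sum_list_bound[of as "\<lambda>a. f (a \<otimes> x)" B] assms
  by (simp add: lavg_def norm_divide divide_le_eq mult.commute)

lemma lmeans_bound:
  "\<lbrakk>\<Phi> \<in> lmeans G; \<forall>x\<in>carrier G. cmod (f x) \<le> B; x \<in> carrier G\<rbrakk> \<Longrightarrow> cmod (\<Phi> f x) \<le> B"
proof (induction arbitrary: x rule: lmeans.induct)
  case (step as \<Phi>)
  then show ?case by (intro lavg_bound) auto
qed simp

lemma lmeans_close:
  assumes "\<Phi> \<in> lmeans G" "\<forall>x\<in>carrier G. cmod (f x - c) \<le> B" "x \<in> carrier G"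
  shows "cmod (\<Phi> f x - c) \<le> B"
  using lmeans_bound[OF assms(1), of "\<lambda>x. f x - c"] assms
  by (simp add: lmeans_diff[OF assms(1)] lmeans_const[OF assms(1)])

lemma lmeans_cong:
  assumes "\<Phi> \<in> lmeans G" "\<And>x. x \<in> carrier G \<Longrightarrow> f x = g x" "x \<in> carrier G"
  shows "\<Phi> f x = \<Phi> g x"
proof -
  have "cmod (\<Phi> (\<lambda>x. f x - g x) x) \<le> 0"
    by (rule lmeans_bound[OF assms(1)]) (use assms in auto)
  then show ?thesis by (simp add: lmeans_diff[OF assms(1)])
qed

lemma sum_list_Re_le:
  "(\<And>a. a \<in> set as \<Longrightarrow> Re (h a) \<le> B) \<Longrightarrow> Re (\<Sum>a\<leftarrow>as. h a) \<le> real (length as) * B"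
  by (induction as) (auto simp: algebra_simps add_mono)

lemma lmeans_Re_le:
  "\<lbrakk>\<Phi> \<in> lmeans G; \<forall>x\<in>carrier G. Re (f x) \<le> B; x \<in> carrier G\<rbrakk> \<Longrightarrow> Re (\<Phi> f x) \<le> B"
proof (induction arbitrary: x rule: lmeans.induct)
  case (step as \<Phi>)
  have "Re (\<Sum>a\<leftarrow>as. \<Phi> f (a \<otimes> x)) \<le> real (length as) * B"
    using step by (intro sum_list_Re_le) auto
  then show ?case using step
    by (simp add: lavg_def Re_divide_of_nat divide_le_eq mult.commute)
qed simp

lemma lmeans_Re_ge:
  assumes "\<Phi> \<in> lmeans G" "\<forall>x\<in>carrier G. Re (f x) \<ge> B" "x \<in> carrier G"
  shows "Re (\<Phi> f x) \<ge> B"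
  using lmeans_Re_le[OF assms(1), of "\<lambda>x. (-1) * f x" "-B" x] assms
  by (simp only: lmeans_scale[OF assms(1)]) simp

text \<open>The bound for \<open>w\<close> holds at all points, and passing from \<open>x\<close> to
  \<open>a \<otimes> x\<close> only moves the point, so no average can worsen it.\<close>

lemma lmeans_equicontinuous:
  "\<lbrakk>\<Phi> \<in> lmeans G; \<forall>x\<in>carrier G. cmod (f (x \<otimes> w) - f x) \<le> e; w \<in> carrier G; x \<in> carrier G\<rbrakk>
    \<Longrightarrow> cmod (\<Phi> f (x \<otimes> w) - \<Phi> f x) \<le> e"
proof (induction arbitrary: x rule: lmeans.induct)
  case (step as \<Phi>)
  have "lavg G as (\<Phi> f) (x \<otimes> w) - lavg G as (\<Phi> f) x = lavg G as (\<lambda>y. \<Phi> f (y \<otimes> w) - \<Phi> f y) x"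
    using step.hyps(2) step.prems unfolding lavg_def diff_divide_distrib[symmetric]
    by (subst sum_list_subtractf[symmetric], intro arg_cong2[where f="(/)"] arg_cong[where f=sum_list] map_cong)
      (auto simp: m_assoc[symmetric])
  also have "cmod \<dots> \<le> e"
    using step by (intro lavg_bound) auto
  finally show ?case .
qed simp

lemma lmeans_rtranslate:
  "\<lbrakk>\<Phi> \<in> lmeans G; b \<in> carrier G; x \<in> carrier G\<rbrakk> \<Longrightarrow> \<Phi> (\<lambda>x. f (x \<otimes> b)) x = \<Phi> f (x \<otimes> b)"
proof (induction arbitrary: x rule: lmeans.induct)
  case (step as \<Phi>)
  show ?case using step unfolding lavg_def
    by (intro arg_cong2[where f="(/)"] arg_cong[where f=sum_list] map_cong)
      (auto simp: m_assoc[symmetric] subset_iff)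
qed simp

lemma lmeans_sum_list:
  "\<Phi> \<in> lmeans G \<Longrightarrow> \<Phi> (\<lambda>x. \<Sum>b\<leftarrow>bs. h b x) x = (\<Sum>b\<leftarrow>bs. \<Phi> (h b) x)"
proof (induction bs)
  case (Cons b bs)
  then show ?case
    using lmeans_add[OF Cons.prems, of "h b" "\<lambda>x. \<Sum>b\<leftarrow>bs. h b x"] by simp
qed (simp add: lmeans_const)

text \<open>Left and right translations commute by associativity. Induction on \<open>\<Psi>\<close>
  removes one right average at a time, \<open>lmeans_rtranslate\<close> moving each right
  translation past \<open>\<Phi>\<close>.\<close>

lemma lmeans_commute:
  "\<lbrakk>\<Psi> \<in> lmeans (opp G); \<Phi> \<in> lmeans G; x \<in> carrier G\<rbrakk> \<Longrightarrow> \<Phi> (\<Psi> f) x = \<Psi> (\<Phi> f) x"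
proof (induction arbitrary: x rule: lmeans.induct)
  case (step bs \<Psi>)
  have "\<Phi> (lavg (opp G) bs (\<Psi> f)) x = (\<Sum>b\<leftarrow>bs. \<Phi> (\<lambda>x. \<Psi> f (x \<otimes> b)) x) / of_nat (length bs)"
  proof -
    have "\<Phi> (lavg (opp G) bs (\<Psi> f)) =
        (\<lambda>x. (1 / of_nat (length bs)) * \<Phi> (\<lambda>x. \<Sum>b\<leftarrow>bs. \<Psi> f (x \<otimes> b)) x)"
      unfolding lmeans_scale[OF step.prems(1), symmetric] by (simp add: lavg_def[abs_def])
    then show ?thesis by (simp add: lmeans_sum_list[OF step.prems(1)])
  qed
  also have "\<dots> = (\<Sum>b\<leftarrow>bs. \<Psi> (\<Phi> f) (x \<otimes> b)) / of_nat (length bs)"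
    using step by (intro arg_cong2[where f="(/)"] arg_cong[where f=sum_list] map_cong)
      (auto simp: lmeans_rtranslate subset_iff)
  finally show ?case by (simp add: lavg_def[of "opp G" bs "\<Psi> (\<Phi> f)"])
qed simp

end


section \<open>The invariant mean on a compact group\<close>

lemma continuous_map_section:
  fixes F :: "'x \<Rightarrow> 'y \<Rightarrow> complex"
  assumes F: "continuous_map (prod_topology X Y) euclidean (\<lambda>(x, y). F x y)"
  shows "x \<in> topspace X \<Longrightarrow> continuous_map Y euclidean (\<lambda>y. F x y)"
    and "y \<in> topspace Y \<Longrightarrow> continuous_map X euclidean (\<lambda>x. F x y)"
proof -
  show "continuous_map Y euclidean (\<lambda>y. F x y)" if "x \<in> topspace X"
  proof -
    have "continuous_map Y (prod_topology X Y) (\<lambda>y. (x, y))"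
      using that by (simp add: continuous_map_pairwise comp_def)
    from continuous_map_compose[OF this F] show ?thesis by (simp add: comp_def)
  qed
  show "continuous_map X euclidean (\<lambda>x. F x y)" if "y \<in> topspace Y"
  proof -
    have "continuous_map X (prod_topology X Y) (\<lambda>x. (x, y))"
      using that by (simp add: continuous_map_pairwise comp_def)
    from continuous_map_compose[OF this F] show ?thesis by (simp add: comp_def)
  qed
qed

lemma continuous_map_complexI:
  fixes f :: "'x \<Rightarrow> complex"
  assumes "\<And>x e. \<lbrakk>x \<in> topspace X; e > 0\<rbrakk> \<Longrightarrow> \<exists>U. openin X U \<and> x \<in> U \<and> (\<forall>y\<in>U. cmod (f y - f x) < e)"
  shows "continuous_map X euclidean f"
proof -
  have "continuous_map X (Met_TC.mtopology) f"
    unfolding Met_TC.continuous_map_to_metric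
    using assms by (auto simp: Met_TC.mball_def dist_norm norm_minus_commute) 
  then show ?thesis by simp
qed

lemma (in group) mult_inv_cancel_mid:
  assumes "x \<in> carrier G" "y \<in> carrier G" "z \<in> carrier G"
  shows "x \<otimes> inv y \<otimes> (y \<otimes> z) = x \<otimes> z"
proof -
  have "inv y \<otimes> (y \<otimes> z) = z" using assms by (simp add: m_assoc[symmetric])
  then show ?thesis using assms by (simp add: m_assoc)
qed

section \<open>Averages close to constants\<close>

context compact_group
begin

lemma lmeans_continuous:
  assumes "\<Phi> \<in> lmeans G" "continuous_map T euclidean f"
  shows "continuous_map T euclidean (\<Phi> f)"
  using assms
proof (induction rule: lmeans.induct)
  case (step as \<Phi>)
  have "continuous_map T euclidean (\<lambda>x. \<Sum>a\<leftarrow>bs. \<Phi> f (a \<otimes> x))" if "set bs \<subseteq> carrier G" for bs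
    using that
    by (induction bs) (auto intro!: continuous_map_add
        continuous_map_comp2[OF step.IH[OF step.prems] continuous_map_ltrans])
  then show ?case
    using step.hyps unfolding lavg_def[abs_def] divide_inverse
    by (intro continuous_map_complex_mult) auto
qed

text \<open>All averages of \<open>f\<close> share a modulus of continuity. If an average with almost minimal maximum
  were small at one point, it would be small on a translate of a fixed neighbourhood, and averaging
  over a finite cover by translates would lower the maximum by a fixed amount.\<close>

lemma near_const_Re:
  assumes f: "continuous_map T euclidean f" and d: "d > 0"
  shows "\<exists>\<Phi>\<in>lmeans G. \<exists>c::real. \<forall>x\<in>carrier G. \<bar>Re (\<Phi> f x) - c\<bar> \<le> d"
proof -
  \<comment> \<open>Upper bounds for the real part of some average of \<open>f\<close>; their
    infimum \<open>\<mu>\<close> becomes the constant to be approached.\<close>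
  define S where "S = {b. \<exists>\<Phi>\<in>lmeans G. \<forall>x\<in>carrier G. Re (\<Phi> f x) \<le> b}"
  obtain B where B: "\<And>x. x \<in> carrier G \<Longrightarrow> cmod (f x) \<le> B"
    using continuous_bounded[OF f] by blast
  have Re_B: "Re (f x) \<le> B" "- B \<le> Re (f x)" if "x \<in> carrier G" for x
    using B[OF that] abs_Re_le_cmod[of "f x"] by linarith+
  have "B \<in> S"
    unfolding S_def using Re_B by (intro CollectI bexI[OF _ lmeans.id]) auto
  have low: "- B \<le> b" if b: "b \<in> S" for b
  proof -
    obtain \<Phi> where "\<Phi> \<in> lmeans G" "\<forall>x\<in>carrier G. Re (\<Phi> f x) \<le> b"
      using b unfolding S_def by blast
    then show ?thesis
      using lmeans_Re_ge[of \<Phi> "-B" f \<one>] Re_B(2) by force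
  qed
  then have bdd: "bdd_below S" by (rule bdd_belowI)
  define \<mu> where "\<mu> = Inf S"
  obtain W where W: "openin T W" "\<one> \<in> W"
      "\<And>w x. \<lbrakk>w \<in> W; x \<in> carrier G\<rbrakk> \<Longrightarrow> cmod (f (x \<otimes> w) - f x) < d / 4"
    using uniformly_continuous_right[OF f, of "d / 4"] d by auto
  have WG: "W \<subseteq> carrier G" using W(1) openin_subset topspace_eq by blast
  obtain ts where ts: "ts \<noteq> []" "set ts \<subseteq> carrier G"
      "\<And>x. x \<in> carrier G \<Longrightarrow> \<exists>t\<in>set ts. \<exists>w\<in>W. x = t \<otimes> w"
    using finite_translates[OF W(1,2)] by blast
  define m where "m = real (length ts)"
  have m: "m \<ge> 1" using ts(1) by (cases ts) (auto simp: m_def)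
  \<comment> \<open>In an average over \<open>m\<close> translates one small term gains
    \<open>d / 4\<close> over \<open>\<mu>\<close>, while the other \<open>m - 1\<close> terms
    exceed \<open>\<mu>\<close> by less than \<open>d / (4 * m)\<close> each; the gain therefore
    wins.\<close>
  have "\<exists>b\<in>S. b < \<mu> + d / (4 * m)"
    using cInf_lessD[of S "\<mu> + d / (4 * m)"] \<open>B \<in> S\<close> d m by (force simp: \<mu>_def)
  then obtain b \<Phi> where b: "b < \<mu> + d / (4 * m)" and \<Phi>: "\<Phi> \<in> lmeans G"
      and \<Phi>b: "\<And>x. x \<in> carrier G \<Longrightarrow> Re (\<Phi> f x) \<le> b"
    unfolding S_def by blast
  have "Re (\<Phi> f x0) \<ge> \<mu> - d / 2" if x0: "x0 \<in> carrier G" for x0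
  proof (rule ccontr)
    assume "\<not> ?thesis"
    then have less: "Re (\<Phi> f x0) < \<mu> - d / 2" by simp
    have near: "Re (\<Phi> f (x0 \<otimes> w)) \<le> \<mu> - d / 4" if "w \<in> W" for w
    proof -
      have "cmod (\<Phi> f (x0 \<otimes> w) - \<Phi> f x0) \<le> d / 4"
        using W(3)[OF that] WG that x0
        by (intro lmeans_equicontinuous[OF \<Phi>]) (auto intro: less_imp_le)
      then show ?thesis
        using abs_Re_le_cmod[of "\<Phi> f (x0 \<otimes> w) - \<Phi> f x0"] less by simp
    qed
    \<comment> \<open>If \<open>x = t \<otimes> w\<close>, translation by
      \<open>x0 \<otimes> inv t\<close> takes \<open>x\<close> to \<open>x0 \<otimes> w\<close>;
      hence every \<open>x\<close> meets at least one small term.\<close>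
    define as where "as = map (\<lambda>t. x0 \<otimes> inv t) ts"
    have as: "as \<noteq> []" "set as \<subseteq> carrier G" "real (length as) = m"
      using ts x0 by (auto simp: as_def m_def)
    have "Re (\<Sum>a\<leftarrow>as. \<Phi> f (a \<otimes> x)) \<le> (m - 1) * b + (\<mu> - d / 4)" if x: "x \<in> carrier G" for x
    proof -
      obtain t w where t: "t \<in> set ts" and w: "w \<in> W" "x = t \<otimes> w" using ts(3)[OF x] by blast
      obtain us vs where split: "ts = us @ t # vs" using t by (meson split_list)
      have eq: "x0 \<otimes> inv t \<otimes> x = x0 \<otimes> w"
        using t ts(2) w WG x0 mult_inv_cancel_mid[of x0 t w] by auto
      have part: "Re (\<Sum>t\<leftarrow>ys. \<Phi> f (x0 \<otimes> inv t \<otimes> x)) \<le> real (length ys) * b"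
        if "set ys \<subseteq> carrier G" for ys
        using that x0 x by (intro sum_list_Re_le \<Phi>b) auto
      have "Re (\<Sum>a\<leftarrow>as. \<Phi> f (a \<otimes> x)) = Re (\<Sum>t\<leftarrow>us. \<Phi> f (x0 \<otimes> inv t \<otimes> x))
          + Re (\<Phi> f (x0 \<otimes> w)) + Re (\<Sum>t\<leftarrow>vs. \<Phi> f (x0 \<otimes> inv t \<otimes> x))"
        by (simp add: as_def split comp_def eq)
      also have "\<dots> \<le> real (length us) * b + (\<mu> - d / 4) + real (length vs) * b"
        using ts(2) by (intro add_mono part near w) (auto simp: split)
      also have "\<dots> = (m - 1) * b + (\<mu> - d / 4)"
        by (simp add: m_def split algebra_simps)
      finally show ?thesis .
    qed
    then have "Re (lavg G as (\<Phi> f) x) \<le> ((m - 1) * b + (\<mu> - d / 4)) / m" if "x \<in> carrier G" for x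
      using that m as(3) by (simp add: lavg_def Re_divide_of_nat divide_right_mono)
    then have "((m - 1) * b + (\<mu> - d / 4)) / m \<in> S"
      unfolding S_def by (intro CollectI bexI[OF _ lmeans.step[OF as(1,2) \<Phi>]]) auto
    then have "\<mu> \<le> ((m - 1) * b + (\<mu> - d / 4)) / m"
      unfolding \<mu>_def by (rule cInf_lower[OF _ bdd])
    then have "m * \<mu> \<le> (m - 1) * b + (\<mu> - d / 4)"
      using m by (simp add: le_divide_eq mult.commute)
    also have "(m - 1) * b \<le> (m - 1) * (\<mu> + d / (4 * m))"
      using m b by (intro mult_left_mono) auto
    finally have "d / 4 \<le> (m - 1) * (d / (4 * m))" by (simp add: algebra_simps)
    then show False using m d by (simp add: field_simps)
  qed
  moreover have "d / (4 * m) \<le> d"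
    using m d by (simp add: divide_le_eq)
  ultimately have "\<bar>Re (\<Phi> f x) - \<mu>\<bar> \<le> d" if "x \<in> carrier G" for x
    using \<Phi>b[OF that] b d that by (simp add: abs_le_iff) (smt (verit) field_sum_of_halves)
  then show ?thesis using \<Phi> by blast
qed

text \<open>The real part is flattened by \<open>\<Phi>\<close> and the imaginary part by
  \<open>\<Psi>\<close>. Applying \<open>\<Psi>\<close> keeps the real part within the bounds
  already reached, so nothing is lost.\<close>

lemma near_const:
  assumes f: "continuous_map T euclidean f" and e: "e > 0"
  shows "\<exists>\<Phi>\<in>lmeans G. \<exists>c. \<forall>x\<in>carrier G. cmod (\<Phi> f x - c) < e"
proof -
  obtain \<Phi> c where \<Phi>: "\<Phi> \<in> lmeans G" and c: "\<And>x. x \<in> carrier G \<Longrightarrow> \<bar>Re (\<Phi> f x) - c\<bar> \<le> e / 4"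
    using near_const_Re[OF f, of "e / 4"] e by auto
  \<comment> \<open>The factor turns the imaginary part into a real part, to which
    \<open>near_const_Re\<close> applies.\<close>
  have g: "continuous_map T euclidean (\<lambda>x. - \<i> * \<Phi> f x)"
    by (rule continuous_map_complex_mult) (simp_all add: lmeans_continuous[OF \<Phi> f])
  obtain \<Psi> c' where \<Psi>: "\<Psi> \<in> lmeans G"
      and "\<And>x. x \<in> carrier G \<Longrightarrow> \<bar>Re (\<Psi> (\<lambda>x. - \<i> * \<Phi> f x) x) - c'\<bar> \<le> e / 4"
    using near_const_Re[OF g, of "e / 4"] e by auto
  then have c': "\<bar>Im (\<Psi> (\<Phi> f) x) - c'\<bar> \<le> e / 4" if "x \<in> carrier G" for x
    using that by (simp only: lmeans_scale[OF \<Psi>]) simp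
  have Re_c: "\<bar>Re (\<Psi> (\<Phi> f) x) - c\<bar> \<le> e / 4" if "x \<in> carrier G" for x
  proof -
    have "\<forall>x\<in>carrier G. Re (\<Phi> f x) \<le> c + e / 4"
      by (intro ballI) (use c in \<open>smt (verit)\<close>)
    moreover have "\<forall>x\<in>carrier G. c - e / 4 \<le> Re (\<Phi> f x)"
      by (intro ballI) (use c in \<open>smt (verit)\<close>)
    ultimately show ?thesis
      using lmeans_Re_le[OF \<Psi> _ that, of "\<Phi> f" "c + e / 4"]
        lmeans_Re_ge[OF \<Psi> _ that, of "c - e / 4" "\<Phi> f"] by linarith
  qed
  have "cmod (\<Psi> (\<Phi> f) x - Complex c c') < e" if "x \<in> carrier G" for x
    using cmod_le[of "\<Psi> (\<Phi> f) x - Complex c c'"] c'[OF that] Re_c[OF that] e by simp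
  then show ?thesis by (intro bexI[OF _ lmeans_comp[OF \<Psi> \<Phi>]]) auto
qed

text \<open>Left and right averages commute, so the limits obtained from either side agree; this is what
  makes the mean well defined.\<close>

lemma lmeans_rmeans_close:
  assumes "\<Phi> \<in> lmeans G" "\<Psi> \<in> lmeans (opp G)"
    and "\<forall>x\<in>carrier G. cmod (\<Phi> f x - c) \<le> d" "\<forall>x\<in>carrier G. cmod (\<Psi> f x - c') \<le> d'"
  shows "cmod (c - c') \<le> d + d'"
proof -
  have "cmod (\<Psi> (\<Phi> f) \<one> - c) \<le> d"
    using group.lmeans_close[OF group_opp assms(2)] assms(3) by simp
  moreover have "cmod (\<Phi> (\<Psi> f) \<one> - c') \<le> d'"
    using lmeans_close[OF assms(1)] assms(4) by simp
  moreover have "\<Phi> (\<Psi> f) \<one> = \<Psi> (\<Phi> f) \<one>"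
    using lmeans_commute[OF assms(2,1)] by simp
  ultimately show ?thesis
    using norm_triangle_ineq4[of "\<Psi> (\<Phi> f) \<one> - c'" "\<Psi> (\<Phi> f) \<one> - c"] by simp
qed

end

text \<open>Defined through left averages alone. That the constant exists and is unique for
  continuous \<open>f\<close> is shown by comparison with right averages, in \<open>mean_ex\<close>
  and \<open>mean_unique\<close>.\<close>

definition mean :: "('a, 'm) monoid_scheme \<Rightarrow> ('a \<Rightarrow> complex) \<Rightarrow> complex" where
  "mean G f = (THE c. \<forall>e>0. \<exists>\<Phi>\<in>lmeans G. \<forall>x\<in>carrier G. cmod (\<Phi> f x - c) < e)"

section \<open>The mean and its invariance\<close>

context compact_group
begin

text \<open>The near-constants \<open>c n\<close> of left and \<open>d n\<close> of right averages
  satisfy \<open>cmod (c m - d n) \<le> \<epsilon> m + \<epsilon> n\<close>. Comparing two left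
  constants through a right one makes \<open>c\<close> Cauchy, and its limit serves both
  sides.\<close>

lemma mean_ex:
  assumes f: "continuous_map T euclidean f"
  shows "\<exists>c. (\<forall>e>0. \<exists>\<Phi>\<in>lmeans G. \<forall>x\<in>carrier G. cmod (\<Phi> f x - c) < e) \<and>
    (\<forall>e>0. \<exists>\<Psi>\<in>lmeans (opp G). \<forall>x\<in>carrier G. cmod (\<Psi> f x - c) < e)"
proof -
  interpret op: compact_group "opp G" T by (rule compact_group_opp)
  define \<epsilon> where "\<epsilon> n = inverse (real (Suc n))" for n
  have \<epsilon>: "\<epsilon> n > 0" for n by (simp add: \<epsilon>_def)
  have \<epsilon>0: "\<epsilon> \<longlonglongrightarrow> 0" unfolding \<epsilon>_def by (rule LIMSEQ_inverse_real_of_nat)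
  have "\<forall>n. \<exists>\<Phi> c. \<Phi> \<in> lmeans G \<and> (\<forall>x\<in>carrier G. cmod (\<Phi> f x - c) < \<epsilon> n)"
    using near_const[OF f \<epsilon>] by blast
  then obtain \<Phi> c where \<Phi>: "\<And>n. \<Phi> n \<in> lmeans G"
      "\<And>n x. x \<in> carrier G \<Longrightarrow> cmod (\<Phi> n f x - c n) < \<epsilon> n" by metis
  have "\<forall>n. \<exists>\<Psi> c. \<Psi> \<in> lmeans (opp G) \<and> (\<forall>x\<in>carrier G. cmod (\<Psi> f x - c) < \<epsilon> n)"
    using op.near_const[OF f \<epsilon>] by (metis opp_simps(1))
  then obtain \<Psi> d where \<Psi>: "\<And>n. \<Psi> n \<in> lmeans (opp G)"
      "\<And>n x. x \<in> carrier G \<Longrightarrow> cmod (\<Psi> n f x - d n) < \<epsilon> n" by metis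
  have cd: "cmod (c m - d n) \<le> \<epsilon> m + \<epsilon> n" for m n
    using lmeans_rmeans_close[OF \<Phi>(1) \<Psi>(1)] \<Phi>(2) \<Psi>(2) by (meson less_imp_le)
  have "cmod (c m - c n) \<le> \<epsilon> m + \<epsilon> n" for m n
  proof -
    \<comment> \<open>The detour through \<open>d k\<close> costs \<open>2 * \<epsilon> k\<close>,
      which vanishes as \<open>k\<close> grows.\<close>
    have "cmod (c m - c n) \<le> \<epsilon> m + \<epsilon> n + 2 * \<epsilon> k" for k
      using norm_triangle_ineq4[of "c m - d k" "c n - d k"] cd[of m k] cd[of n k] by simp
    moreover have "(\<lambda>k. \<epsilon> m + \<epsilon> n + 2 * \<epsilon> k) \<longlonglongrightarrow> \<epsilon> m + \<epsilon> n + 2 * 0"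
      by (intro tendsto_intros \<epsilon>0)
    ultimately have "cmod (c m - c n) \<le> \<epsilon> m + \<epsilon> n + 2 * 0"
      by (intro LIMSEQ_le_const) auto
    then show ?thesis by simp
  qed
  note cc = this
  have "Cauchy c"
  proof (rule metric_CauchyI)
    fix e :: real assume "e > 0"
    then obtain N where N: "\<And>n. n \<ge> N \<Longrightarrow> \<epsilon> n < e / 2"
      using order_tendstoD(2)[OF \<epsilon>0, of "e / 2"] by (auto simp: eventually_sequentially)
    then show "\<exists>M. \<forall>m\<ge>M. \<forall>n\<ge>M. dist (c m) (c n) < e"
    proof (intro exI[of _ N] allI impI)
      fix m n assume "N \<le> m" "N \<le> n"
      then show "dist (c m) (c n) < e"
        using cc[of m n] N[of m] N[of n] by (simp add: dist_norm)
    qed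
  qed
  then obtain l where l: "c \<longlonglongrightarrow> l" using Cauchy_convergent convergent_def by blast
  have cl: "cmod (c m - l) \<le> \<epsilon> m" for m
  proof -
    have "(\<lambda>n. \<epsilon> m + \<epsilon> n - cmod (c m - c n)) \<longlonglongrightarrow> \<epsilon> m + 0 - cmod (c m - l)"
      by (intro tendsto_intros \<epsilon>0 l)
    then have "0 \<le> \<epsilon> m + 0 - cmod (c m - l)"
      using cc by (intro LIMSEQ_le_const) auto
    then show ?thesis by simp
  qed
  have dl: "cmod (d m - l) \<le> \<epsilon> m" for m
  proof -
    have "(\<lambda>n. \<epsilon> n + \<epsilon> m - cmod (c n - d m)) \<longlonglongrightarrow> 0 + \<epsilon> m - cmod (l - d m)"
      by (intro tendsto_intros \<epsilon>0 l)
    then have "0 \<le> 0 + \<epsilon> m - cmod (l - d m)"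
      using cd by (intro LIMSEQ_le_const) auto
    then show ?thesis by (simp add: norm_minus_commute)
  qed
  have small: "\<exists>n. \<epsilon> n < e / 2" if "e > 0" for e
    using order_tendstoD(2)[OF \<epsilon>0, of "e / 2"] that by (auto simp: eventually_sequentially)
  show ?thesis
  proof (intro exI[of _ l] conjI allI impI)
    fix e :: real assume e: "e > 0"
    then obtain n where n: "\<epsilon> n < e / 2" using small by blast
    have "cmod (\<Phi> n f x - l) < e" if "x \<in> carrier G" for x
      using norm_triangle_ineq[of "\<Phi> n f x - c n" "c n - l"] \<Phi>(2)[OF that, of n] cl[of n] n by simp
    then show "\<exists>\<Phi>\<in>lmeans G. \<forall>x\<in>carrier G. cmod (\<Phi> f x - l) < e" using \<Phi>(1) by blast
    have "cmod (\<Psi> n f x - l) < e" if "x \<in> carrier G" for x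
      using norm_triangle_ineq[of "\<Psi> n f x - d n" "d n - l"] \<Psi>(2)[OF that, of n] dl[of n] n by simp
    then show "\<exists>\<Psi>\<in>lmeans (opp G). \<forall>x\<in>carrier G. cmod (\<Psi> f x - l) < e" using \<Psi>(1) by blast
  qed
qed

lemma mean_unique:
  assumes f: "continuous_map T euclidean f"
    and "\<forall>e>0. \<exists>\<Phi>\<in>lmeans G. \<forall>x\<in>carrier G. cmod (\<Phi> f x - c) < e"
    and "\<forall>e>0. \<exists>\<Psi>\<in>lmeans (opp G). \<forall>x\<in>carrier G. cmod (\<Psi> f x - c') < e"
  shows "c = c'"
proof -
  have "cmod (c - c') \<le> 0 + e" if "e > 0" for e
  proof -
    obtain \<Phi> where "\<Phi> \<in> lmeans G" "\<forall>x\<in>carrier G. cmod (\<Phi> f x - c) \<le> e / 2"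
      using assms(2) \<open>e > 0\<close> by (meson half_gt_zero less_imp_le)
    moreover obtain \<Psi> where "\<Psi> \<in> lmeans (opp G)" "\<forall>x\<in>carrier G. cmod (\<Psi> f x - c') \<le> e / 2"
      using assms(3) \<open>e > 0\<close> by (meson half_gt_zero less_imp_le)
    ultimately show ?thesis using lmeans_rmeans_close by fastforce
  qed
  then have "cmod (c - c') \<le> 0" by (rule field_le_epsilon)
  then show ?thesis by simp
qed

lemma mean_eqI:
  assumes f: "continuous_map T euclidean f"
    and c: "\<And>e. e > 0 \<Longrightarrow> \<exists>\<Phi>\<in>lmeans G. \<forall>x\<in>carrier G. cmod (\<Phi> f x - c) < e"
  shows "mean G f = c"
  unfolding mean_def
proof (rule the_equality)
  obtain d where "\<forall>e>0. \<exists>\<Psi>\<in>lmeans (opp G). \<forall>x\<in>carrier G. cmod (\<Psi> f x - d) < e"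
    using mean_ex[OF f] by blast
  then show "c' = c" if "\<forall>e>0. \<exists>\<Phi>\<in>lmeans G. \<forall>x\<in>carrier G. cmod (\<Phi> f x - c') < e" for c'
    using mean_unique[OF f] that c by (metis (no_types))
qed (use c in blast)

lemma mean_lapprox:
  assumes f: "continuous_map T euclidean f" and "e > 0"
  shows "\<exists>\<Phi>\<in>lmeans G. \<forall>x\<in>carrier G. cmod (\<Phi> f x - mean G f) < e"
proof -
  obtain c where c: "\<forall>e>0. \<exists>\<Phi>\<in>lmeans G. \<forall>x\<in>carrier G. cmod (\<Phi> f x - c) < e"
    using mean_ex[OF f] by blast
  then have "mean G f = c" using mean_eqI[OF f] by blast
  then show ?thesis using c assms by blast
qed

lemma mean_rapprox:
  assumes f: "continuous_map T euclidean f" and "e > 0"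
  shows "\<exists>\<Psi>\<in>lmeans (opp G). \<forall>x\<in>carrier G. cmod (\<Psi> f x - mean G f) < e"
proof -
  obtain c where c: "\<forall>e>0. \<exists>\<Phi>\<in>lmeans G. \<forall>x\<in>carrier G. cmod (\<Phi> f x - c) < e"
    "\<forall>e>0. \<exists>\<Psi>\<in>lmeans (opp G). \<forall>x\<in>carrier G. cmod (\<Psi> f x - c) < e"
    using mean_ex[OF f] by blast
  then have "mean G f = c" using mean_eqI[OF f] by blast
  then show ?thesis using c assms by blast
qed

lemma mean_eqI_right:
  assumes f: "continuous_map T euclidean f"
    and c: "\<And>e. e > 0 \<Longrightarrow> \<exists>\<Psi>\<in>lmeans (opp G). \<forall>x\<in>carrier G. cmod (\<Psi> f x - c) < e"
  shows "mean G f = c"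
  using mean_unique[OF f] mean_lapprox[OF f] c by blast

lemma mean_cong:
  assumes "\<And>x. x \<in> carrier G \<Longrightarrow> f x = g x"
  shows "mean G f = mean G g"
proof -
  have "(\<forall>x\<in>carrier G. cmod (\<Phi> f x - c) < e) = (\<forall>x\<in>carrier G. cmod (\<Phi> g x - c) < e)"
    if "\<Phi> \<in> lmeans G" for \<Phi> c e
    using lmeans_cong[OF that, of f g] assms by simp
  then show ?thesis unfolding mean_def by (metis (no_types, lifting))
qed

text \<open>A right average \<open>\<Psi>\<close> that makes \<open>f\<close> nearly constant does
  the same for \<open>\<Phi> f\<close>: it commutes with \<open>\<Phi>\<close>, and
  \<open>\<Phi>\<close> keeps near-constants near the same constant.\<close>

lemma mean_lmeans:
  assumes f: "continuous_map T euclidean f" and \<Phi>: "\<Phi> \<in> lmeans G"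
  shows "mean G (\<Phi> f) = mean G f"
proof (rule mean_eqI_right[OF lmeans_continuous[OF \<Phi> f]])
  fix e :: real assume e: "e > 0"
  obtain \<Psi> where \<Psi>: "\<Psi> \<in> lmeans (opp G)" "\<And>x. x \<in> carrier G \<Longrightarrow> cmod (\<Psi> f x - mean G f) \<le> e / 2"
    using mean_rapprox[OF f, of "e / 2"] e by (auto intro: less_imp_le)
  have "cmod (\<Psi> (\<Phi> f) x - mean G f) < e" if "x \<in> carrier G" for x
    using lmeans_close[OF \<Phi>, of "\<Psi> f" "mean G f" "e / 2" x] \<Psi> lmeans_commute[OF \<Psi>(1) \<Phi> that] that e
    by simp
  then show "\<exists>\<Psi>\<in>lmeans (opp G). \<forall>x\<in>carrier G. cmod (\<Psi> (\<Phi> f) x - mean G f) < e"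
    using \<Psi>(1) by blast
qed

lemma mean_const [simp]: "mean G (\<lambda>x. c) = c"
  by (rule mean_eqI) (auto intro!: bexI[OF _ lmeans.id])

text \<open>Induction by composition: a further average \<open>\<Psi>\<close> flattens
  \<open>\<Phi> f\<close> for the new \<open>f\<close>, whose mean is unchanged by
  \<open>mean_lmeans\<close>, and leaves the functions already close to their means as close as they
  were.\<close>

lemma mean_finite_approx:
  assumes "finite \<F>" "\<And>f. f \<in> \<F> \<Longrightarrow> continuous_map T euclidean f" "e > 0"
  shows "\<exists>\<Phi>\<in>lmeans G. \<forall>f\<in>\<F>. \<forall>x\<in>carrier G. cmod (\<Phi> f x - mean G f) \<le> e"
  using assms
proof (induction rule: finite_induct)
  case empty
  then show ?case by (intro bexI[OF _ lmeans.id]) auto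
next
  case (insert f \<F>)
  then obtain \<Phi> where \<Phi>: "\<Phi> \<in> lmeans G"
      "\<And>f x. f \<in> \<F> \<Longrightarrow> x \<in> carrier G \<Longrightarrow> cmod (\<Phi> f x - mean G f) \<le> e" by auto
  have f: "continuous_map T euclidean f" using insert by blast
  obtain \<Psi> where \<Psi>: "\<Psi> \<in> lmeans G"
      "\<And>x. x \<in> carrier G \<Longrightarrow> cmod (\<Psi> (\<Phi> f) x - mean G (\<Phi> f)) < e"
    using mean_lapprox[OF lmeans_continuous[OF \<Phi>(1) f] insert.prems(2)] by blast
  show ?case
  proof (intro bexI[OF _ lmeans_comp[OF \<Psi>(1) \<Phi>(1)]] ballI)
    fix g x assume g: "g \<in> insert f \<F>" and x: "x \<in> carrier G"
    show "cmod (\<Psi> (\<Phi> g) x - mean G g) \<le> e"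
    proof (cases "g = f")
      case True
      then show ?thesis using \<Psi>(2)[OF x] mean_lmeans[OF f \<Phi>(1)] by simp
    next
      case False
      then show ?thesis using g \<Phi>(2) x by (intro lmeans_close[OF \<Psi>(1)]) auto
    qed
  qed
qed

lemma mean_add:
  assumes f: "continuous_map T euclidean f" and g: "continuous_map T euclidean g"
  shows "mean G (\<lambda>x. f x + g x) = mean G f + mean G g"
proof (rule mean_eqI)
  show "continuous_map T euclidean (\<lambda>x. f x + g x)" by (intro continuous_map_add f g)
  fix e :: real assume e: "e > 0"
  have "\<exists>\<Phi>\<in>lmeans G. \<forall>h\<in>{f, g}. \<forall>x\<in>carrier G. cmod (\<Phi> h x - mean G h) \<le> e / 3"
    by (rule mean_finite_approx) (use f g e in auto)
  then obtain \<Phi> where \<Phi>: "\<Phi> \<in> lmeans G"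
      "\<And>h x. h \<in> {f, g} \<Longrightarrow> x \<in> carrier G \<Longrightarrow> cmod (\<Phi> h x - mean G h) \<le> e / 3"
    by blast
  have "cmod (\<Phi> (\<lambda>x. f x + g x) x - (mean G f + mean G g)) < e" if "x \<in> carrier G" for x
    using norm_triangle_ineq[of "\<Phi> f x - mean G f" "\<Phi> g x - mean G g"] \<Phi>(2)[of f x] \<Phi>(2)[of g x] e that
    by (simp add: lmeans_add[OF \<Phi>(1)] algebra_simps)
  then show "\<exists>\<Phi>\<in>lmeans G. \<forall>x\<in>carrier G. cmod (\<Phi> (\<lambda>x. f x + g x) x - (mean G f + mean G g)) < e"
    using \<Phi>(1) by blast
qed

lemma mean_scale:
  assumes f: "continuous_map T euclidean f"
  shows "mean G (\<lambda>x. c * f x) = c * mean G f"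
proof (rule mean_eqI)
  show "continuous_map T euclidean (\<lambda>x. c * f x)" by (intro continuous_map_complex_mult f) auto
  fix e :: real assume e: "e > 0"
  obtain \<Phi> where \<Phi>: "\<Phi> \<in> lmeans G"
      "\<And>x. x \<in> carrier G \<Longrightarrow> cmod (\<Phi> f x - mean G f) < e / (cmod c + 1)"
    using mean_lapprox[OF f, of "e / (cmod c + 1)"] e by (auto simp: add_nonneg_pos)
  have "cmod (\<Phi> (\<lambda>x. c * f x) x - c * mean G f) < e" if "x \<in> carrier G" for x
  proof -
    have "cmod (\<Phi> (\<lambda>x. c * f x) x - c * mean G f) = cmod c * cmod (\<Phi> f x - mean G f)"
      by (simp add: lmeans_scale[OF \<Phi>(1)] right_diff_distrib[symmetric] norm_mult)
    also have "\<dots> \<le> cmod c * (e / (cmod c + 1))"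
      using \<Phi>(2)[OF that] by (intro mult_left_mono) auto
    also have "\<dots> < e"
      using e by (simp add: divide_less_eq add_nonneg_pos algebra_simps) (smt (verit) norm_ge_zero)
    finally show ?thesis .
  qed
  then show "\<exists>\<Phi>\<in>lmeans G. \<forall>x\<in>carrier G. cmod (\<Phi> (\<lambda>x. c * f x) x - c * mean G f) < e"
    using \<Phi>(1) by blast
qed

lemma mean_diff:
  assumes f: "continuous_map T euclidean f" and g: "continuous_map T euclidean g"
  shows "mean G (\<lambda>x. f x - g x) = mean G f - mean G g"
proof -
  have "continuous_map T euclidean (\<lambda>x. (-1) * g x)" by (intro continuous_map_complex_mult g) auto
  from mean_add[OF f this] show ?thesis
    using mean_scale[OF g, of "-1"] by simp
qed

lemma mean_sum:
  assumes "finite I" "\<And>i. i \<in> I \<Longrightarrow> continuous_map T euclidean (f i)"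
  shows "mean G (\<lambda>x. \<Sum>i\<in>I. f i x) = (\<Sum>i\<in>I. mean G (f i))"
  using assms by (induction rule: finite_induct) (auto simp: mean_add continuous_map_sum)

lemma mean_cnj:
  assumes f: "continuous_map T euclidean f"
  shows "mean G (\<lambda>x. cnj (f x)) = cnj (mean G f)"
proof (rule mean_eqI)
  show "continuous_map T euclidean (\<lambda>x. cnj (f x))"
    by (intro continuous_map_cnj f)
  fix e :: real assume "e > 0"
  then obtain \<Phi> where \<Phi>: "\<Phi> \<in> lmeans G" "\<And>x. x \<in> carrier G \<Longrightarrow> cmod (\<Phi> f x - mean G f) < e"
    using mean_lapprox[OF f] by blast
  then show "\<exists>\<Phi>\<in>lmeans G. \<forall>x\<in>carrier G. cmod (\<Phi> (\<lambda>x. cnj (f x)) x - cnj (mean G f)) < e"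
    by (intro bexI[of _ \<Phi>]) (auto simp: lmeans_cnj[OF \<Phi>(1)] simp flip: complex_cnj_diff)
qed

text \<open>Left averages commute with right translations, so any \<open>\<Phi>\<close> good for
  \<open>f\<close> is good for the translate. Left invariance, \<open>mean_ltranslate\<close>, is
  the mirror argument with right averages.\<close>

lemma mean_rtranslate:
  assumes f: "continuous_map T euclidean f" and b: "b \<in> carrier G"
  shows "mean G (\<lambda>x. f (x \<otimes> b)) = mean G f"
proof (rule mean_eqI)
  show "continuous_map T euclidean (\<lambda>x. f (x \<otimes> b))"
    by (intro continuous_map_comp2[OF f] continuous_map_rtrans b)
  fix e :: real assume "e > 0"
  then obtain \<Phi> where \<Phi>: "\<Phi> \<in> lmeans G" "\<And>x. x \<in> carrier G \<Longrightarrow> cmod (\<Phi> f x - mean G f) < e"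
    using mean_lapprox[OF f] by blast
  then show "\<exists>\<Phi>\<in>lmeans G. \<forall>x\<in>carrier G. cmod (\<Phi> (\<lambda>x. f (x \<otimes> b)) x - mean G f) < e"
    by (intro bexI[of _ \<Phi>]) (auto simp: lmeans_rtranslate b)
qed

lemma mean_ltranslate:
  assumes f: "continuous_map T euclidean f" and b: "b \<in> carrier G"
  shows "mean G (\<lambda>x. f (b \<otimes> x)) = mean G f"
proof (rule mean_eqI_right)
  show "continuous_map T euclidean (\<lambda>x. f (b \<otimes> x))"
    by (intro continuous_map_comp2[OF f] continuous_map_ltrans b)
  fix e :: real assume "e > 0"
  then obtain \<Psi> where \<Psi>: "\<Psi> \<in> lmeans (opp G)" "\<And>x. x \<in> carrier G \<Longrightarrow> cmod (\<Psi> f x - mean G f) < e"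
    using mean_rapprox[OF f] by blast
  then show "\<exists>\<Psi>\<in>lmeans (opp G). \<forall>x\<in>carrier G. cmod (\<Psi> (\<lambda>x. f (b \<otimes> x)) x - mean G f) < e"
    using group.lmeans_rtranslate[OF group_opp \<Psi>(1), of b _ f] b
    by (intro bexI[of _ \<Psi>]) auto
qed

lemma mean_bound:
  assumes f: "continuous_map T euclidean f" and B: "\<And>x. x \<in> carrier G \<Longrightarrow> cmod (f x) \<le> B"
  shows "cmod (mean G f) \<le> B"
proof (rule field_le_epsilon)
  fix e :: real assume "e > 0"
  then obtain \<Phi> where \<Phi>: "\<Phi> \<in> lmeans G" "\<And>x. x \<in> carrier G \<Longrightarrow> cmod (\<Phi> f x - mean G f) < e"
    using mean_lapprox[OF f] by blast
  have "cmod (\<Phi> f \<one>) \<le> B" using lmeans_bound[OF \<Phi>(1), of f B \<one>] B by simp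
  then show "cmod (mean G f) \<le> B + e"
    using \<Phi>(2)[OF one_closed] norm_triangle_sub[of "mean G f" "\<Phi> f \<one>"]
    unfolding norm_minus_commute[of "mean G f"] by linarith
qed

lemma mean_Re_ge:
  assumes f: "continuous_map T euclidean f" and B: "\<And>x. x \<in> carrier G \<Longrightarrow> B \<le> Re (f x)"
  shows "B \<le> Re (mean G f)"
proof (rule field_le_epsilon)
  fix e :: real assume "e > 0"
  then obtain \<Phi> where \<Phi>: "\<Phi> \<in> lmeans G" "\<And>x. x \<in> carrier G \<Longrightarrow> cmod (\<Phi> f x - mean G f) < e"
    using mean_lapprox[OF f] by blast
  have "B \<le> Re (\<Phi> f \<one>)" using lmeans_Re_ge[OF \<Phi>(1), of B f \<one>] B by simp
  then show "B \<le> Re (mean G f) + e"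
    using \<Phi>(2)[OF one_closed] abs_Re_le_cmod[of "\<Phi> f \<one> - mean G f"]
    unfolding minus_complex.sel by linarith
qed

text \<open>Faithfulness of the mean: near \<open>x0\<close> the real part is at least
  \<open>r\<close>, finitely many translates of that neighbourhood cover the group, and the average
  over them has the same mean and is everywhere at least \<open>r\<close> divided by their number.
  This makes \<open>cip\<close> definite.\<close>

lemma mean_strict_pos:
  assumes f: "continuous_map T euclidean f" and pos: "\<And>x. x \<in> carrier G \<Longrightarrow> 0 \<le> Re (f x)"
    and x0: "x0 \<in> carrier G" "Re (f x0) > 0"
  shows "0 < Re (mean G f)"
proof -
  define r where "r = Re (f x0) / 2"
  have r: "r > 0" using x0 by (simp add: r_def)
  obtain W where W: "openin T W" "\<one> \<in> W"
      "\<And>w x. \<lbrakk>w \<in> W; x \<in> carrier G\<rbrakk> \<Longrightarrow> cmod (f (x \<otimes> w) - f x) < r"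
    using uniformly_continuous_right[OF f r] by auto
  have WG: "W \<subseteq> carrier G" using W(1) openin_subset topspace_eq by blast
  obtain ts where ts: "ts \<noteq> []" "set ts \<subseteq> carrier G"
      "\<And>x. x \<in> carrier G \<Longrightarrow> \<exists>t\<in>set ts. \<exists>w\<in>W. x = t \<otimes> w"
    using finite_translates[OF W(1,2)] by blast
  define as where "as = map (\<lambda>t. x0 \<otimes> inv t) ts"
  have as: "as \<noteq> []" "set as \<subseteq> carrier G" using ts x0 by (auto simp: as_def)
  have ge: "r \<le> Re (\<Sum>a\<leftarrow>as. f (a \<otimes> x))" if x: "x \<in> carrier G" for x
  proof -
    obtain t w where t: "t \<in> set ts" and w: "w \<in> W" "x = t \<otimes> w" using ts(3)[OF x] by blast
    have eq: "x0 \<otimes> inv t \<otimes> x = x0 \<otimes> w"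
      using t ts(2) w WG x0 mult_inv_cancel_mid[of x0 t w] by auto
    have "Re (f (x0 \<otimes> w)) \<ge> r"
      using W(3)[OF w(1) x0(1)] abs_Re_le_cmod[of "f (x0 \<otimes> w) - f x0"] by (simp add: r_def)
    \<comment> \<open>One term of the sum is this value, and the others are nonnegative.\<close>
    also have "Re (f (x0 \<otimes> w)) \<le> (\<Sum>a\<leftarrow>as. Re (f (a \<otimes> x)))"
      using t pos as(2) x by (intro member_le_sum_list) (force simp: as_def eq[symmetric])+
    also have "\<dots> = Re (\<Sum>a\<leftarrow>as. f (a \<otimes> x))"
      by (induction as) auto
    finally show ?thesis .
  qed
  have \<Phi>: "lavg G as \<in> lmeans G" using lmeans.step[OF as lmeans.id] by simp
  have "r / real (length as) \<le> Re (mean G (lavg G as f))"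
    using ge by (intro mean_Re_ge lmeans_continuous[OF \<Phi> f])
      (simp add: lavg_def Re_divide_of_nat divide_right_mono)
  moreover have "0 < r / real (length as)" using r as(1) by simp
  ultimately show ?thesis using mean_lmeans[OF f \<Phi>] by simp
qed

section \<open>Means depending on a parameter and the interchange of two means\<close>

lemma continuous_mean:
  assumes F: "continuous_map (prod_topology X T) euclidean (\<lambda>(x, y). F x y)"
  shows "continuous_map X euclidean (\<lambda>x. mean G (F x))"
proof (rule continuous_map_complexI)
  fix x0 and e :: real assume x0: "x0 \<in> topspace X" and e: "e > 0"
  obtain U where U: "openin X U" "x0 \<in> U"
      "\<And>x y. \<lbrakk>x \<in> U; y \<in> carrier G\<rbrakk> \<Longrightarrow> cmod (F x y - F x0 y) < e / 2"
    using continuous_map_tube[OF F compact x0, of "e / 2"] e unfolding topspace_eq by auto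
  have "cmod (mean G (F x) - mean G (F x0)) < e" if x: "x \<in> U" for x
  proof -
    have cont: "continuous_map T euclidean (F x)" "continuous_map T euclidean (F x0)"
      using continuous_map_section(1)[OF F] x x0 openin_subset[OF U(1)] by auto
    have "cmod (mean G (\<lambda>y. F x y - F x0 y)) \<le> e / 2"
      using U(3)[OF x] by (intro mean_bound continuous_map_diff cont) (auto intro: less_imp_le)
    then show ?thesis using e by (simp add: mean_diff[OF cont])
  qed
  then show "\<exists>U. openin X U \<and> x0 \<in> U \<and> (\<forall>y\<in>U. cmod (mean G (F y) - mean G (F x0)) < e)"
    using U by blast
qed

text \<open>By compactness of \<open>X\<close> finitely many sections \<open>F x0\<close> are
  uniformly within \<open>e / 3\<close> of all sections, and \<open>\<Phi>\<close> is chosen for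
  these. The extra function \<open>q\<close> is there for \<open>mean_Fubini\<close>, where it is
  the mean over the other variable.\<close>

lemma mean_uniform_approx:
  assumes F: "continuous_map (prod_topology X T) euclidean (\<lambda>(x, y). F x y)"
    and X: "compact_space X" and q: "continuous_map T euclidean q" and e: "e > 0"
  shows "\<exists>\<Phi>\<in>lmeans G. cmod (\<Phi> q \<one> - mean G q) \<le> e \<and>
    (\<forall>x\<in>topspace X. cmod (\<Phi> (F x) \<one> - mean G (F x)) \<le> e)"
proof -
  have "\<exists>U. openin X U \<and> x0 \<in> U \<and> (\<forall>x\<in>U. \<forall>y\<in>carrier G. cmod (F x y - F x0 y) < e / 3)"
    if "x0 \<in> topspace X" for x0
    using continuous_map_tube[OF F compact that, of "e / 3"] e unfolding topspace_eq by auto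
  then obtain U where U: "\<And>x0. x0 \<in> topspace X \<Longrightarrow> openin X (U x0) \<and> x0 \<in> U x0"
      "\<And>x0 x y. \<lbrakk>x0 \<in> topspace X; x \<in> U x0; y \<in> carrier G\<rbrakk> \<Longrightarrow> cmod (F x y - F x0 y) < e / 3"
    by metis
  obtain \<F> where "finite \<F>" "\<F> \<subseteq> U ` topspace X" "topspace X \<subseteq> \<Union>\<F>"
    using compactinD[of X "topspace X" "U ` topspace X"] X U(1) unfolding compact_space_def by blast
  then obtain N where N: "finite N" "N \<subseteq> topspace X" "topspace X \<subseteq> \<Union>(U ` N)"
    by (metis finite_subset_image)
  have cF: "continuous_map T euclidean (F x)" if "x \<in> topspace X" for x
    using continuous_map_section(1)[OF F that] .
  have "\<exists>\<Phi>\<in>lmeans G. \<forall>h\<in>insert q (F ` N). \<forall>x\<in>carrier G. cmod (\<Phi> h x - mean G h) \<le> e / 3"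
    by (rule mean_finite_approx) (use N q e cF in auto)
  then obtain \<Phi> where \<Phi>: "\<Phi> \<in> lmeans G"
      "\<And>h x. h \<in> insert q (F ` N) \<Longrightarrow> x \<in> carrier G \<Longrightarrow> cmod (\<Phi> h x - mean G h) \<le> e / 3"
    by blast
  have "cmod (\<Phi> (F x) \<one> - mean G (F x)) \<le> e" if x: "x \<in> topspace X" for x
  proof -
    obtain x0 where x0: "x0 \<in> N" "x \<in> U x0" using N x by blast
    then have x0X: "x0 \<in> topspace X" using N by blast
    have close: "\<forall>y\<in>carrier G. cmod (F x y - F x0 y) \<le> e / 3"
      using U(2)[OF x0X x0(2)] by (auto intro: less_imp_le)
    have "cmod (\<Phi> (\<lambda>y. F x y - F x0 y) \<one>) \<le> e / 3"
      by (rule lmeans_bound[OF \<Phi>(1) close one_closed])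
    moreover have "cmod (mean G (\<lambda>y. F x y - F x0 y)) \<le> e / 3"
      using close by (intro mean_bound continuous_map_diff cF x x0X) auto
    moreover have "cmod (\<Phi> (F x0) \<one> - mean G (F x0)) \<le> e / 3"
      using \<Phi>(2)[of "F x0" \<one>] x0 by simp
    ultimately show ?thesis
      unfolding lmeans_diff[OF \<Phi>(1)] mean_diff[OF cF[OF x] cF[OF x0X]]
      using norm_triangle_ineq[of "\<Phi> (F x) \<one> - \<Phi> (F x0) \<one>" "\<Phi> (F x0) \<one> - mean G (F x0)"]
        norm_triangle_ineq4[of "\<Phi> (F x) \<one> - mean G (F x0)" "mean G (F x) - mean G (F x0)"] by simp
  qed
  moreover have "cmod (\<Phi> q \<one> - mean G q) \<le> e"
    using \<Phi>(2)[of q \<one>] e by simp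
  ultimately show ?thesis using \<Phi>(1) by (intro bexI[of _ \<Phi>]) auto
qed

lemma mean_lmeans_swap:
  assumes F: "continuous_map (prod_topology T T) euclidean (\<lambda>(x, y). F x y)" and \<Phi>: "\<Phi> \<in> lmeans G"
    and z: "z \<in> carrier G"
  shows "continuous_map T euclidean (\<lambda>x. \<Phi> (F x) z) \<and>
    mean G (\<lambda>x. \<Phi> (F x) z) = \<Phi> (\<lambda>y. mean G (\<lambda>x. F x y)) z"
  using \<Phi> z
proof (induction arbitrary: z rule: lmeans.induct)
  case id
  then show ?case using continuous_map_section(2)[OF F] topspace_eq by auto
next
  case (step as \<Phi>)
  have as: "a \<otimes> z \<in> carrier G" if "a \<in> set as" for a using that step by auto
  have cont: "continuous_map T euclidean (\<lambda>x. \<Sum>i<length as. \<Phi> (F x) (as ! i \<otimes> z))"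
    using step as by (intro continuous_map_sum) auto
  have sum: "lavg G as f z = inverse (of_nat (length as)) * (\<Sum>i<length as. f (as ! i \<otimes> z))" for f
    by (simp add: lavg_def sum_list_sum_nth divide_inverse atLeast0LessThan)
  have "mean G (\<lambda>x. \<Sum>i<length as. \<Phi> (F x) (as ! i \<otimes> z)) =
      (\<Sum>i<length as. mean G (\<lambda>x. \<Phi> (F x) (as ! i \<otimes> z)))"
    by (rule mean_sum) (use step as in auto)
  then show ?case
    unfolding sum using step as
    by (auto simp: mean_scale[OF cont] intro!: continuous_map_complex_mult cont)
qed

text \<open>Inner means are replaced, uniformly in \<open>x\<close>, by the values of a finite
  average \<open>\<Phi>\<close> at \<open>\<one>\<close>; for a finite average the interchange is
  additivity, \<open>mean_lmeans_swap\<close>.\<close>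

lemma mean_Fubini:
  assumes F: "continuous_map (prod_topology T T) euclidean (\<lambda>(x, y). F x y)"
  shows "mean G (\<lambda>x. mean G (\<lambda>y. F x y)) = mean G (\<lambda>y. mean G (\<lambda>x. F x y))"
proof -
  have F': "continuous_map (prod_topology T T) euclidean (\<lambda>(y, x). F x y)"
  proof -
    have "continuous_map (prod_topology T T) (prod_topology T T) (\<lambda>(y, x). (x, y))"
      by (simp add: continuous_map_pairwise comp_def case_prod_unfold continuous_map_fst continuous_map_snd)
    from continuous_map_compose[OF this F] show ?thesis by (simp add: comp_def case_prod_unfold)
  qed
  note cp = continuous_mean[OF F] and cq = continuous_mean[OF F']
  let ?p = "\<lambda>x. mean G (F x)" and ?q = "\<lambda>y. mean G (\<lambda>x. F x y)"
  have "cmod (mean G ?p - mean G ?q) \<le> 0 + e" if e: "e > 0" for e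
  proof -
    obtain \<Phi> where \<Phi>: "\<Phi> \<in> lmeans G" "cmod (\<Phi> ?q \<one> - mean G ?q) \<le> e / 2"
        "\<And>x. x \<in> carrier G \<Longrightarrow> cmod (\<Phi> (F x) \<one> - ?p x) \<le> e / 2"
      using mean_uniform_approx[OF F compact cq, of "e / 2"] e unfolding topspace_eq by auto
    note sw = mean_lmeans_swap[OF F \<Phi>(1) one_closed]
    have "cmod (mean G (\<lambda>x. \<Phi> (F x) \<one> - ?p x)) \<le> e / 2"
      using \<Phi>(3) sw by (intro mean_bound continuous_map_diff cp) auto
    then have "cmod (\<Phi> ?q \<one> - mean G ?p) \<le> e / 2"
      using sw by (simp add: mean_diff cp)
    then show ?thesis
      using \<Phi>(2) norm_triangle_ineq4[of "\<Phi> ?q \<one> - mean G ?q" "\<Phi> ?q \<one> - mean G ?p"] by simp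
  qed
  then have "cmod (mean G ?p - mean G ?q) \<le> 0" by (rule field_le_epsilon)
  then show ?thesis by simp
qed

end


section \<open>Inner products on spaces of functions\<close>

definition csub :: "('x \<Rightarrow> complex) set \<Rightarrow> bool" where
  "csub E \<longleftrightarrow> (\<lambda>_. 0) \<in> E \<and> (\<forall>f\<in>E. \<forall>g\<in>E. (\<lambda>x. f x + g x) \<in> E) \<and> (\<forall>c. \<forall>f\<in>E. (\<lambda>x. c * f x) \<in> E)"

lemma csub_zero: "csub E \<Longrightarrow> (\<lambda>_. 0) \<in> E"
  and csub_add: "\<lbrakk>csub E; f \<in> E; g \<in> E\<rbrakk> \<Longrightarrow> (\<lambda>x. f x + g x) \<in> E"
  and csub_scale: "\<lbrakk>csub E; f \<in> E\<rbrakk> \<Longrightarrow> (\<lambda>x. c * f x) \<in> E"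
  by (simp_all add: csub_def)

lemma csub_diff: "\<lbrakk>csub E; f \<in> E; g \<in> E\<rbrakk> \<Longrightarrow> (\<lambda>x. f x - g x) \<in> E"
  using csub_add[of E f "\<lambda>x. (-1) * g x"] csub_scale[of E g "-1"] by simp

lemma csub_sum:
  assumes "csub E" "finite I" "\<And>i. i \<in> I \<Longrightarrow> e i \<in> E"
  shows "(\<lambda>x. \<Sum>i\<in>I. c i * e i x) \<in> E"
  using assms(2,3)
proof (induction rule: finite_induct)
  case (insert i I)
  then show ?case
    using csub_add[OF assms(1) csub_scale[OF assms(1), of "e i" "c i"], of "\<lambda>x. \<Sum>i\<in>I. c i * e i x"]
    by simp
qed (use csub_zero[OF assms(1)] in simp)

definition hilb :: "('x \<Rightarrow> complex) set \<Rightarrow> (('x \<Rightarrow> complex) \<Rightarrow> ('x \<Rightarrow> complex) \<Rightarrow> complex)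
    \<Rightarrow> ('x \<Rightarrow> complex) hilbert" where
  "hilb E ip = \<lparr>carrier = E, mult = undefined, one = undefined, zero = (\<lambda>_. 0),
    add = (\<lambda>f g x. f x + g x), smult = (\<lambda>c f x. c * f x), hinner = ip\<rparr>"

lemma hilb_simps [simp]:
  "carrier (hilb E ip) = E" "\<zero>\<^bsub>hilb E ip\<^esub> = (\<lambda>_. 0)" "f \<oplus>\<^bsub>hilb E ip\<^esub> g = (\<lambda>x. f x + g x)"
  "c \<odot>\<^bsub>hilb E ip\<^esub> f = (\<lambda>x. c * f x)" "hinner (hilb E ip) = ip"
  by (simp_all add: hilb_def)

text \<open>Used for two spaces: continuous functions on the group with the mean,
  \<open>fun_ip_CF\<close>, and functions on a finite index set, \<open>fun_ip_CI\<close>. Vectors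
  are functions with pointwise operations, so subspaces are plain sets.\<close>

locale fun_ip =
  fixes S :: "('x \<Rightarrow> complex) set" and ip :: "('x \<Rightarrow> complex) \<Rightarrow> ('x \<Rightarrow> complex) \<Rightarrow> complex"
  assumes csub_S: "csub S"
    and ip_add: "\<lbrakk>f \<in> S; g \<in> S; h \<in> S\<rbrakk> \<Longrightarrow> ip (\<lambda>x. f x + g x) h = ip f h + ip g h"
    and ip_scale: "\<lbrakk>f \<in> S; h \<in> S\<rbrakk> \<Longrightarrow> ip (\<lambda>x. c * f x) h = c * ip f h"
    and ip_cnj: "\<lbrakk>f \<in> S; g \<in> S\<rbrakk> \<Longrightarrow> ip f g = cnj (ip g f)"
    and ip_nonneg: "f \<in> S \<Longrightarrow> 0 \<le> Re (ip f f)"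
    and ip_definite: "\<lbrakk>f \<in> S; ip f f = 0\<rbrakk> \<Longrightarrow> f = (\<lambda>_. 0)"
begin

lemma fun_ip_sub: "\<lbrakk>csub E; E \<subseteq> S\<rbrakk> \<Longrightarrow> fun_ip E ip"
  by unfold_locales (auto simp: ip_add ip_scale subset_iff ip_nonneg intro: ip_cnj ip_definite)

lemma complex_inner_space_hilb: "complex_inner_space (hilb S ip)"
proof -
  have "module complex_ring (hilb S ip)"
  proof (rule moduleI)
    show "abelian_group (hilb S ip)"
    proof (rule abelian_groupI)
      fix f assume "f \<in> carrier (hilb S ip)"
      then show "\<exists>g\<in>carrier (hilb S ip). g \<oplus>\<^bsub>hilb S ip\<^esub> f = \<zero>\<^bsub>hilb S ip\<^esub>"
        using csub_scale[OF csub_S, of f "-1"] by (intro bexI[of _ "\<lambda>x. - 1 * f x"]) auto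
    qed (auto simp: csub_zero[OF csub_S] csub_add[OF csub_S] algebra_simps)
  qed (auto simp: cring_complex_ring csub_scale[OF csub_S] algebra_simps)
  moreover have "complex_inner_space_axioms (hilb S ip)"
    by unfold_locales (auto simp: ip_add ip_scale ip_nonneg intro: ip_cnj ip_definite)
  ultimately show ?thesis by (simp add: complex_inner_space_def)
qed

sublocale V: complex_inner_space "hilb S ip" by (rule complex_inner_space_hilb)

abbreviation nrm :: "('x \<Rightarrow> complex) \<Rightarrow> real" where "nrm f \<equiv> sqrt (Re (ip f f))"

lemma S_diff: "\<lbrakk>f \<in> S; g \<in> S\<rbrakk> \<Longrightarrow> (\<lambda>x. f x - g x) \<in> S"
  by (rule csub_diff[OF csub_S])

lemma minus_hilb: "\<lbrakk>f \<in> S; g \<in> S\<rbrakk> \<Longrightarrow> f \<ominus>\<^bsub>hilb S ip\<^esub> g = (\<lambda>x. f x - g x)"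
  using V.uminus_eq[of g] by (simp add: a_minus_def)

lemma ip_add_right: "\<lbrakk>f \<in> S; g \<in> S; h \<in> S\<rbrakk> \<Longrightarrow> ip h (\<lambda>x. f x + g x) = ip h f + ip h g"
  using V.hinner_add_right[of f g h] by simp

lemma ip_scale_right: "\<lbrakk>f \<in> S; h \<in> S\<rbrakk> \<Longrightarrow> ip h (\<lambda>x. c * f x) = cnj c * ip h f"
  using V.hinner_scale_right[of f h c] by simp

lemma ip_diff: "\<lbrakk>f \<in> S; g \<in> S; h \<in> S\<rbrakk> \<Longrightarrow> ip (\<lambda>x. f x - g x) h = ip f h - ip g h"
  using V.hinner_diff_left[of f g h] by (simp add: minus_hilb)

lemma ip_diff_right: "\<lbrakk>f \<in> S; g \<in> S; h \<in> S\<rbrakk> \<Longrightarrow> ip h (\<lambda>x. f x - g x) = ip h f - ip h g"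
  using V.hinner_diff_right[of f g h] by (simp add: minus_hilb)

lemma ip_zero: "f \<in> S \<Longrightarrow> ip (\<lambda>_. 0) f = 0" "f \<in> S \<Longrightarrow> ip f (\<lambda>_. 0) = 0"
  using V.hinner_zero_left[of f] V.hinner_zero_right[of f] by simp_all

lemma ip_self: "f \<in> S \<Longrightarrow> ip f f = of_real ((nrm f)\<^sup>2)"
  using V.hinner_self[of f] ip_nonneg[of f] by simp

lemma ip_cauchy_schwarz: "\<lbrakk>f \<in> S; g \<in> S\<rbrakk> \<Longrightarrow> cmod (ip f g) \<le> nrm f * nrm g"
  using V.cauchy_schwarz[of f g] by simp

lemma nrm_eq_0: "f \<in> S \<Longrightarrow> nrm f = 0 \<longleftrightarrow> f = (\<lambda>_. 0)"
  using ip_self[of f] ip_definite[of f] ip_zero(1)[OF csub_zero[OF csub_S]] by auto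

lemma nrm_scale: "f \<in> S \<Longrightarrow> nrm (\<lambda>x. c * f x) = cmod c * nrm f"
proof -
  assume f: "f \<in> S"
  have "ip (\<lambda>x. c * f x) (\<lambda>x. c * f x) = (c * cnj c) * ip f f"
    using f by (simp add: ip_scale ip_scale_right csub_scale[OF csub_S])
  also have "\<dots> = of_real ((cmod c)\<^sup>2 * (nrm f)\<^sup>2)"
    using ip_self[OF f] by (simp flip: complex_norm_square)
  finally show ?thesis using ip_nonneg[OF f] by (simp add: real_sqrt_mult)
qed

lemma hdist_hilb: "\<lbrakk>f \<in> S; g \<in> S\<rbrakk> \<Longrightarrow> hdist (hilb S ip) f g = nrm (\<lambda>x. f x - g x)"
  by (simp add: hdist_def minus_hilb)

lemma ip_sum:
  assumes "finite I" "\<And>i. i \<in> I \<Longrightarrow> e i \<in> S" "h \<in> S"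
  shows "ip (\<lambda>x. \<Sum>i\<in>I. c i * e i x) h = (\<Sum>i\<in>I. c i * ip (e i) h)"
  using assms(1,2)
proof (induction rule: finite_induct)
  case (insert i I)
  have "ip (\<lambda>x. c i * e i x + (\<Sum>i\<in>I. c i * e i x)) h = c i * ip (e i) h + ip (\<lambda>x. \<Sum>i\<in>I. c i * e i x) h"
    using insert assms(3) by (subst ip_add)
      (auto simp: ip_scale csub_scale[OF csub_S] intro: csub_sum[OF csub_S])
  then show ?case using insert by simp
qed (use assms ip_zero in simp)

lemma ip_sum_right:
  assumes "finite I" "\<And>i. i \<in> I \<Longrightarrow> e i \<in> S" "h \<in> S"
  shows "ip h (\<lambda>x. \<Sum>i\<in>I. c i * e i x) = (\<Sum>i\<in>I. cnj (c i) * ip h (e i))"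
proof -
  have "ip h (\<lambda>x. \<Sum>i\<in>I. c i * e i x) = cnj (ip (\<lambda>x. \<Sum>i\<in>I. c i * e i x) h)"
    using assms by (intro ip_cnj csub_sum[OF csub_S])
  also have "\<dots> = (\<Sum>i\<in>I. cnj (c i) * cnj (ip (e i) h))"
    by (simp add: ip_sum[OF assms])
  also have "\<dots> = (\<Sum>i\<in>I. cnj (c i) * ip h (e i))"
    using assms by (intro sum.cong) (auto simp: ip_cnj[of h])
  finally show ?thesis .
qed

section \<open>Orthonormal systems and dimension\<close>

definition ons :: "nat \<Rightarrow> (nat \<Rightarrow> 'x \<Rightarrow> complex) \<Rightarrow> bool" where
  "ons n e \<longleftrightarrow> (\<forall>i<n. e i \<in> S) \<and> (\<forall>i<n. \<forall>j<n. ip (e i) (e j) = (if i = j then 1 else 0))"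

definition proj :: "nat \<Rightarrow> (nat \<Rightarrow> 'x \<Rightarrow> complex) \<Rightarrow> ('x \<Rightarrow> complex) \<Rightarrow> 'x \<Rightarrow> complex" where
  "proj n e f = (\<lambda>x. \<Sum>i<n. ip f (e i) * e i x)"

definition onb :: "nat \<Rightarrow> (nat \<Rightarrow> 'x \<Rightarrow> complex) \<Rightarrow> ('x \<Rightarrow> complex) set \<Rightarrow> bool" where
  "onb n e E \<longleftrightarrow> ons n e \<and> (\<forall>i<n. e i \<in> E) \<and> (\<forall>f\<in>E. f = proj n e f)"

lemma proj_S: "ons n e \<Longrightarrow> proj n e f \<in> S"
  unfolding proj_def ons_def by (intro csub_sum[OF csub_S]) auto

lemma ip_comb:
  assumes "ons n e" "j < n"
  shows "ip (\<lambda>x. \<Sum>i<n. c i * e i x) (e j) = c j"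
proof -
  have "ip (\<lambda>x. \<Sum>i<n. c i * e i x) (e j) = (\<Sum>i<n. c i * ip (e i) (e j))"
    using assms by (intro ip_sum) (auto simp: ons_def)
  also have "\<dots> = (\<Sum>i<n. if i = j then c i else 0)"
    using assms by (intro sum.cong) (auto simp: ons_def)
  finally show ?thesis using assms by simp
qed

lemma ip_comb_self:
  assumes "ons n e"
  shows "ip (\<lambda>x. \<Sum>i<n. c i * e i x) (\<lambda>x. \<Sum>i<n. c i * e i x) = of_real (\<Sum>i<n. (cmod (c i))\<^sup>2)"
proof -
  have "ip (\<lambda>x. \<Sum>i<n. c i * e i x) (\<lambda>x. \<Sum>i<n. c i * e i x) =
      (\<Sum>j<n. cnj (c j) * ip (\<lambda>x. \<Sum>i<n. c i * e i x) (e j))"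
    using assms by (intro ip_sum_right csub_sum[OF csub_S]) (auto simp: ons_def)
  also have "\<dots> = (\<Sum>j<n. cnj (c j) * c j)"
    using assms by (intro sum.cong) (auto simp: ip_comb)
  also have "\<dots> = of_real (\<Sum>i<n. (cmod (c i))\<^sup>2)"
    unfolding of_real_sum
    by (intro sum.cong) (auto simp: complex_norm_square mult.commute simp del: of_real_power)
  finally show ?thesis .
qed

lemma ip_proj: "\<lbrakk>ons n e; j < n\<rbrakk> \<Longrightarrow> ip (proj n e f) (e j) = ip f (e j)"
  unfolding proj_def by (rule ip_comb)

lemma ip_diff_proj:
  "\<lbrakk>ons n e; j < n; f \<in> S\<rbrakk> \<Longrightarrow> ip (\<lambda>x. f x - proj n e f x) (e j) = 0"
  using proj_S[of n e f] by (simp add: ip_diff ip_proj ons_def)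

lemma ip_diff_proj_proj:
  assumes "ons n e" "f \<in> S"
  shows "ip (\<lambda>x. f x - proj n e f x) (proj n e g) = 0"
proof -
  have "ip (\<lambda>x. f x - proj n e f x) (proj n e g) =
      (\<Sum>j<n. cnj (ip g (e j)) * ip (\<lambda>x. f x - proj n e f x) (e j))"
    unfolding proj_def[of n e g] using assms proj_S
    by (intro ip_sum_right S_diff) (auto simp: ons_def)
  then show ?thesis using assms by (simp add: ip_diff_proj)
qed

lemma pythagoras:
  assumes "ons n e" "f \<in> S"
  shows "Re (ip f f) = Re (ip (proj n e f) (proj n e f)) +
    Re (ip (\<lambda>x. f x - proj n e f x) (\<lambda>x. f x - proj n e f x))"
proof -
  let ?p = "proj n e f" and ?q = "\<lambda>x. f x - proj n e f x"
  have p: "?p \<in> S" and q: "?q \<in> S" using assms proj_S S_diff by auto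
  have "ip f f = ip (\<lambda>x. ?p x + ?q x) (\<lambda>x. ?p x + ?q x)" by simp
  also have "\<dots> = ip ?p ?p + ip ?p ?q + (ip ?q ?p + ip ?q ?q)"
    using p q csub_add[OF csub_S p q] by (simp only: ip_add ip_add_right)
  also have "ip ?q ?p = 0" by (rule ip_diff_proj_proj[OF assms])
  then have "ip ?p ?q = 0" using ip_cnj[OF p q] by simp
  finally show ?thesis using \<open>ip ?q ?p = 0\<close> by simp
qed

lemma bessel:
  assumes "ons n e" "f \<in> S"
  shows "(\<Sum>i<n. (cmod (ip f (e i)))\<^sup>2) \<le> Re (ip f f)"
proof -
  have "Re (ip (proj n e f) (proj n e f)) = (\<Sum>i<n. (cmod (ip f (e i)))\<^sup>2)"
    unfolding proj_def ip_comb_self[OF assms(1)] by simp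
  then show ?thesis
    using pythagoras[OF assms] ip_nonneg[OF S_diff[OF assms(2) proj_S[OF assms(1)], of f]] by simp
qed

lemma parseval:
  assumes "onb n e E" "f \<in> E"
  shows "Re (ip f f) = (\<Sum>i<n. (cmod (ip f (e i)))\<^sup>2)"
proof -
  have "ip f f = ip (proj n e f) (proj n e f)" using assms by (simp add: onb_def)
  then show ?thesis
    unfolding proj_def ip_comb_self[OF assms(1)[unfolded onb_def, THEN conjunct1]] by simp
qed

text \<open>Gram-Schmidt: the new member is the normalized difference of \<open>f\<close> and its
  projection.\<close>

lemma ons_extend:
  assumes E: "csub E" "E \<subseteq> S" and e: "ons n e" "\<And>i. i < n \<Longrightarrow> e i \<in> E"
    and f: "f \<in> E" "f \<noteq> proj n e f"
  shows "\<exists>e'. ons (Suc n) e' \<and> (\<forall>i<Suc n. e' i \<in> E)"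
proof -
  have fS: "f \<in> S" using E f by auto
  define h where "h = (\<lambda>x. f x - proj n e f x)"
  have h: "h \<in> E" unfolding h_def proj_def
    using e f by (intro csub_diff[OF E(1)] csub_sum[OF E(1)]) auto
  then have hS: "h \<in> S" using E by auto
  have "h \<noteq> (\<lambda>_. 0)" using f(2) by (auto simp: h_def fun_eq_iff)
  then have r: "nrm h > 0" using nrm_eq_0[OF hS] ip_nonneg[OF hS] by (simp add: less_le)
  define g where "g = (\<lambda>x. of_real (1 / nrm h) * h x)"
  have g: "g \<in> E" "g \<in> S" 
    unfolding g_def by (rule csub_scale[OF E(1) h], rule csub_scale[OF csub_S hS])
  have "nrm g = 1" using r nrm_scale[OF hS, of "of_real (1 / nrm h)"] by (simp add: g_def norm_divide)
  then have gg: "ip g g = 1" using ip_self[OF g(2)] by simp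
  have ge: "ip g (e j) = 0" if "j < n" for j
  proof -
    have "ip g (e j) = of_real (1 / nrm h) * ip h (e j)"
      unfolding g_def using that e(1) by (intro ip_scale hS) (auto simp: ons_def)
    then show ?thesis using ip_diff_proj[OF e(1) that fS] by (simp add: h_def)
  qed
  have eg: "ip (e j) g = 0" if "j < n" for j
    using ip_cnj[of "e j" g] ge[OF that] that e(1) g by (simp add: ons_def)
  show ?thesis
    by (intro exI[of _ "e(n := g)"])
      (use e g gg ge eg in \<open>auto simp: ons_def less_Suc_eq\<close>)
qed

text \<open>The squared moduli of \<open>ip (b k) (e i)\<close>, summed over both indices, give
  \<open>m\<close> by Parseval for \<open>e\<close> and at most \<open>n\<close> by Bessel for
  \<open>b\<close>.\<close>

lemma ons_card_le:
  assumes e: "onb n e E" and E: "E \<subseteq> S" and b: "ons m b" "\<And>k. k < m \<Longrightarrow> b k \<in> E"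
  shows "m \<le> n"
proof -
  have eo: "ons n e" using e by (simp add: onb_def)
  have "real m = (\<Sum>k<m. Re (ip (b k) (b k)))" using b by (simp add: ons_def)
  also have "\<dots> = (\<Sum>k<m. \<Sum>i<n. (cmod (ip (b k) (e i)))\<^sup>2)"
    using b by (intro sum.cong parseval[OF e]) auto
  also have "\<dots> = (\<Sum>i<n. \<Sum>k<m. (cmod (ip (e i) (b k)))\<^sup>2)"
    using b(1) eo by (subst sum.swap, intro sum.cong)
      (auto simp: ons_def ip_cnj[of "b _" "e _"])
  also have "\<dots> \<le> (\<Sum>i<n. Re (ip (e i) (e i)))"
    using eo by (intro sum_mono bessel[OF b(1)]) (auto simp: ons_def)
  also have "\<dots> = real n" using eo by (simp add: ons_def)
  finally show ?thesis by simp
qed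

text \<open>An orthonormal system in \<open>E\<close> of maximal length is a basis, since otherwise
  \<open>ons_extend\<close> would lengthen it. The bound \<open>N\<close> comes from
  \<open>K_eigenspace_onb\<close> and \<open>CI_onb\<close> in the two applications, and from
  \<open>ons_card_le\<close> for subspaces.\<close>

lemma onb_exists:
  assumes E: "csub E" "E \<subseteq> S"
    and bnd: "\<And>m b. \<lbrakk>ons m b; \<forall>k<m. b k \<in> E\<rbrakk> \<Longrightarrow> m \<le> N"
  shows "\<exists>n e. n \<le> N \<and> onb n e E"
proof -
  define P where "P m \<longleftrightarrow> (\<exists>b. ons m b \<and> (\<forall>k<m. b k \<in> E))" for m
  have "P 0" by (simp add: P_def ons_def)
  moreover have "\<And>m. P m \<Longrightarrow> m \<le> N" using bnd by (auto simp: P_def)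
  ultimately obtain n where n: "P n" "\<And>m. P m \<Longrightarrow> m \<le> n"
    using GreatestI_nat[of P 0 N] Greatest_le_nat[of P _ N] by metis
  then obtain e where e: "ons n e" "\<And>i. i < n \<Longrightarrow> e i \<in> E" by (auto simp: P_def)
  have "f = proj n e f" if "f \<in> E" for f
  proof (rule ccontr)
    assume "f \<noteq> proj n e f"
    then have "P (Suc n)" unfolding P_def using ons_extend[OF E e that] by blast
    then show False using n(2) by fastforce
  qed
  then show ?thesis using e bnd n by (intro exI[of _ n] exI[of _ e]) (auto simp: onb_def)
qed

text \<open>A basis of \<open>D\<close> can be extended by means of a vector of \<open>E\<close>
  outside \<open>D\<close>, so its length is strictly below that of a basis of \<open>E\<close>.
  Descent on this length drives \<open>almost_fixed_minimal\<close>.\<close>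

lemma onb_subspace:
  assumes e: "onb n e E" and E: "E \<subseteq> S" "csub E" and D: "csub D" "D \<subset> E"
  shows "\<exists>m d. m < n \<and> onb m d D"
proof -
  have "m \<le> n" if "ons m b" "\<forall>k<m. b k \<in> D" for m b
    using ons_card_le[OF e E(1) that(1)] that(2) D by blast
  then obtain m d where d: "m \<le> n" "onb m d D"
    using onb_exists[OF D(1)] D(2) E(1) by (meson order_trans psubset_imp_subset)
  obtain f where f: "f \<in> E" "f \<notin> D" using D by blast
  have "proj m d f \<in> D"
    unfolding proj_def using d by (intro csub_sum[OF D(1)]) (auto simp: onb_def)
  then have "f \<noteq> proj m d f" using f by metis
  then obtain e' where "ons (Suc m) e'" "\<forall>i<Suc m. e' i \<in> E"
    using ons_extend[OF E(2,1), of m d f] d D f by (auto simp: onb_def)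
  then have "Suc m \<le> n" using ons_card_le[OF e E(1)] by blast
  then show ?thesis using d by (intro exI[of _ m] exI[of _ d]) auto
qed

text \<open>The coordinates of a Cauchy sequence are Cauchy by Cauchy-Schwarz, and
  \<open>ip_comb_self\<close> computes distances from these finitely many coordinates.\<close>

lemma hilbert_space_hilb:
  assumes e: "onb n e S"
  shows "hilbert_space (hilb S ip)"
proof -
  interpret M: Metric_space S "hdist (hilb S ip)" using V.Metric_space_hdist by simp
  have eo: "ons n e" using e by (simp add: onb_def)
  have "\<exists>x. limitin M.mtopology \<sigma> x sequentially" if s: "M.MCauchy \<sigma>" for \<sigma>
  proof -
    have sS: "\<sigma> k \<in> S" for k using s unfolding M.MCauchy_def by blast
    have "Cauchy (\<lambda>k. ip (\<sigma> k) (e i))" if i: "i < n" for i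
    proof (rule metric_CauchyI)
      fix \<epsilon> :: real assume "\<epsilon> > 0"
      then obtain N where N: "\<And>k l. \<lbrakk>N \<le> k; N \<le> l\<rbrakk> \<Longrightarrow> hdist (hilb S ip) (\<sigma> k) (\<sigma> l) < \<epsilon>"
        using s unfolding M.MCauchy_def by blast
      show "\<exists>M. \<forall>k\<ge>M. \<forall>l\<ge>M. dist (ip (\<sigma> k) (e i)) (ip (\<sigma> l) (e i)) < \<epsilon>"
      proof (intro exI[of _ N] allI impI)
        fix k l assume "N \<le> k" "N \<le> l"
        have ei: "e i \<in> S" "ip (e i) (e i) = 1" using eo i by (auto simp: ons_def)
        have "dist (ip (\<sigma> k) (e i)) (ip (\<sigma> l) (e i)) = cmod (ip (\<lambda>x. \<sigma> k x - \<sigma> l x) (e i))"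
          using ei sS by (simp add: dist_norm ip_diff)
        also have "\<dots> \<le> nrm (\<lambda>x. \<sigma> k x - \<sigma> l x) * nrm (e i)"
          using ei sS S_diff by (intro ip_cauchy_schwarz) auto
        also have "\<dots> < \<epsilon>" using N[OF \<open>N \<le> k\<close> \<open>N \<le> l\<close>] ei sS by (simp add: hdist_hilb)
        finally show "dist (ip (\<sigma> k) (e i)) (ip (\<sigma> l) (e i)) < \<epsilon>" .
      qed
    qed
    then have "\<exists>a. (\<lambda>k. ip (\<sigma> k) (e i)) \<longlonglongrightarrow> a" if "i < n" for i
      using that Cauchy_convergent convergent_def by blast
    then obtain a where a: "\<And>i. i < n \<Longrightarrow> (\<lambda>k. ip (\<sigma> k) (e i)) \<longlonglongrightarrow> a i" by metis
    define x where "x = (\<lambda>t. \<Sum>i<n. a i * e i t)"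
    have x: "x \<in> S" unfolding x_def using eo by (intro csub_sum[OF csub_S]) (auto simp: ons_def)
    have "hdist (hilb S ip) (\<sigma> k) x = sqrt (\<Sum>i<n. (cmod (ip (\<sigma> k) (e i) - a i))\<^sup>2)" for k
    proof -
      have "\<sigma> k = proj n e (\<sigma> k)" using e sS by (simp add: onb_def)
      then have "\<sigma> k t = (\<Sum>i<n. ip (\<sigma> k) (e i) * e i t)" for t
        by (simp add: proj_def fun_eq_iff)
      then have "(\<lambda>t. \<sigma> k t - x t) = (\<lambda>t. \<Sum>i<n. (ip (\<sigma> k) (e i) - a i) * e i t)"
        by (simp add: x_def left_diff_distrib sum_subtractf)
      then show ?thesis using sS x by (simp add: hdist_hilb ip_comb_self[OF eo])
    qed
    moreover have "(\<lambda>k. sqrt (\<Sum>i<n. (cmod (ip (\<sigma> k) (e i) - a i))\<^sup>2)) \<longlonglongrightarrow> sqrt (\<Sum>i<n. (cmod (a i - a i))\<^sup>2)"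
      by (intro tendsto_intros a) auto
    ultimately have "(\<lambda>k. hdist (hilb S ip) (\<sigma> k) x) \<longlonglongrightarrow> 0" by simp
    then have "limitin M.mtopology \<sigma> x sequentially"
      unfolding M.limitin_metric using x sS by (auto dest: order_tendstoD(2))
    then show ?thesis by blast
  qed
  then show ?thesis
    using complex_inner_space_hilb
    by (simp add: hilbert_space_def hilbert_space_axioms_def M.mcomplete_def)
qed

end


section \<open>Convolution operators on a compact group\<close>

context compact_group
begin

text \<open>The value 0 off the carrier makes a function determined by its values on the group;
  otherwise \<open>cip\<close> would not be definite.\<close>

definition CF :: "('a \<Rightarrow> complex) set" where
  "CF = {f. continuous_map T euclidean f \<and> (\<forall>x. x \<notin> carrier G \<longrightarrow> f x = 0)}"

definition cip :: "('a \<Rightarrow> complex) \<Rightarrow> ('a \<Rightarrow> complex) \<Rightarrow> complex" where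
  "cip f g = mean G (\<lambda>x. f x * cnj (g x))"

definition ext0 :: "('a \<Rightarrow> complex) \<Rightarrow> 'a \<Rightarrow> complex" where
  "ext0 f = (\<lambda>x. if x \<in> carrier G then f x else 0)"

lemma ext0_simps [simp]: "x \<in> carrier G \<Longrightarrow> ext0 f x = f x" "x \<notin> carrier G \<Longrightarrow> ext0 f x = 0"
  by (simp_all add: ext0_def)

lemma CF_cont: "f \<in> CF \<Longrightarrow> continuous_map T euclidean f"
  and CF_zero: "\<lbrakk>f \<in> CF; x \<notin> carrier G\<rbrakk> \<Longrightarrow> f x = 0"
  by (simp_all add: CF_def)

lemma CF_eqI: "\<lbrakk>f \<in> CF; g \<in> CF; \<And>x. x \<in> carrier G \<Longrightarrow> f x = g x\<rbrakk> \<Longrightarrow> f = g"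
  by (rule ext) (metis CF_zero)

lemma ext0_CF: "continuous_map T euclidean f \<Longrightarrow> ext0 f \<in> CF"
  unfolding CF_def by (auto simp: topspace_eq intro: continuous_map_eq)

lemma cip_cont:
  "\<lbrakk>continuous_map T euclidean f; continuous_map T euclidean g\<rbrakk>
    \<Longrightarrow> continuous_map T euclidean (\<lambda>x. f x * cnj (g x))"
  by (intro continuous_map_complex_mult continuous_map_cnj)

lemma fun_ip_CF: "fun_ip CF cip"
proof
  show "csub CF"
    unfolding csub_def CF_def by (auto intro!: continuous_map_add continuous_map_complex_mult)
  fix f g h c
  assume f: "f \<in> CF"
  show "0 \<le> Re (cip f f)"
    unfolding cip_def using f by (intro mean_Re_ge cip_cont CF_cont) (simp_all flip: complex_norm_square)
  show "f = (\<lambda>_. 0)" if "cip f f = 0"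
  proof (rule ext, rule ccontr)
    fix x assume "f x \<noteq> 0"
    then have x: "x \<in> carrier G" using CF_zero[OF f] by blast
    have "0 < Re (mean G (\<lambda>x. f x * cnj (f x)))"
      by (rule mean_strict_pos[OF cip_cont[OF CF_cont[OF f] CF_cont[OF f]] _ x])
        (use \<open>f x \<noteq> 0\<close> in \<open>simp_all flip: complex_norm_square\<close>)
    then show False using that by (simp add: cip_def)
  qed
  assume h: "h \<in> CF"
  show "cip (\<lambda>x. c * f x) h = c * cip f h"
    unfolding cip_def using mean_scale[OF cip_cont[OF CF_cont[OF f] CF_cont[OF h]], of c]
    by (simp add: mult.assoc)
  show "cip f h = cnj (cip h f)"
    unfolding cip_def using mean_cnj[OF cip_cont[OF CF_cont[OF h] CF_cont[OF f]]]
    by (simp add: mult.commute)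
  assume g: "g \<in> CF"
  show "cip (\<lambda>x. f x + g x) h = cip f h + cip g h"
    unfolding cip_def
    using mean_add[OF cip_cont[OF CF_cont[OF f] CF_cont[OF h]] cip_cont[OF CF_cont[OF g] CF_cont[OF h]]]
    by (simp add: distrib_right)
qed

sublocale C: fun_ip CF cip by (rule fun_ip_CF)

text \<open>The mean has total mass 1, so \<open>mean_bound\<close> turns uniform estimates into
  estimates in the norm of \<open>cip\<close>.\<close>

lemma nrm_le_sup:
  assumes f: "f \<in> CF" and B: "\<And>x. x \<in> carrier G \<Longrightarrow> cmod (f x) \<le> B"
  shows "C.nrm f \<le> B"
proof -
  have B0: "0 \<le> B" using B[OF one_closed] norm_ge_zero order_trans by blast
  have "cmod (cip f f) \<le> B\<^sup>2"
    unfolding cip_def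
  proof (rule mean_bound[OF cip_cont[OF CF_cont[OF f] CF_cont[OF f]]])
    fix x assume "x \<in> carrier G"
    then show "cmod (f x * cnj (f x)) \<le> B\<^sup>2"
      using B by (simp add: norm_mult power2_eq_square mult_mono')
  qed
  then have "Re (cip f f) \<le> B\<^sup>2" using complex_Re_le_cmod order_trans by blast
  then show ?thesis using B0 real_le_lsqrt C.ip_nonneg[OF f] by blast
qed

text \<open>The right regular representation on \<open>CF\<close>.\<close>

definition rt :: "'a \<Rightarrow> ('a \<Rightarrow> complex) \<Rightarrow> 'a \<Rightarrow> complex" where
  "rt g f = ext0 (\<lambda>x. f (x \<otimes> g))"

lemma rt_CF: "\<lbrakk>f \<in> CF; g \<in> carrier G\<rbrakk> \<Longrightarrow> rt g f \<in> CF"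
  unfolding rt_def by (intro ext0_CF continuous_map_comp2[OF CF_cont] continuous_map_rtrans)

lemma rt_apply: "x \<in> carrier G \<Longrightarrow> rt g f x = f (x \<otimes> g)"
  by (simp add: rt_def)

lemma rt_rt:
  assumes "g \<in> carrier G" "h \<in> carrier G"
  shows "rt g (rt h f) = rt (g \<otimes> h) f"
  unfolding rt_def ext0_def using assms by (auto simp: m_assoc)

lemma rt_linear:
  "rt g (\<lambda>x. f x + h x) = (\<lambda>x. rt g f x + rt g h x)"
  "rt g (\<lambda>x. f x - h x) = (\<lambda>x. rt g f x - rt g h x)"
  "rt g (\<lambda>x. c * f x) = (\<lambda>x. c * rt g f x)"
  by (auto simp: rt_def ext0_def)

lemma cip_rt:
  assumes f: "f \<in> CF" and h: "h \<in> CF" and g: "g \<in> carrier G"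
  shows "cip (rt g f) (rt g h) = cip f h"
proof -
  have "cip (rt g f) (rt g h) = mean G (\<lambda>x. f (x \<otimes> g) * cnj (h (x \<otimes> g)))"
    unfolding cip_def by (rule mean_cong) (simp add: rt_apply)
  also have "\<dots> = cip f h"
    unfolding cip_def using mean_rtranslate[OF cip_cont[OF CF_cont[OF f] CF_cont[OF h]] g] .
  finally show ?thesis .
qed

lemma cip_rt_left:
  assumes f: "f \<in> CF" and h: "h \<in> CF" and g: "g \<in> carrier G"
  shows "cip (rt g f) h = cip f (rt (inv g) h)"
proof -
  have "h = rt g (rt (inv g) h)"
    using h g by (intro CF_eqI rt_CF) (auto simp: rt_rt rt_apply)
  then show ?thesis using cip_rt[OF f rt_CF[OF h, of "inv g"] g] g by simp
qed

end


section \<open>Convolution with a Hermitian kernel\<close>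

locale symmetric_kernel = compact_group +
  fixes k :: "'a \<Rightarrow> complex"
  assumes k_cont: "continuous_map T euclidean k"
    and k_sym: "x \<in> carrier G \<Longrightarrow> k (inv x) = cnj (k x)"
begin

text \<open>The conjugated kernel row at \<open>x\<close>: evaluating \<open>K f\<close> at
  \<open>x\<close> becomes an inner product with \<open>kv x\<close> (\<open>K_eq_cip\<close>), so
  Cauchy-Schwarz and Bessel apply to point values.\<close>

definition kv :: "'a \<Rightarrow> 'a \<Rightarrow> complex" where
  "kv x = ext0 (\<lambda>y. cnj (k (x \<otimes> inv y)))"

text \<open>Left convolution with \<open>k\<close>. The kernel depends on
  \<open>x \<otimes> inv y\<close> only, so \<open>K\<close> commutes with right translations
  (\<open>K_rt\<close>), and \<open>k_sym\<close> makes it symmetric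
  (\<open>K_symmetric\<close>).\<close>

definition K :: "('a \<Rightarrow> complex) \<Rightarrow> 'a \<Rightarrow> complex" where
  "K f = ext0 (\<lambda>x. mean G (\<lambda>y. k (x \<otimes> inv y) * f y))"

lemma kernel_cont: "continuous_map (prod_topology T T) euclidean (\<lambda>(x, y). k (x \<otimes> inv y))"
  unfolding case_prod_unfold
  by (intro continuous_map_comp2[OF k_cont] continuous_map_gmult continuous_map_inv)
    (auto simp: continuous_map_fst continuous_map_snd)

lemma kv_CF: "x \<in> carrier G \<Longrightarrow> kv x \<in> CF"
  unfolding kv_def
  by (intro ext0_CF continuous_map_cnj continuous_map_section(1)[OF kernel_cont]) (simp add: topspace_eq)

lemma K_eq_cip: "x \<in> carrier G \<Longrightarrow> K f x = cip f (kv x)"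
  unfolding K_def cip_def kv_def by (simp add: mult.commute cong: mean_cong)

lemma continuous_kernel_mult:
  assumes f: "f \<in> CF"
  shows "continuous_map (prod_topology T T) euclidean (\<lambda>(x, y). k (x \<otimes> inv y) * f y)"
  using kernel_cont unfolding case_prod_unfold
  by (intro continuous_map_complex_mult continuous_map_comp2[OF CF_cont[OF f]])
    (auto simp: continuous_map_snd)

lemma K_CF: "f \<in> CF \<Longrightarrow> K f \<in> CF"
  unfolding K_def by (intro ext0_CF continuous_mean[OF continuous_kernel_mult])

lemma K_linear:
  assumes "f \<in> CF" "g \<in> CF"
  shows "K (\<lambda>x. f x + g x) = (\<lambda>x. K f x + K g x)" "K (\<lambda>x. f x - g x) = (\<lambda>x. K f x - K g x)"
    "K (\<lambda>x. c * f x) = (\<lambda>x. c * K f x)"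
proof -
  note sub = csub_add[OF C.csub_S] C.S_diff csub_scale[OF C.csub_S]
  show "K (\<lambda>x. f x + g x) = (\<lambda>x. K f x + K g x)"
    using assms by (intro CF_eqI K_CF sub) (simp_all add: K_eq_cip C.ip_add kv_CF)
  show "K (\<lambda>x. f x - g x) = (\<lambda>x. K f x - K g x)"
    using assms by (intro CF_eqI K_CF sub) (simp_all add: K_eq_cip C.ip_diff kv_CF)
  show "K (\<lambda>x. c * f x) = (\<lambda>x. c * K f x)"
    using assms by (intro CF_eqI K_CF sub) (simp_all add: K_eq_cip C.ip_scale kv_CF)
qed

lemma K_bound: "\<exists>B>0. (\<forall>x\<in>carrier G. C.nrm (kv x) \<le> B) \<and> (\<forall>f\<in>CF. \<forall>x\<in>carrier G. cmod (K f x) \<le> B * C.nrm f)"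
proof -
  obtain B where B: "\<And>x. x \<in> carrier G \<Longrightarrow> cmod (k x) \<le> B"
    using continuous_bounded[OF k_cont] by blast
  have kv: "C.nrm (kv x) \<le> max 1 B" if "x \<in> carrier G" for x
    using that B by (intro nrm_le_sup kv_CF) (auto simp: kv_def le_max_iff_disj)
  have "cmod (K f x) \<le> max 1 B * C.nrm f" if "f \<in> CF" "x \<in> carrier G" for f x
  proof -
    have "cmod (K f x) \<le> C.nrm f * C.nrm (kv x)"
      using that by (simp add: K_eq_cip C.ip_cauchy_schwarz kv_CF)
    also have "\<dots> \<le> C.nrm f * max 1 B"
      using kv[OF that(2)] C.ip_nonneg[OF that(1)] by (intro mult_left_mono) auto
    finally show ?thesis by (simp add: mult.commute)
  qed
  then show ?thesis using kv by (intro exI[of _ "max 1 B"]) auto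
qed

text \<open>A difference of two values of \<open>K f\<close> is the inner product of
  \<open>f\<close> with a difference of kernel rows, which is uniformly small for nearby points.
  Images of the unit ball are therefore equicontinuous.\<close>

lemma K_equicontinuous:
  assumes x0: "x0 \<in> carrier G" and e: "e > 0"
  shows "\<exists>U. openin T U \<and> x0 \<in> U \<and> (\<forall>f\<in>CF. \<forall>x\<in>U. cmod (K f x - K f x0) \<le> e * C.nrm f)"
proof -
  obtain U where U: "openin T U" "x0 \<in> U"
      "\<And>x y. \<lbrakk>x \<in> U; y \<in> carrier G\<rbrakk> \<Longrightarrow> cmod (k (x \<otimes> inv y) - k (x0 \<otimes> inv y)) < e"
    using continuous_map_tube[OF kernel_cont compact _ e, of x0] x0 unfolding topspace_eq by blast
  have "cmod (K f x - K f x0) \<le> e * C.nrm f" if f: "f \<in> CF" and x: "x \<in> U" for f x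
  proof -
    have xG: "x \<in> carrier G" using openin_subset[OF U(1)] x topspace_eq by blast
    have d: "(\<lambda>y. kv x y - kv x0 y) \<in> CF" using kv_CF xG x0 C.S_diff by blast
    have "K f x - K f x0 = cip f (\<lambda>y. kv x y - kv x0 y)"
      using xG x0 f by (simp add: K_eq_cip C.ip_diff_right kv_CF)
    then have "cmod (K f x - K f x0) \<le> C.nrm f * C.nrm (\<lambda>y. kv x y - kv x0 y)"
      using C.ip_cauchy_schwarz[OF f d] by simp
    also have "C.nrm (\<lambda>y. kv x y - kv x0 y) \<le> e"
      using U(3)[OF x] by (intro nrm_le_sup d)
        (auto simp: kv_def simp flip: complex_cnj_diff intro: less_imp_le)
    then have "C.nrm f * C.nrm (\<lambda>y. kv x y - kv x0 y) \<le> C.nrm f * e"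
      using C.ip_nonneg[OF f] by (intro mult_left_mono) auto
    finally show ?thesis by (simp add: mult.commute)
  qed
  then show ?thesis using U(1,2) by blast
qed

lemma K_symmetric:
  assumes f: "f \<in> CF" and g: "g \<in> CF"
  shows "cip (K f) g = cip f (K g)"
proof -
  have F: "continuous_map (prod_topology T T) euclidean (\<lambda>(x, y). (k (x \<otimes> inv y) * f y) * cnj (g x))"
    unfolding case_prod_unfold
    by (intro continuous_map_complex_mult[OF continuous_kernel_mult[OF f, unfolded case_prod_unfold]]
        continuous_map_cnj continuous_map_comp2[OF CF_cont[OF g]])
      (auto simp: continuous_map_fst)
  have kf: "continuous_map T euclidean (\<lambda>y. k (x \<otimes> inv y) * f y)" if "x \<in> carrier G" for x
    using continuous_map_section(1)[OF continuous_kernel_mult[OF f]] that topspace_eq by blast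
  have kg: "continuous_map T euclidean (\<lambda>x. k (y \<otimes> inv x) * g x)" if "y \<in> carrier G" for y
    using continuous_map_section(1)[OF continuous_kernel_mult[OF g]] that topspace_eq by blast
  have "cip (K f) g = mean G (\<lambda>x. mean G (\<lambda>y. (k (x \<otimes> inv y) * f y) * cnj (g x)))"
    unfolding cip_def K_def
  proof (rule mean_cong)
    fix x assume x: "x \<in> carrier G"
    show "ext0 (\<lambda>x. mean G (\<lambda>y. k (x \<otimes> inv y) * f y)) x * cnj (g x) =
        mean G (\<lambda>y. k (x \<otimes> inv y) * f y * cnj (g x))"
      using x mean_scale[OF kf[OF x], of "cnj (g x)"] by (simp add: mult.commute)
  qed
  also have "\<dots> = mean G (\<lambda>y. mean G (\<lambda>x. (k (x \<otimes> inv y) * f y) * cnj (g x)))"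
    by (rule mean_Fubini[OF F])
  also have "\<dots> = cip f (K g)"
    unfolding cip_def
  proof (rule mean_cong)
    fix y assume y: "y \<in> carrier G"
    have "mean G (\<lambda>x. (k (x \<otimes> inv y) * f y) * cnj (g x)) =
        mean G (\<lambda>x. f y * cnj (k (y \<otimes> inv x) * g x))"
    proof (rule mean_cong)
      fix x assume x: "x \<in> carrier G"
      have "inv (y \<otimes> inv x) = x \<otimes> inv y" using x y by (simp add: inv_mult_group)
      then show "k (x \<otimes> inv y) * f y * cnj (g x) = f y * cnj (k (y \<otimes> inv x) * g x)"
        using k_sym[of "y \<otimes> inv x"] x y by simp
    qed
    also have "\<dots> = f y * cnj (K g y)"
      using mean_scale[OF continuous_map_cnj[OF kg[OF y]], of "f y"] mean_cnj[OF kg[OF y]] y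
      by (simp add: K_def)
    finally show "mean G (\<lambda>x. (k (x \<otimes> inv y) * f y) * cnj (g x)) = f y * cnj (K g y)" .
  qed
  finally show ?thesis .
qed

lemma K_rt:
  assumes f: "f \<in> CF" and g: "g \<in> carrier G"
  shows "K (rt g f) = rt g (K f)"
proof (rule CF_eqI)
  show "K (rt g f) \<in> CF" "rt g (K f) \<in> CF" using K_CF rt_CF f g by auto
  fix x assume x: "x \<in> carrier G"
  have "continuous_map T euclidean (\<lambda>y. k (x \<otimes> g \<otimes> inv y) * f y)"
    using continuous_map_section(1)[OF continuous_kernel_mult[OF f]] x g topspace_eq by blast
  from mean_rtranslate[OF this g]
  have "mean G (\<lambda>y. k (x \<otimes> g \<otimes> inv (y \<otimes> g)) * f (y \<otimes> g)) = K f (x \<otimes> g)"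
    using x g by (simp add: K_def)
  moreover have "K (rt g f) x = mean G (\<lambda>y. k (x \<otimes> g \<otimes> inv (y \<otimes> g)) * f (y \<otimes> g))"
    unfolding K_def using x
  proof (simp, intro mean_cong)
    fix y assume y: "y \<in> carrier G"
    have "x \<otimes> g \<otimes> inv (y \<otimes> g) = x \<otimes> inv y"
      using x y g by (simp add: inv_mult_group m_assoc[symmetric])
        (simp add: m_assoc)
    then show "k (x \<otimes> inv y) * rt g f y = k (x \<otimes> g \<otimes> inv (y \<otimes> g)) * f (y \<otimes> g)"
      using y by (simp add: rt_apply)
  qed
  ultimately show "K (rt g f) x = rt g (K f) x" using x by (simp add: rt_apply)
qed

text \<open>Arzela-Ascoli: for each scale there is a finite net such that every point has a net
  point at which all the images take nearly the same value; a diagonal subsequence converges on the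
  countable union of the nets, hence is uniformly Cauchy.\<close>

lemma K_compact:
  assumes f: "\<And>n. f n \<in> CF" "\<And>n. C.nrm (f n) \<le> 1"
  shows "\<exists>r h. strict_mono (r :: nat \<Rightarrow> nat) \<and> h \<in> CF \<and> uniform_limit (carrier G) (\<lambda>n. K (f (r n))) h sequentially"
proof -
  obtain B where B: "B > 0" "\<And>f x. \<lbrakk>f \<in> CF; x \<in> carrier G\<rbrakk> \<Longrightarrow> cmod (K f x) \<le> B * C.nrm f"
    using K_bound by blast
  have bnd: "cmod (K (f n) x) \<le> B" if "x \<in> carrier G" for n x
  proof -
    have "B * C.nrm (f n) \<le> B * 1" using B(1) f(2)[of n] by (intro mult_left_mono) auto
    then show ?thesis using B(2)[OF f(1) that, of n] by linarith
  qed
  have osc: "\<exists>U. openin T U \<and> x0 \<in> U \<and> (\<forall>x\<in>U. \<forall>n. cmod (K (f n) x - K (f n) x0) \<le> e)"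
    if xe: "x0 \<in> carrier G" "e > 0" for x0 e
  proof -
    obtain U where U: "openin T U" "x0 \<in> U" "\<And>f x. \<lbrakk>f\<in>CF; x\<in>U\<rbrakk> \<Longrightarrow> cmod (K f x - K f x0) \<le> e * C.nrm f"
      using K_equicontinuous[OF xe] by blast
    have "cmod (K (f n) x - K (f n) x0) \<le> e" if "x \<in> U" for n x
    proof -
      have "e * C.nrm (f n) \<le> e * 1" using xe(2) f(2)[of n] by (intro mult_left_mono) auto
      then show ?thesis using U(3)[OF f(1) that, of n] by linarith
    qed
    then show ?thesis using U by blast
  qed
  have "\<exists>N. finite N \<and> N \<subseteq> carrier G \<and>
      (\<forall>x\<in>carrier G. \<exists>x0\<in>N. \<forall>n. cmod (K (f n) x - K (f n) x0) \<le> e)" if e: "e > 0" for e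
  proof -
    obtain U where U: "\<And>x0. x0 \<in> carrier G \<Longrightarrow> openin T (U x0) \<and> x0 \<in> U x0"
        "\<And>x0 x n. \<lbrakk>x0 \<in> carrier G; x \<in> U x0\<rbrakk> \<Longrightarrow> cmod (K (f n) x - K (f n) x0) \<le> e"
      using osc[OF _ e] by metis
    have "carrier G \<subseteq> \<Union>(U ` carrier G)" using U(1) by blast
    then obtain \<F> where "finite \<F>" "\<F> \<subseteq> U ` carrier G" "carrier G \<subseteq> \<Union>\<F>"
      using compactinD[of T "topspace T" "U ` carrier G"] compact U(1)
      unfolding compact_space_def topspace_eq by blast
    then obtain N where N: "finite N" "N \<subseteq> carrier G" "carrier G \<subseteq> \<Union>(U ` N)"
      by (metis finite_subset_image)
    have "\<exists>x0\<in>N. \<forall>n. cmod (K (f n) x - K (f n) x0) \<le> e" if "x \<in> carrier G" for x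
      using N that U(2) by blast
    then show ?thesis using N by blast
  qed
  then have "\<forall>j. \<exists>N. finite N \<and> N \<subseteq> carrier G \<and>
      (\<forall>x\<in>carrier G. \<exists>x0\<in>N. \<forall>n. cmod (K (f n) x - K (f n) x0) \<le> inverse (real (Suc j)))"
    by simp
  then obtain N where N: "\<And>j. finite (N j)" "\<And>j. N j \<subseteq> carrier G"
      "\<And>j x. x \<in> carrier G \<Longrightarrow> \<exists>x0\<in>N j. \<forall>n. cmod (K (f n) x - K (f n) x0) \<le> inverse (real (Suc j))"
    by metis
  have "countable (\<Union>j. N j)" using N(1) by (simp add: countable_finite)
  then obtain r where r: "strict_mono (r :: nat \<Rightarrow> nat)"
      "\<And>x. x \<in> (\<Union>j. N j) \<Longrightarrow> \<exists>l. (\<lambda>n. K (f (r n)) x) \<longlonglongrightarrow> l"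
    using function_convergent_subsequence[of "\<Union>j. N j" "\<lambda>n. K (f n)" B] bnd N(2) by blast
  have "uniformly_Cauchy_on (carrier G) (\<lambda>n. K (f (r n)))"
    unfolding uniformly_Cauchy_on_def
  proof (intro allI impI)
    fix e :: real assume e: "e > 0"
    then obtain j where j: "inverse (real (Suc j)) < e / 3"
      using reals_Archimedean[of "e / 3"] by auto
    have "\<exists>M. \<forall>m\<ge>M. \<forall>n\<ge>M. dist (K (f (r m)) x) (K (f (r n)) x) < e / 3" if "x \<in> N j" for x
      using metric_CauchyD[OF LIMSEQ_imp_Cauchy, of "\<lambda>n. K (f (r n)) x" _ "e / 3"] r(2)[of x] that e by auto
    then obtain M where M: "\<And>x m n. \<lbrakk>x \<in> N j; M x \<le> m; M x \<le> n\<rbrakk> \<Longrightarrow> dist (K (f (r m)) x) (K (f (r n)) x) < e / 3"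
      by metis
    show "\<exists>M. \<forall>x\<in>carrier G. \<forall>m\<ge>M. \<forall>n\<ge>M. dist (K (f (r m)) x) (K (f (r n)) x) < e"
    \<comment> \<open>The sum of the thresholds over the finite net dominates each of them.\<close>
    proof (intro exI[of _ "\<Sum>x\<in>N j. M x"] ballI allI impI)
      fix x m n assume x: "x \<in> carrier G" and mn: "(\<Sum>x\<in>N j. M x) \<le> m" "(\<Sum>x\<in>N j. M x) \<le> n"
      obtain x0 where x0: "x0 \<in> N j" "\<And>n. cmod (K (f n) x - K (f n) x0) \<le> inverse (real (Suc j))"
        using N(3)[OF x] by blast
      have "M x0 \<le> (\<Sum>x\<in>N j. M x)" using x0(1) N(1) by (intro member_le_sum) auto
      then have "dist (K (f (r m)) x0) (K (f (r n)) x0) < e / 3" using M[OF x0(1)] mn by simp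
      moreover have "dist (K (f (r m)) x) (K (f (r m)) x0) < e / 3"
        "dist (K (f (r n)) x0) (K (f (r n)) x) < e / 3"
        using x0(2)[of "r m"] x0(2)[of "r n"] j by (simp_all add: dist_norm norm_minus_commute)
      ultimately show "dist (K (f (r m)) x) (K (f (r n)) x) < e"
        using dist_triangle[of "K (f (r m)) x" "K (f (r n)) x" "K (f (r m)) x0"]
          dist_triangle[of "K (f (r m)) x0" "K (f (r n)) x" "K (f (r n)) x0"] by linarith
    qed
  qed
  then obtain l where l: "uniform_limit (carrier G) (\<lambda>n. K (f (r n))) l sequentially"
    using Cauchy_uniformly_convergent uniformly_convergent_on_def by blast
  have lim: "(\<lambda>n. K (f (r n)) x) \<longlonglongrightarrow> l x" if "x \<in> carrier G" for x
    using tendsto_uniform_limitI[OF l that] .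
  have "continuous_map T euclidean l"
  proof (rule continuous_map_complexI)
    fix x0 and e :: real assume "x0 \<in> topspace T" and e: "e > 0"
    then have x0: "x0 \<in> carrier G" by (simp add: topspace_eq)
    obtain U where U: "openin T U" "x0 \<in> U" "\<And>x n. x \<in> U \<Longrightarrow> cmod (K (f n) x - K (f n) x0) \<le> e / 2"
      using osc[OF x0, of "e / 2"] e by auto
    have "cmod (l x - l x0) < e" if x: "x \<in> U" for x
    proof -
      have xG: "x \<in> carrier G" using openin_subset[OF U(1)] x topspace_eq by blast
      have "(\<lambda>n. cmod (K (f (r n)) x - K (f (r n)) x0)) \<longlonglongrightarrow> cmod (l x - l x0)"
        by (intro tendsto_intros lim xG x0)
      then have "cmod (l x - l x0) \<le> e / 2"
        by (rule LIMSEQ_le_const2) (use U(3)[OF x] in auto)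
      then show ?thesis using e by simp
    qed
    then show "\<exists>U. openin T U \<and> x0 \<in> U \<and> (\<forall>y\<in>U. cmod (l y - l x0) < e)" using U by blast
  qed
  then have "ext0 l \<in> CF" by (rule ext0_CF)
  moreover have "uniform_limit (carrier G) (\<lambda>n. K (f (r n))) (ext0 l) sequentially"
    using l by (rule uniform_limit_cong'[THEN iffD1, rotated -1]) auto
  ultimately show ?thesis using r(1) by blast
qed

end

definition (in compact_group) perp :: "('a \<Rightarrow> complex) set \<Rightarrow> ('a \<Rightarrow> complex) set" where
  "perp A = {f \<in> CF. \<forall>v\<in>A. cip f v = 0}"

lemma (in compact_group) csub_perp: "A \<subseteq> CF \<Longrightarrow> csub (perp A)"
  unfolding csub_def perp_def
  using csub_zero[OF C.csub_S] csub_add[OF C.csub_S] csub_scale[OF C.csub_S]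
  by (auto simp: C.ip_add C.ip_scale C.ip_zero subset_iff)

section \<open>Eigenvectors and eigenspaces of the squared operator\<close>

context symmetric_kernel
begin

lemma K_nrm: "\<exists>B>0. \<forall>f\<in>CF. C.nrm (K f) \<le> B * C.nrm f"
  using K_bound nrm_le_sup K_CF by meson

lemma K_nrm_tendsto:
  assumes g: "\<And>n. g n \<in> CF" and lim: "(\<lambda>n. C.nrm (g n)) \<longlonglongrightarrow> 0"
  shows "(\<lambda>n. C.nrm (K (g n))) \<longlonglongrightarrow> 0" and "x \<in> carrier G \<Longrightarrow> (\<lambda>n. K (g n) x) \<longlonglongrightarrow> 0"
proof -
  obtain B where B: "\<And>f. f \<in> CF \<Longrightarrow> C.nrm (K f) \<le> B * C.nrm f" using K_nrm by blast
  have "(\<lambda>n. B * C.nrm (g n)) \<longlonglongrightarrow> B * 0" by (intro tendsto_intros lim)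
  then show "(\<lambda>n. C.nrm (K (g n))) \<longlonglongrightarrow> 0"
    by (intro tendsto_sandwich[of "\<lambda>_. 0" "\<lambda>n. C.nrm (K (g n))" sequentially "\<lambda>n. B * C.nrm (g n)"])
      (use B g C.ip_nonneg K_CF in auto)
  obtain B where B: "\<And>f x. f \<in> CF \<Longrightarrow> x \<in> carrier G \<Longrightarrow> cmod (K f x) \<le> B * C.nrm f" using K_bound by blast
  have "(\<lambda>n. B * C.nrm (g n)) \<longlonglongrightarrow> B * 0" by (intro tendsto_intros lim)
  then show "(\<lambda>n. K (g n) x) \<longlonglongrightarrow> 0" if "x \<in> carrier G"
    using B[OF g that] by (intro Lim_null_comparison[of "\<lambda>n. K (g n) x" "\<lambda>n. B * C.nrm (g n)"]) auto
qed

text \<open>A sequence of unit vectors maximizing \<open>\<parallel>K f\<parallel>\<close> satisfies \<open>\<parallel>K (K f) - s f\<parallel> \<longlongrightarrow> 0\<close>, and by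
  compactness a subsequence of the images converges uniformly, necessarily to an eigenvector. No
  completeness of the space of continuous functions in the \<open>L\<^sup>2\<close> norm is needed.\<close>

lemma K_eigenvector:
  assumes A: "A \<subseteq> CF" and inv: "\<And>f. f \<in> perp A \<Longrightarrow> K f \<in> perp A"
    and h0: "h0 \<in> perp A" "K h0 \<noteq> (\<lambda>_. 0)"
  shows "\<exists>s>0. \<exists>h\<in>perp A. h \<noteq> (\<lambda>_. 0) \<and> K (K h) = (\<lambda>x. complex_of_real s * h x)"
proof -
  define W where "W = perp A"
  have W: "csub W" "W \<subseteq> CF" using csub_perp[OF A] by (auto simp: W_def perp_def)
  obtain B where B: "B > 0" "\<And>f. f \<in> CF \<Longrightarrow> C.nrm (K f) \<le> B * C.nrm f"
    using K_nrm by blast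
  define R where "R = {(C.nrm (K f))\<^sup>2 | f. f \<in> W \<and> C.nrm f = 1}"
  have normalize: "\<exists>g\<in>W. C.nrm g = 1 \<and> C.nrm (K g) = C.nrm (K f) / C.nrm f" if f: "f \<in> W" "C.nrm f \<noteq> 0" for f
  proof -
    define c where "c = complex_of_real (1 / C.nrm f)"
    have fC: "f \<in> CF" using f W by auto
    have pos: "C.nrm f > 0" using f C.ip_nonneg[OF fC] by (simp add: less_le)
    have cc: "cmod c = 1 / C.nrm f" using pos by (simp add: c_def norm_divide)
    have "(\<lambda>x. c * f x) \<in> W" using csub_scale[OF W(1) f(1)] .
    moreover have "C.nrm (\<lambda>x. c * f x) = 1" using C.nrm_scale[OF fC, of c] cc pos by simp
    moreover have "C.nrm (K (\<lambda>x. c * f x)) = C.nrm (K f) / C.nrm f"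
      using C.nrm_scale[OF K_CF[OF fC], of c] cc K_linear(3)[OF fC fC, of c] by simp
    ultimately show ?thesis by blast
  qed
  have bdd: "bdd_above R"
  proof (rule bdd_aboveI)
    fix a assume "a \<in> R"
    then obtain f where f: "f \<in> W" "C.nrm f = 1" "a = (C.nrm (K f))\<^sup>2" by (auto simp: R_def)
    then have "C.nrm (K f) \<le> B" using B(2)[of f] W by auto
    then show "a \<le> B\<^sup>2" using f C.ip_nonneg K_CF W by (auto intro!: power_mono simp del: real_sqrt_pow2)
  qed
  \<comment> \<open>By symmetry \<open>s\<close> is the supremum of \<open>cip (K (K f)) f\<close>
    over unit vectors. The square of \<open>K\<close> is positive, so a maximizing sequence leads to
    the eigenvalue \<open>s\<close> with no choice of sign.\<close>
  define s where "s = Sup R"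
  have R_le: "(C.nrm (K f))\<^sup>2 \<le> s" if "f \<in> W" "C.nrm f = 1" for f
    unfolding s_def using that by (intro cSup_upper[OF _ bdd]) (auto simp: R_def)
  have h0C: "h0 \<in> CF" using h0 W by (auto simp: W_def)
  have nz: "C.nrm (K h0) \<noteq> 0" using C.nrm_eq_0[OF K_CF[OF h0C]] h0 by simp
  have "h0 \<noteq> (\<lambda>_. 0)" using h0 K_linear(3)[OF h0C h0C, of 0] by auto
  then have nz': "C.nrm h0 \<noteq> 0" using C.nrm_eq_0[OF h0C] by simp
  obtain g0 where g0: "g0 \<in> W" "C.nrm g0 = 1" "C.nrm (K g0) = C.nrm (K h0) / C.nrm h0"
    using normalize[of h0] h0 nz' by (auto simp: W_def)
  have "0 < (C.nrm (K g0))\<^sup>2" unfolding g0(3) using nz nz' by simp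
  then have s: "s > 0" using R_le[OF g0(1,2)] by linarith
  have key: "(C.nrm (K f))\<^sup>2 \<le> s * (C.nrm f)\<^sup>2" if f: "f \<in> W" for f
  proof (cases "C.nrm f = 0")
    case True
    then have "f = (\<lambda>_. 0)" using C.nrm_eq_0 f W by blast
    then have "K f = (\<lambda>_. 0)" using K_linear(3)[of f f 0] f W by auto
    then show ?thesis using True C.nrm_eq_0[OF csub_zero[OF C.csub_S]] by simp
  next
    case False
    then obtain g where "g \<in> W" "C.nrm g = 1" "C.nrm (K g) = C.nrm (K f) / C.nrm f"
      using normalize[OF f] by blast
    then have "(C.nrm (K f) / C.nrm f)\<^sup>2 \<le> s" using R_le by metis
    moreover have "0 < (C.nrm f)\<^sup>2" using False by (simp only: zero_less_power2 not_False_eq_True)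
    ultimately show ?thesis
      unfolding power_divide by (simp only: divide_le_eq if_True)
  qed
  have "\<exists>f\<in>W. C.nrm f = 1 \<and> s - inverse (real (Suc n)) < (C.nrm (K f))\<^sup>2" for n
    using less_cSupD[of R "s - inverse (real (Suc n))"] g0 by (auto simp: s_def R_def)
  then obtain f where f: "\<And>n. f n \<in> W" "\<And>n. C.nrm (f n) = 1"
      "\<And>n. s - inverse (real (Suc n)) < (C.nrm (K (f n)))\<^sup>2" by metis
  have fC: "f n \<in> CF" for n using f(1) W by auto
  obtain r h where r: "strict_mono (r :: nat \<Rightarrow> nat)" and h: "h \<in> CF"
      and lim: "uniform_limit (carrier G) (\<lambda>n. K (f (r n))) h sequentially"
    using K_compact[of f] fC f(2) by auto
  define hn where "hn n = K (f (r n))" for n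
  have hnW: "hn n \<in> W" for n using inv f(1) by (simp add: hn_def W_def)
  have hnC: "hn n \<in> CF" for n using hnW W by auto
  have diffC: "(\<lambda>x. hn n x - h x) \<in> CF" for n using hnC h C.S_diff by blast
  have hlim: "(\<lambda>n. C.nrm (\<lambda>x. hn n x - h x)) \<longlonglongrightarrow> 0"
  proof (rule tendstoI)
    fix e :: real assume e: "e > 0"
    have "\<forall>\<^sub>F n in sequentially. \<forall>x\<in>carrier G. dist (K (f (r n)) x) (h x) < e / 2"
      using lim half_gt_zero[OF e] unfolding uniform_limit_iff by blast
    then show "\<forall>\<^sub>F n in sequentially. dist (C.nrm (\<lambda>x. hn n x - h x)) 0 < e"
    proof eventually_elim
      case (elim n)
      have "C.nrm (\<lambda>x. hn n x - h x) \<le> e / 2"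
        using elim by (intro nrm_le_sup diffC) (auto simp: hn_def dist_norm intro: less_imp_le)
      then show ?case using e C.ip_nonneg[OF diffC] by (simp add: dist_norm)
    qed
  qed
  \<comment> \<open>\<open>perp A\<close> is closed under limits in norm, by Cauchy-Schwarz.\<close>
  have hW: "h \<in> W"
  proof -
    have "cip h v = 0" if v: "v \<in> A" for v
    proof -
      have vC: "v \<in> CF" using v A by auto
      have "cmod (cip h v) \<le> C.nrm (\<lambda>x. hn n x - h x) * C.nrm v" for n
      proof -
        have "cip (\<lambda>x. hn n x - h x) v = - cip h v"
          using hnW[of n] v hnC h vC by (simp add: C.ip_diff W_def perp_def)
        then show ?thesis using C.ip_cauchy_schwarz[OF diffC[of n] vC] by simp
      qed
      moreover have "(\<lambda>n. C.nrm (\<lambda>x. hn n x - h x) * C.nrm v) \<longlonglongrightarrow> 0 * C.nrm v"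
        by (intro tendsto_intros hlim)
      ultimately have "cmod (cip h v) \<le> 0 * C.nrm v" by (intro LIMSEQ_le_const) auto
      then show ?thesis by simp
    qed
    then show ?thesis using h by (simp add: W_def perp_def)
  qed
  \<comment> \<open>The squared norms of \<open>hn n\<close> exceed a sequence that tends to
    \<open>s > 0\<close>, so the limit cannot vanish.\<close>
  have h_nz: "h \<noteq> (\<lambda>_. 0)"
  proof
    assume "h = (\<lambda>_. 0)"
    then have "(\<lambda>n. C.nrm (hn n)) \<longlonglongrightarrow> 0" using hlim by simp
    then have a: "(\<lambda>n. (C.nrm (hn n))\<^sup>2) \<longlonglongrightarrow> 0\<^sup>2" by (intro tendsto_power)
    have b: "(\<lambda>n. s - inverse (real (Suc (r n)))) \<longlonglongrightarrow> s - 0"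
      using LIMSEQ_subseq_LIMSEQ[OF LIMSEQ_inverse_real_of_nat r] by (intro tendsto_intros) (simp add: comp_def)
    have "s - inverse (real (Suc (r n))) \<le> (C.nrm (hn n))\<^sup>2" for n
      unfolding hn_def by (rule less_imp_le[OF f(3)])
    then have "s - 0 \<le> 0\<^sup>2" by (intro LIMSEQ_le[OF b a]) blast
    then show False using s by simp
  qed
  define d where "d n = (\<lambda>x. K (hn n) x - of_real s * f (r n) x)" for n
  have dC: "d n \<in> CF" for n
    unfolding d_def using K_CF[OF hnC] csub_scale[OF C.csub_S fC] by (intro C.S_diff)
  \<comment> \<open>Expanding the square gives \<open>P - 2 * s * a + s\<^sup>2\<close>, where
    \<open>P\<close> and \<open>a\<close> are the squared norms of \<open>K (hn n)\<close> and
    \<open>hn n\<close>. As \<open>P \<le> s * a\<close> by \<open>key\<close>, it is at most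
    \<open>s * (s - a)\<close>, and \<open>s - a\<close> is small by the choice of
    \<open>f\<close>.\<close>
  have "(C.nrm (d n))\<^sup>2 \<le> s * inverse (real (Suc (r n)))" for n
  proof -
    let ?f = "f (r n)" and ?p = "K (hn n)" and ?q = "\<lambda>x. of_real s * f (r n) x"
    define a where "a = (C.nrm (hn n))\<^sup>2"
    have pC: "?p \<in> CF" and qC: "?q \<in> CF" using K_CF[OF hnC] csub_scale[OF C.csub_S fC] by auto
    have "cip ?p ?f = cip (hn n) (hn n)"
      using K_symmetric[OF hnC[of n] fC[of "r n"]] by (simp add: hn_def)
    also have "\<dots> = of_real a" unfolding a_def by (rule C.ip_self[OF hnC])
    finally have pf: "cip ?p ?f = of_real a" .
    then have fp: "cip ?f ?p = of_real a" using C.ip_cnj[OF fC pC, of "r n"] by simp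
    define P where "P = (C.nrm ?p)\<^sup>2"
    have pp: "cip ?p ?p = of_real P" unfolding P_def by (rule C.ip_self[OF pC])
    have ff: "cip ?f ?f = 1" using C.ip_self[OF fC, of "r n"] f(2)[of "r n"] by simp
    have "complex_of_real ((C.nrm (d n))\<^sup>2) = cip (d n) (d n)" by (rule C.ip_self[OF dC, symmetric])
    also have "\<dots> = cip ?p ?p - of_real s * cip ?p ?f - (of_real s * cip ?f ?p - of_real s * of_real s * cip ?f ?f)"
      unfolding d_def using pC qC fC C.S_diff[OF pC qC]
      by (simp add: C.ip_diff C.ip_diff_right C.ip_scale C.ip_scale_right algebra_simps)
    also have "\<dots> = of_real (P - 2 * s * a + s\<^sup>2)"
      unfolding pp pf fp ff by (simp add: power2_eq_square)
    finally have "(C.nrm (d n))\<^sup>2 = P - 2 * s * a + s\<^sup>2"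
      by (simp only: of_real_eq_iff)
    also have "\<dots> \<le> s * a - 2 * s * a + s\<^sup>2" using key[OF hnW[of n]] unfolding a_def P_def by linarith
    also have "\<dots> = s * (s - a)" by (simp add: power2_eq_square algebra_simps)
    also have "\<dots> \<le> s * inverse (real (Suc (r n)))"
      using f(3)[of "r n"] s unfolding a_def hn_def by (intro mult_left_mono) auto
    finally show ?thesis .
  qed
  then have "C.nrm (d n) \<le> sqrt (s * inverse (real (Suc (r n))))" for n
    by (rule real_le_rsqrt)
  moreover have "(\<lambda>n. sqrt (s * inverse (real (Suc (r n))))) \<longlonglongrightarrow> sqrt (s * 0)"
    using LIMSEQ_subseq_LIMSEQ[OF LIMSEQ_inverse_real_of_nat r] by (intro tendsto_intros) (simp add: comp_def)
  ultimately have dlim: "(\<lambda>n. C.nrm (d n)) \<longlonglongrightarrow> 0"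
    by (intro tendsto_sandwich[of "\<lambda>_. 0" "\<lambda>n. C.nrm (d n)" sequentially
          "\<lambda>n. sqrt (s * inverse (real (Suc (r n))))"]) (use C.ip_nonneg[OF dC] in auto)
  \<comment> \<open>The vectors \<open>f (r n)\<close> need not converge, only their images do.
    Applying \<open>K\<close> to \<open>d n\<close> replaces \<open>f (r n)\<close> by
    \<open>hn n\<close>, and every term then has a limit.\<close>
  have "K (K h) x = of_real s * h x" if x: "x \<in> carrier G" for x
  proof -
    have Kd: "K (d n) x = K (K (hn n)) x - of_real s * hn n x" for n
    proof -
      have "K (d n) = (\<lambda>x. K (K (hn n)) x - K (\<lambda>x. of_real s * f (r n) x) x)"
        unfolding d_def using K_CF[OF hnC] csub_scale[OF C.csub_S fC] by (intro K_linear)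
      then show ?thesis using K_linear(3)[OF fC fC, of "of_real s" "r n"] by (simp add: hn_def)
    qed
    have KKdiff: "K (K (\<lambda>x. hn n x - h x)) x = K (K (hn n)) x - K (K h) x" for n
      using K_linear(2)[OF hnC h] K_linear(2)[OF K_CF[OF hnC] K_CF[OF h]] by simp
    have "(\<lambda>n. K (K (\<lambda>x. hn n x - h x)) x) \<longlonglongrightarrow> 0"
      by (rule K_nrm_tendsto(2)[OF _ K_nrm_tendsto(1)[OF diffC hlim] x]) (intro K_CF diffC)
    then have "(\<lambda>n. K (K (hn n)) x) \<longlonglongrightarrow> K (K h) x"
      unfolding KKdiff by (simp add: LIM_zero_iff)
    moreover have "(\<lambda>n. hn n x) \<longlonglongrightarrow> h x"
      using tendsto_uniform_limitI[OF lim x] by (simp add: hn_def)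
    ultimately have "(\<lambda>n. K (d n) x) \<longlonglongrightarrow> K (K h) x - of_real s * h x"
      unfolding Kd by (intro tendsto_intros)
    moreover have "(\<lambda>n. K (d n) x) \<longlonglongrightarrow> 0" by (rule K_nrm_tendsto(2)[OF dC dlim x])
    ultimately show ?thesis using LIMSEQ_unique by fastforce
  qed
  then have "K (K h) = (\<lambda>x. of_real s * h x)"
    by (intro CF_eqI K_CF h csub_scale[OF C.csub_S])
  then show ?thesis using s hW h_nz unfolding W_def by blast
qed

text \<open>Hilbert--Schmidt bound: Bessel's inequality for the kernel sections gives \<open>m * s \<le> B\<^sup>2\<close> for
  \<open>m\<close> orthonormal eigenvectors.\<close>

lemma K_eigenspace_onb:
  assumes s: "s > 0" and E: "csub E" "E \<subseteq> CF"
    and eig: "\<And>f. f \<in> E \<Longrightarrow> K (K f) = (\<lambda>x. complex_of_real s * f x)"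
  shows "\<exists>n e. C.onb n e E"
proof -
  obtain B where B: "\<And>x. x \<in> carrier G \<Longrightarrow> C.nrm (kv x) \<le> B" using K_bound by blast
  have "m \<le> nat \<lfloor>B\<^sup>2 / s\<rfloor>" if b: "C.ons m b" "\<forall>j<m. b j \<in> E" for m b
  proof -
    have bC: "b j \<in> CF" if "j < m" for j using b that E by auto
    have cont: "continuous_map T euclidean (\<lambda>x. K (b j) x * cnj (K (b j) x))" if "j < m" for j
      using bC[OF that] by (intro cip_cont CF_cont K_CF)
    have "cip (K (b j)) (K (b j)) = of_real s" if j: "j < m" for j
    proof -
      have "cip (K (b j)) (K (b j)) = cip (K (K (b j))) (b j)"
        using K_symmetric[OF K_CF[OF bC[OF j]] bC[OF j]] by simp
      also have "\<dots> = of_real s * cip (b j) (b j)"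
        using eig b j bC by (simp add: C.ip_scale)
      finally show ?thesis using b j by (simp add: C.ons_def)
    qed
    then have "complex_of_real (real m * s) = (\<Sum>j<m. cip (K (b j)) (K (b j)))" by simp
    also have "\<dots> = mean G (\<lambda>x. \<Sum>j<m. K (b j) x * cnj (K (b j) x))"
      unfolding cip_def using cont by (intro mean_sum[symmetric]) auto
    finally have "real m * s = cmod (mean G (\<lambda>x. \<Sum>j<m. K (b j) x * cnj (K (b j) x)))"
      using s by (metis abs_of_nonneg mult_nonneg_nonneg norm_of_real of_nat_0_le_iff less_imp_le)
    also have "\<dots> \<le> B\<^sup>2"
    proof (rule mean_bound)
      show "continuous_map T euclidean (\<lambda>x. \<Sum>j<m. K (b j) x * cnj (K (b j) x))"
        using cont by (intro continuous_map_sum) auto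
      fix x assume x: "x \<in> carrier G"
      have "(\<Sum>j<m. K (b j) x * cnj (K (b j) x)) = of_real (\<Sum>j<m. (cmod (K (b j) x))\<^sup>2)"
        unfolding of_real_sum by (intro sum.cong) (auto simp: complex_norm_square simp del: of_real_power)
      then have "cmod (\<Sum>j<m. K (b j) x * cnj (K (b j) x)) = (\<Sum>j<m. (cmod (K (b j) x))\<^sup>2)"
        by (simp only: norm_of_real) (simp add: sum_nonneg)
      also have "\<dots> = (\<Sum>j<m. (cmod (cip (kv x) (b j)))\<^sup>2)"
        using C.ip_cnj[OF kv_CF[OF x] bC] x by (intro sum.cong) (auto simp: K_eq_cip)
      also have "\<dots> \<le> Re (cip (kv x) (kv x))"
        by (rule C.bessel[OF b(1) kv_CF[OF x]])
      also have "\<dots> = (C.nrm (kv x))\<^sup>2" using C.ip_nonneg[OF kv_CF[OF x]] by simp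
      also have "\<dots> \<le> B\<^sup>2" using B[OF x] C.ip_nonneg[OF kv_CF[OF x]] by (intro power_mono) auto
      finally show "cmod (\<Sum>j<m. K (b j) x * cnj (K (b j) x)) \<le> B\<^sup>2" .
    qed
    finally have "real m \<le> B\<^sup>2 / s" using s by (simp add: le_divide_eq)
    then show ?thesis by (simp add: le_nat_floor)
  qed
  then show ?thesis using C.onb_exists[OF E] by blast
qed

end


section \<open>Finite-dimensional unitary representations\<close>

text \<open>Unitarity is expressed by the last clause, which makes the matrix of the inverse the
  adjoint. The index set is arbitrary so that tensor products can be indexed by pairs.\<close>

definition mrep :: "('a, 'm) monoid_scheme \<Rightarrow> 'a topology \<Rightarrow> 'i set \<Rightarrow> ('a \<Rightarrow> 'i \<Rightarrow> 'i \<Rightarrow> complex) \<Rightarrow> bool"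
  where
  "mrep G T I u \<longleftrightarrow> finite I \<and>
    (\<forall>i\<in>I. \<forall>j\<in>I. continuous_map T euclidean (\<lambda>g. u g i j)) \<and>
    (\<forall>g\<in>carrier G. \<forall>h\<in>carrier G. \<forall>i\<in>I. \<forall>j\<in>I. u (g \<otimes>\<^bsub>G\<^esub> h) i j = (\<Sum>k\<in>I. u g i k * u h k j)) \<and>
    (\<forall>i\<in>I. \<forall>j\<in>I. u \<one>\<^bsub>G\<^esub> i j = (if i = j then 1 else 0)) \<and>
    (\<forall>g\<in>carrier G. \<forall>i\<in>I. \<forall>j\<in>I. u (inv\<^bsub>G\<^esub> g) i j = cnj (u g j i))"

lemma mrepD:
  assumes "mrep G T I u"
  shows "finite I" "\<lbrakk>i \<in> I; j \<in> I\<rbrakk> \<Longrightarrow> continuous_map T euclidean (\<lambda>g. u g i j)"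
    "\<lbrakk>g \<in> carrier G; h \<in> carrier G; i \<in> I; j \<in> I\<rbrakk> \<Longrightarrow> u (g \<otimes>\<^bsub>G\<^esub> h) i j = (\<Sum>k\<in>I. u g i k * u h k j)"
    "\<lbrakk>i \<in> I; j \<in> I\<rbrakk> \<Longrightarrow> u \<one>\<^bsub>G\<^esub> i j = (if i = j then 1 else 0)"
    "\<lbrakk>g \<in> carrier G; i \<in> I; j \<in> I\<rbrakk> \<Longrightarrow> u (inv\<^bsub>G\<^esub> g) i j = cnj (u g j i)"
  using assms by (auto simp: mrep_def)

text \<open>The relation that Schur orthogonality gives for inequivalent irreducible
  representations; here it defines the family to be built.\<close>

definition coeff_orth :: "('a, 'm) monoid_scheme \<Rightarrow> nat \<times> ('a \<Rightarrow> nat \<Rightarrow> nat \<Rightarrow> complex) \<Rightarrow>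
    nat \<times> ('a \<Rightarrow> nat \<Rightarrow> nat \<Rightarrow> complex) \<Rightarrow> bool" where
  "coeff_orth G = (\<lambda>(n, u) (m, v). \<forall>i<n. \<forall>j<n. \<forall>k<m. \<forall>l<m. mean G (\<lambda>g. u g i j * cnj (v g k l)) = 0)"

context compact_group
begin

text \<open>The matrix of the right regular representation on \<open>E\<close> in the basis
  \<open>e\<close>. Multiplicativity is the expansion of \<open>rt h (e j)\<close> in the basis, and
  unitarity is \<open>cip_rt_left\<close>.\<close>

lemma finite_invariant_mrep:
  assumes E: "E \<subseteq> CF" and e: "C.onb n e E"
    and inv: "\<And>f g. \<lbrakk>f \<in> E; g \<in> carrier G\<rbrakk> \<Longrightarrow> rt g f \<in> E"
  shows "mrep G T {..<n} (\<lambda>g i j. cip (rt g (e j)) (e i))"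
proof -
  have eE: "e i \<in> E" if "i < n" for i using that e by (simp add: C.onb_def)
  then have eC: "e i \<in> CF" if "i < n" for i using that E by blast
  have eo: "C.ons n e" using e by (simp add: C.onb_def)
  have cont: "continuous_map T euclidean (\<lambda>g. cip (rt g (e j)) (e i))" if "i < n" "j < n" for i j
  proof -
    have "continuous_map (prod_topology T T) euclidean (\<lambda>(g, x). e j (x \<otimes> g) * cnj (e i x))"
      unfolding case_prod_unfold
      by (intro continuous_map_complex_mult continuous_map_cnj continuous_map_comp2[OF CF_cont[OF eC]]
          that continuous_map_gmult) (auto simp: continuous_map_fst continuous_map_snd)
    from continuous_mean[OF this] show ?thesis
      by (rule continuous_map_eq) (auto simp: cip_def rt_apply intro: mean_cong)
  qed
  have hom: "cip (rt (g \<otimes> h) (e j)) (e i) = (\<Sum>k<n. cip (rt g (e k)) (e i) * cip (rt h (e j)) (e k))"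
    if g: "g \<in> carrier G" and h: "h \<in> carrier G" and ij: "i < n" "j < n" for g h i j
  proof -
    have "rt h (e j) = C.proj n e (rt h (e j))"
      using e inv[OF eE[OF ij(2)] h] by (simp add: C.onb_def)
    then have "rt h (e j) x = (\<Sum>k<n. cip (rt h (e j)) (e k) * e k x)" for x
      by (simp add: C.proj_def fun_eq_iff)
    then have "rt g (rt h (e j)) = (\<lambda>x. \<Sum>k<n. cip (rt h (e j)) (e k) * rt g (e k) x)"
      unfolding rt_def[of g] by (auto simp: ext0_def fun_eq_iff)
    then have "cip (rt (g \<otimes> h) (e j)) (e i) = cip (\<lambda>x. \<Sum>k<n. cip (rt h (e j)) (e k) * rt g (e k) x) (e i)"
      by (simp add: rt_rt g h)
    also have "\<dots> = (\<Sum>k<n. cip (rt h (e j)) (e k) * cip (rt g (e k)) (e i))"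
      using eC g ij by (intro C.ip_sum) (auto intro: rt_CF)
    finally show ?thesis by (simp add: mult.commute)
  qed
  have one: "cip (rt \<one> (e j)) (e i) = (if i = j then 1 else 0)" if ij: "i < n" "j < n" for i j
  proof -
    have "rt \<one> (e j) = e j" using eC ij by (intro CF_eqI rt_CF) (auto simp: rt_apply)
    then show ?thesis using eo ij by (simp add: C.ons_def)
  qed
  have "cip (rt (inv g) (e j)) (e i) = cnj (cip (rt g (e i)) (e j))"
    if g: "g \<in> carrier G" and ij: "i < n" "j < n" for g i j
    using cip_rt_left[OF eC[OF ij(2)] eC[OF ij(1)], of "inv g"] C.ip_cnj[OF eC[OF ij(2)] rt_CF[OF eC[OF ij(1)] g]] g
    by simp
  then show ?thesis using cont hom one unfolding mrep_def by auto
qed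

lemma separating_function:
  assumes "openin T U" "x \<in> U"
  shows "\<exists>f. continuous_map T euclidean f \<and> f x = 1 \<and> (\<forall>y\<in>carrier G - U. f y = 0) \<and>
    (\<forall>y\<in>carrier G. f y \<in> \<real> \<and> 0 \<le> Re (f y))"
proof -
  have "normal_space T" using compact Hausdorff compact_Hausdorff_or_regular_imp_normal_space by blast
  then have "completely_regular_space T"
    using Hausdorff Hausdorff_imp_t1_space normal_imp_completely_regular_space_A by blast
  moreover have "closedin T (topspace T - U)" "x \<in> topspace T - (topspace T - U)"
    using assms openin_subset by (auto simp: closedin_diff)
  ultimately obtain f where f: "continuous_map T (top_of_set {0..1::real}) f" "f x = 0" "f ` (topspace T - U) \<subseteq> {1}"
    unfolding completely_regular_space_def by meson
  have fr: "continuous_map T euclideanreal f" using f(1) continuous_map_in_subtopology by blast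
  have f01: "f y \<in> {0..1}" if "y \<in> carrier G" for y
    using f(1) that continuous_map_in_subtopology topspace_eq by (metis PiE image_subset_iff_funcset)
  have "continuous_map T euclidean (\<lambda>y. complex_of_real (1 - f y))"
    using fr by (auto simp: continuous_map_atin intro!: tendsto_diff tendsto_of_real)
  then show ?thesis using f f01 topspace_eq by (intro exI[of _ "\<lambda>y. complex_of_real (1 - f y)"]) auto
qed

text \<open>The functions orthogonal to all coefficients of \<open>\<F>\<close> are stable under translations and under
  convolution, and contain \<open>f(\<cdot> x) - f\<close> for every \<open>f\<close>; an eigenspace of a convolution operator
  among them carries the new representation.\<close>

lemma coeff_orth_mrep_exists:
  assumes \<F>: "\<And>m v. (m, v) \<in> \<F> \<Longrightarrow> mrep G T {..<m} v"
    and x: "x \<in> carrier G" "x \<noteq> \<one>"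
    and triv: "\<And>m v i j. \<lbrakk>(m, v) \<in> \<F>; i < m; j < m\<rbrakk> \<Longrightarrow> v x i j = v \<one> i j"
  shows "\<exists>n u. n \<ge> 1 \<and> mrep G T {..<n} u \<and> (\<forall>p\<in>\<F>. coeff_orth G (n, u) p)"
proof -
  define A where "A = {ext0 (\<lambda>g. v g i j) | m v i j. (m, v) \<in> \<F> \<and> i < m \<and> j < m}"
  have cC: "ext0 (\<lambda>g. v g i j) \<in> CF" if "(m, v) \<in> \<F>" "i < m" "j < m" for m v i j
    using mrepD(2)[OF \<F>[OF that(1)]] that by (intro ext0_CF) auto
  have A: "A \<subseteq> CF" using cC by (auto simp: A_def)
  have W0: "cip f (ext0 (\<lambda>g. v g i j)) = 0" if "f \<in> perp A" "(m, v) \<in> \<F>" "i < m" "j < m" for f m v i j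
    using that unfolding perp_def A_def by blast
  have WI: "f \<in> perp A" if "f \<in> CF" "\<And>m v i j. \<lbrakk>(m, v) \<in> \<F>; i < m; j < m\<rbrakk> \<Longrightarrow> cip f (ext0 (\<lambda>g. v g i j)) = 0" for f
    using that unfolding perp_def A_def by blast
  have WC: "f \<in> CF" if "f \<in> perp A" for f using that by (simp add: perp_def)
  have W_comb: "cip f (\<lambda>x. \<Sum>l<m. c l * ext0 (\<lambda>g. v g (p l) (q l)) x) = 0"
    if "f \<in> perp A" "(m, v) \<in> \<F>" "\<And>l. l < m \<Longrightarrow> p l < m \<and> q l < m" for f m v p q c
  proof -
    have "cip f (\<lambda>x. \<Sum>l<m. c l * ext0 (\<lambda>g. v g (p l) (q l)) x) =
        (\<Sum>l<m. cnj (c l) * cip f (ext0 (\<lambda>g. v g (p l) (q l))))"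
      using that cC WC by (intro C.ip_sum_right) auto
    also have "\<dots> = 0" using that W0 by simp
    finally show ?thesis .
  qed
  have rt_c: "rt g (ext0 (\<lambda>h. v h i j)) = (\<lambda>x. \<Sum>l<m. v g l j * ext0 (\<lambda>h. v h i l) x)"
    if "(m, v) \<in> \<F>" "i < m" "j < m" "g \<in> carrier G" for m v i j g
    using that mrepD(3)[OF \<F>[OF that(1)], of _ g i j]
    by (auto simp: rt_def ext0_def fun_eq_iff mult.commute)
  have W_rt: "rt g f \<in> perp A" if f: "f \<in> perp A" and g: "g \<in> carrier G" for f g
  proof (rule WI)
    show "rt g f \<in> CF" using rt_CF WC f g by blast
    fix m v i j assume v: "(m, v) \<in> \<F>" "i < m" "j < m"
    have "cip (rt g f) (ext0 (\<lambda>g. v g i j)) = cip f (rt (inv g) (ext0 (\<lambda>g. v g i j)))"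
      by (rule cip_rt_left[OF WC[OF f] cC[OF v] g])
    also have "\<dots> = 0"
      using W_comb[OF f v(1), of "\<lambda>_. i" "\<lambda>l. l"] rt_c[OF v, of "inv g"] g v by simp
    finally show "cip (rt g f) (ext0 (\<lambda>g. v g i j)) = 0" .
  qed
  obtain f0 :: "'a \<Rightarrow> complex" where f0: "continuous_map T euclidean f0" "f0 x = 1" "f0 \<one> = 0"
  proof -
    have "openin T (topspace T - {\<one>})"
      using closedin_Hausdorff_singleton[OF Hausdorff, of \<one>] one_closed
      unfolding topspace_eq[symmetric] by (intro openin_diff) auto
    moreover have "x \<in> topspace T - {\<one>}" using x topspace_eq by auto
    ultimately have "\<exists>f::'a \<Rightarrow> complex. continuous_map T euclidean f \<and> f x = 1 \<and>
        (\<forall>y\<in>carrier G - (topspace T - {\<one>}). f y = 0) \<and> (\<forall>y\<in>carrier G. f y \<in> \<real> \<and> 0 \<le> Re (f y))"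
      by (rule separating_function)
    then show thesis using that one_closed by blast
  qed
  define f where "f = ext0 f0"
  have f: "f \<in> CF" using f0 ext0_CF by (simp add: f_def)
  \<comment> \<open>Since \<open>x\<close> acts like \<open>\<one>\<close> in every member of
    \<open>\<F>\<close>, translating by \<open>x\<close> does not change inner products with
    coefficients, so \<open>h\<close> is orthogonal to them; \<open>h \<one> = 1\<close> keeps it
    from being 0.\<close>
  define h where "h = (\<lambda>y. rt x f y - f y)"
  have hC: "h \<in> CF" unfolding h_def using rt_CF f x C.S_diff by blast
  have h1: "h \<one> = 1" using f0 x by (simp add: h_def rt_apply f_def)
  have h: "h \<in> perp A"
  proof (rule WI[OF hC])
    fix m v i j assume v: "(m, v) \<in> \<F>" "i < m" "j < m"
    let ?v = "ext0 (\<lambda>g. v g i j)"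
    have "rt (inv x) ?v = ?v"
    proof (rule CF_eqI)
      fix y assume y: "y \<in> carrier G"
      have "v (inv x) l j = v \<one> l j" if "l < m" for l
        using mrepD(5)[OF \<F>[OF v(1)] x(1), of l j] mrepD(4)[OF \<F>[OF v(1)]] triv[OF v(1,3) that] v that by simp
      then have "(\<Sum>l<m. v y i l * v (inv x) l j) = (\<Sum>l<m. v y i l * v \<one> l j)"
        by (intro sum.cong) auto
      then have "v (y \<otimes> inv x) i j = v (y \<otimes> \<one>) i j"
        using mrepD(3)[OF \<F>[OF v(1)] y] v x by simp
      then show "rt (inv x) ?v y = ?v y" using x y by (simp add: rt_apply)
    qed (use rt_CF cC[OF v] x in auto)
    then show "cip h ?v = 0"
      unfolding h_def using cip_rt_left[OF f cC[OF v] x(1)] rt_CF[OF f x(1)] f cC[OF v]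
      by (simp add: C.ip_diff)
  qed
  define U where "U = {y \<in> topspace T. h y \<in> ball 1 (1/2)}"
  have U: "openin T U" "\<one> \<in> U"
    using openin_continuous_map_preimage[OF CF_cont[OF hC], of "ball 1 (1/2)"] h1 topspace_eq
    by (auto simp: U_def)
  obtain k0 where k0: "continuous_map T euclidean k0" "k0 \<one> = 1"
      "\<And>y. \<lbrakk>y \<in> carrier G; y \<notin> U\<rbrakk> \<Longrightarrow> k0 y = 0" "\<And>y. y \<in> carrier G \<Longrightarrow> k0 y \<in> \<real> \<and> 0 \<le> Re (k0 y)"
    using separating_function[OF U] by blast
  \<comment> \<open>The product with the reflected function gives \<open>k (inv z) = k z\<close> and
    leaves \<open>k\<close> nonnegative, supported in \<open>U\<close> and equal to 1 at
    \<open>\<one>\<close>.\<close>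
  define k where "k z = k0 z * k0 (inv z)" for z
  have k_cont: "continuous_map T euclidean k"
    unfolding k_def[abs_def]
    by (intro continuous_map_complex_mult continuous_map_comp2[OF k0(1)] k0(1) continuous_inv)
  have k_real: "k z \<in> \<real>" "0 \<le> Re (k z)" "z \<notin> U \<Longrightarrow> k z = 0" "k (inv z) = k z" if "z \<in> carrier G" for z
    using k0(3)[OF that] k0(4)[OF that] k0(4)[of "inv z"] that
    by (auto simp: k_def complex_is_Real_iff)
  interpret K: symmetric_kernel G T k
    using k_cont k_real by unfold_locales (auto simp: Reals_cnj_iff)
  have W_K: "K.K f \<in> perp A" if f: "f \<in> perp A" for f
  proof (rule WI)
    show "K.K f \<in> CF" using K.K_CF WC f by blast
    fix m v i j assume v: "(m, v) \<in> \<F>" "i < m" "j < m"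
    let ?v = "ext0 (\<lambda>g. v g i j)"
    \<comment> \<open>Translating by \<open>y\<close> under the mean shows that the operator maps
      the coefficient \<open>(i, j)\<close> to a combination of the coefficients
      \<open>(l, j)\<close> with weights \<open>c l\<close>.\<close>
    define c where "c l = mean G (\<lambda>y. k (inv y) * v y i l)" for l
    have cont: "continuous_map T euclidean (\<lambda>y. v y l l')" if "l < m" "l' < m" for l l'
      using mrepD(2)[OF \<F>[OF v(1)]] that by auto
    have cont': "continuous_map T euclidean (\<lambda>y. k (inv y) * v y i l)" if "l < m" for l
      by (intro continuous_map_complex_mult continuous_map_comp2[OF k_cont] continuous_inv cont v that)
    have "K.K ?v y = (\<Sum>l<m. c l * v y l j)" if y: "y \<in> carrier G" for y
    proof -
      have ct: "continuous_map T euclidean (\<lambda>z. k (y \<otimes> inv z) * v z i j)"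
        by (intro continuous_map_complex_mult continuous_map_comp2[OF k_cont] continuous_map_gmult
            continuous_inv cont v) (use y topspace_eq in auto)
      have "K.K ?v y = mean G (\<lambda>z. k (y \<otimes> inv z) * v z i j)"
        using y unfolding K.K_def by (simp cong: mean_cong)
      also have "\<dots> = mean G (\<lambda>z. k (y \<otimes> inv (z \<otimes> y)) * v (z \<otimes> y) i j)"
        using mean_rtranslate[OF ct y] by simp
      also have "\<dots> = mean G (\<lambda>z. \<Sum>l<m. v y l j * (k (inv z) * v z i l))"
      proof (rule mean_cong)
        fix z assume z: "z \<in> carrier G"
        have "y \<otimes> inv (z \<otimes> y) = inv z" using y z by (simp add: inv_mult_group m_assoc[symmetric])
        then show "k (y \<otimes> inv (z \<otimes> y)) * v (z \<otimes> y) i j = (\<Sum>l<m. v y l j * (k (inv z) * v z i l))"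
          using mrepD(3)[OF \<F>[OF v(1)] z y, of i j] v by (simp add: sum_distrib_left mult_ac)
      qed
      also have "\<dots> = (\<Sum>l<m. mean G (\<lambda>z. v y l j * (k (inv z) * v z i l)))"
        by (intro mean_sum continuous_map_complex_mult cont') auto
      also have "\<dots> = (\<Sum>l<m. c l * v y l j)"
        using cont' by (intro sum.cong) (auto simp: mean_scale c_def)
      finally show ?thesis .
    qed
    note Kv = this
    have "K.K ?v = (\<lambda>y. \<Sum>l<m. c l * ext0 (\<lambda>g. v g l j) y)"
    proof (rule ext)
      show "K.K ?v y = (\<Sum>l<m. c l * ext0 (\<lambda>g. v g l j) y)" for y
        by (cases "y \<in> carrier G") (simp_all add: Kv CF_zero[OF K.K_CF[OF cC[OF v]]])
    qed
    then show "cip (K.K f) ?v = 0"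
      using K.K_symmetric[OF WC[OF f] cC[OF v]] W_comb[OF f v(1), of "\<lambda>l. l" "\<lambda>_. j"] v by simp
  qed
  \<comment> \<open>The value at \<open>\<one>\<close> is the mean of
    \<open>k (inv y) * h y\<close>, whose real part is nonnegative, because \<open>h\<close> has
    nonnegative real part on \<open>U\<close>, and positive at \<open>\<one>\<close>.\<close>
  have "K.K h \<noteq> (\<lambda>_. 0)"
  proof
    assume *: "K.K h = (\<lambda>_. 0)"
    have ct: "continuous_map T euclidean (\<lambda>y. k (inv y) * h y)"
      by (intro continuous_map_complex_mult continuous_map_comp2[OF k_cont] continuous_inv CF_cont hC)
    have "0 < Re (mean G (\<lambda>y. k (inv y) * h y))"
    proof (rule mean_strict_pos[OF ct _ one_closed])
      show "0 < Re (k (inv \<one>) * h \<one>)" using h1 k0(2) by (simp add: k_def)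
      fix y assume y: "y \<in> carrier G"
      show "0 \<le> Re (k (inv y) * h y)"
      proof (cases "y \<in> U")
        case True
        then have "cmod (1 - h y) < 1 / 2" by (simp add: U_def dist_norm)
        then have "0 \<le> Re (h y)" using abs_Re_le_cmod[of "1 - h y"] by simp
        then show ?thesis using k_real[OF y] by (simp add: complex_is_Real_iff)
      qed (use k_real[OF y] in simp)
    qed
    also have "mean G (\<lambda>y. k (inv y) * h y) = K.K h \<one>"
      by (simp add: K.K_def cong: mean_cong)
    finally show False by (simp add: *)
  qed
  then obtain s h' where s: "s > 0" and h': "h' \<in> perp A" "h' \<noteq> (\<lambda>_. 0)" "K.K (K.K h') = (\<lambda>x. complex_of_real s * h' x)"
    using K.K_eigenvector[OF A W_K h] by blast
  \<comment> \<open>This eigenspace is finite-dimensional by \<open>K_eigenspace_onb\<close> and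
    stable under right translations, with which the operator commutes.\<close>
  define E where "E = {f \<in> perp A. K.K (K.K f) = (\<lambda>x. complex_of_real s * f x)}"
  have EC: "E \<subseteq> CF" using WC by (auto simp: E_def)
  have csub_E: "csub E"
    unfolding csub_def
  proof (intro conjI ballI allI)
    note W = csub_perp[OF A]
    have z: "K.K (\<lambda>_. 0) = (\<lambda>_. 0)"
      using K.K_linear(3)[OF f f, of 0] by simp
    show "(\<lambda>_. 0) \<in> E" using csub_zero[OF W] csub_zero[OF C.csub_S] z by (simp add: E_def)
    fix f g c assume f: "f \<in> E"
    then have fC: "f \<in> CF" "K.K f \<in> CF" using EC K.K_CF by auto
    show "(\<lambda>x. c * f x) \<in> E"
      using f csub_scale[OF W] by (simp add: E_def K.K_linear(3)[OF fC(1) fC(1)] K.K_linear(3)[OF fC(2) fC(2)] mult_ac)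
    assume g: "g \<in> E"
    then have gC: "g \<in> CF" "K.K g \<in> CF" using EC K.K_CF by auto
    show "(\<lambda>x. f x + g x) \<in> E"
      using f g csub_add[OF W] by (simp add: E_def K.K_linear(1)[OF fC(1) gC(1)] K.K_linear(1)[OF fC(2) gC(2)] distrib_left)
  qed
  have E_rt: "rt g f \<in> E" if "f \<in> E" "g \<in> carrier G" for f g
    using that W_rt K.K_rt[of f g] K.K_rt[of "K.K f" g] EC K.K_CF[of f] by (auto simp: E_def rt_linear)
  obtain n e where e: "C.onb n e E"
    using K.K_eigenspace_onb[OF s csub_E EC] by (auto simp: E_def)
  have "n \<noteq> 0"
  proof
    assume "n = 0"
    moreover have "h' = C.proj n e h'" using e h' by (simp add: C.onb_def E_def)
    ultimately show False using h'(2) by (simp add: C.proj_def)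
  qed
  define u where "u g i j = cip (rt g (e j)) (e i)" for g i j
  have u: "mrep G T {..<n} u"
    unfolding u_def[abs_def] by (rule finite_invariant_mrep[OF EC e E_rt])
  have eE: "e i \<in> E" if "i < n" for i using that e by (simp add: C.onb_def)
  have "coeff_orth G (n, u) (m, v)" if v: "(m, v) \<in> \<F>" for m v
    unfolding coeff_orth_def prod.case
  proof (intro allI impI)
    fix i j p q assume ij: "i < n" "j < n" and pq: "p < m" "q < m"
    have ei: "e i \<in> CF" "e j \<in> CF" "e j \<in> perp A" using ij eE EC by (auto simp: E_def)
    have cv: "continuous_map T euclidean (\<lambda>g. v g p q)" using mrepD(2)[OF \<F>[OF v]] pq by auto
    have F: "continuous_map (prod_topology T T) euclidean (\<lambda>(g, y). (e j (y \<otimes> g) * cnj (e i y)) * cnj (v g p q))"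
      unfolding case_prod_unfold
      by (intro continuous_map_complex_mult continuous_map_cnj continuous_map_comp2[OF CF_cont[OF ei(1)]]
          continuous_map_comp2[OF CF_cont[OF ei(2)]] continuous_map_comp2[OF cv] continuous_map_gmult)
        (auto simp: continuous_map_fst continuous_map_snd)
    \<comment> \<open>\<open>u g i j\<close> is a mean over \<open>y\<close> involving translates of
      \<open>e j\<close>. After exchanging the means, replacing \<open>g\<close> by
      \<open>inv y \<otimes> g\<close> turns \<open>v g p q\<close> into a combination of
      coefficients, to which \<open>e j\<close> is orthogonal.\<close>
    have "mean G (\<lambda>g. u g i j * cnj (v g p q)) =
        mean G (\<lambda>g. mean G (\<lambda>y. (e j (y \<otimes> g) * cnj (e i y)) * cnj (v g p q)))"
    proof (rule mean_cong)
      fix g assume g: "g \<in> carrier G"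
      have c1: "continuous_map T euclidean (\<lambda>y. e j (y \<otimes> g) * cnj (e i y))"
        by (intro cip_cont continuous_map_comp2[OF CF_cont[OF ei(2)]] continuous_map_rtrans g CF_cont ei)
      have "u g i j = mean G (\<lambda>y. e j (y \<otimes> g) * cnj (e i y))"
        unfolding u_def cip_def by (rule mean_cong) (simp add: rt_apply)
      then show "u g i j * cnj (v g p q) = mean G (\<lambda>y. (e j (y \<otimes> g) * cnj (e i y)) * cnj (v g p q))"
        using mean_scale[OF c1, of "cnj (v g p q)"] by (simp add: mult.commute)
    qed
    also have "\<dots> = mean G (\<lambda>y. mean G (\<lambda>g. (e j (y \<otimes> g) * cnj (e i y)) * cnj (v g p q)))"
      by (rule mean_Fubini[OF F])
    also have "\<dots> = mean G (\<lambda>y. 0)"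
    proof (rule mean_cong)
      fix y assume y: "y \<in> carrier G"
      have c2: "continuous_map T euclidean (\<lambda>g. e j (y \<otimes> g) * cnj (v g p q))"
        by (intro cip_cont continuous_map_comp2[OF CF_cont[OF ei(2)]] continuous_map_ltrans y cv)
      have c3: "continuous_map T euclidean (\<lambda>g. e j g * cnj (v (inv y \<otimes> g) p q))"
        using y by (intro cip_cont continuous_map_comp2[OF cv] continuous_map_ltrans CF_cont ei) auto
      have "mean G (\<lambda>g. e j (y \<otimes> g) * cnj (v g p q)) = mean G (\<lambda>g. e j (y \<otimes> g) * cnj (v (inv y \<otimes> (y \<otimes> g)) p q))"
        using y by (intro mean_cong) (simp add: m_assoc[symmetric])
      also have "\<dots> = mean G (\<lambda>g. e j g * cnj (v (inv y \<otimes> g) p q))"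
        by (rule mean_ltranslate[OF c3 y])
      also have "\<dots> = cip (e j) (\<lambda>g. \<Sum>l<m. v (inv y) p l * ext0 (\<lambda>g. v g l q) g)"
        unfolding cip_def using mrepD(3)[OF \<F>[OF v], of "inv y" _ p q] y pq
        by (intro mean_cong) simp
      also have "\<dots> = 0"
        by (rule W_comb[OF ei(3) v]) (use pq in auto)
      finally have "mean G (\<lambda>g. e j (y \<otimes> g) * cnj (v g p q)) = 0" .
      then show "mean G (\<lambda>g. (e j (y \<otimes> g) * cnj (e i y)) * cnj (v g p q)) = 0"
        using mean_scale[OF c2, of "cnj (e i y)"] by (simp add: mult_ac)
    qed
    finally show "mean G (\<lambda>g. u g i j * cnj (v g p q)) = 0" by simp
  qed
  then show ?thesis using u \<open>n \<noteq> 0\<close> by (intro exI[of _ n] exI[of _ u]) auto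
qed

end


section \<open>Separable quotients of non-metrizable spaces\<close>

text \<open>For coefficients of representations this is congruence modulo their common
  kernel.\<close>

definition agree :: "('a \<Rightarrow> complex) set \<Rightarrow> 'a \<Rightarrow> 'a \<Rightarrow> bool" where
  "agree \<Phi> x y \<longleftrightarrow> (\<forall>\<phi>\<in>\<Phi>. \<phi> x = \<phi> y)"

lemma agree_refl [simp]: "agree \<Phi> x x"
  and agree_sym: "agree \<Phi> x y \<Longrightarrow> agree \<Phi> y x"
  and agree_trans: "\<lbrakk>agree \<Phi> x y; agree \<Phi> y z\<rbrakk> \<Longrightarrow> agree \<Phi> x z"
  and agree_mono: "\<lbrakk>\<Psi> \<subseteq> \<Phi>; agree \<Phi> x y\<rbrakk> \<Longrightarrow> agree \<Psi> x y"
  by (auto simp: agree_def)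

definition complex_base :: "complex set set" where
  "complex_base = (SOME B. countable B \<and> topological_basis B)"

lemma complex_base: "countable complex_base" "topological_basis complex_base"
proof -
  have "countable complex_base \<and> topological_basis complex_base"
    unfolding complex_base_def by (rule someI_ex[OF ex_countable_basis])
  then show "countable complex_base" "topological_basis complex_base" by auto
qed

text \<open>A subbase of the coarsest topology making all of \<open>\<Phi>\<close> continuous,
  countable when \<open>\<Phi>\<close> is.\<close>

definition preimages :: "('a \<Rightarrow> complex) set \<Rightarrow> 'a set set" where
  "preimages \<Phi> = {\<phi> -` Q | \<phi> Q. \<phi> \<in> \<Phi> \<and> Q \<in> complex_base}"

lemma preimages_UN: "B \<in> preimages (\<Union>(\<Phi> ` A)) \<longleftrightarrow> (\<exists>a\<in>A. B \<in> preimages (\<Phi> a))"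
  by (auto simp: preimages_def)

lemma countable_preimages: "countable \<Phi> \<Longrightarrow> countable (preimages \<Phi>)"
proof -
  assume "countable \<Phi>"
  then have "countable ((\<lambda>(\<phi>, Q). \<phi> -` Q) ` (\<Phi> \<times> complex_base))"
    using complex_base(1) by auto
  moreover have "preimages \<Phi> = (\<lambda>(\<phi>, Q). \<phi> -` Q) ` (\<Phi> \<times> complex_base)"
    by (auto simp: preimages_def)
  ultimately show ?thesis by simp
qed

lemma agree_preimages:
  assumes "agree \<Phi> x y" "\<K> \<subseteq> preimages \<Phi>" "x \<in> \<Inter>\<K>"
  shows "y \<in> \<Inter>\<K>"
proof
  fix B assume B: "B \<in> \<K>"
  then obtain \<phi> Q where "B = \<phi> -` Q" "\<phi> \<in> \<Phi>" using assms(2) by (auto simp: preimages_def)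
  moreover have "x \<in> B" using B assms(3) by blast
  ultimately show "y \<in> B" using assms(1) by (auto simp: agree_def)
qed

lemma openin_preimages:
  assumes "\<And>\<phi>. \<phi> \<in> \<Phi> \<Longrightarrow> continuous_map T euclidean \<phi>" "finite \<K>" "\<K> \<subseteq> preimages \<Phi>"
  shows "openin T (topspace T \<inter> \<Inter>\<K>)"
proof -
  have "openin T (topspace T \<inter> B)" if "B \<in> \<K>" for B
  proof -
    have "B \<in> preimages \<Phi>" using that assms(3) by blast
    then obtain \<phi> Q where B: "B = \<phi> -` Q" "\<phi> \<in> \<Phi>" "Q \<in> complex_base"
      by (auto simp: preimages_def)
    have "openin euclidean Q"
      using topological_basis_open[OF complex_base(2) B(3)] by simp
    from openin_continuous_map_preimage[OF assms(1)[OF B(2)] this] show ?thesis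
      by (simp add: B(1) vimage_def Int_def)
  qed
  then have "openin T (\<Inter>(insert (topspace T) ((\<lambda>B. topspace T \<inter> B) ` \<K>)))"
    using assms(2) by (intro openin_Inter) auto
  moreover have "\<Inter>(insert (topspace T) ((\<lambda>B. topspace T \<inter> B) ` \<K>)) = topspace T \<inter> \<Inter>\<K>" by auto
  ultimately show ?thesis by simp
qed

text \<open>The part of \<open>K\<close> outside \<open>U\<close> is compact, and each of its points
  is separated from \<open>x\<close> by some member of \<open>\<Phi>\<close>; finitely many of these
  separations suffice.\<close>

lemma compact_preimages_nhd:
  assumes \<Phi>: "\<And>\<phi>. \<phi> \<in> \<Phi> \<Longrightarrow> continuous_map T euclidean \<phi>"
    and K: "compactin T K" and U: "openin T U"
    and sat: "\<And>g. \<lbrakk>g \<in> K; agree \<Phi> g x\<rbrakk> \<Longrightarrow> g \<in> U"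
  shows "\<exists>\<K>. finite \<K> \<and> \<K> \<subseteq> preimages \<Phi> \<and> x \<in> \<Inter>\<K> \<and> (\<forall>g\<in>K. g \<in> \<Inter>\<K> \<longrightarrow> g \<in> U)"
proof -
  define L where "L = (topspace T - U) \<inter> K"
  have L: "compactin T L" unfolding L_def using K U by (intro closed_Int_compactin) auto
  have "\<exists>\<phi> Q Q'. \<phi> \<in> \<Phi> \<and> Q \<in> complex_base \<and> open Q' \<and> \<phi> x \<in> Q \<and> \<phi> g \<in> Q' \<and> Q \<inter> Q' = {}" if g: "g \<in> L" for g
  proof -
    have "\<not> agree \<Phi> g x" using sat g by (auto simp: L_def)
    then obtain \<phi> where \<phi>: "\<phi> \<in> \<Phi>" "\<phi> x \<noteq> \<phi> g" by (auto simp: agree_def)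
    obtain V Q' where V: "open V" "open Q'" "\<phi> x \<in> V" "\<phi> g \<in> Q'" "V \<inter> Q' = {}"
      using hausdorff[OF \<phi>(2)] by blast
    obtain Q where "Q \<in> complex_base" "\<phi> x \<in> Q" "Q \<subseteq> V"
      using topological_basisE[OF complex_base(2) V(1,3)] by blast
    then show ?thesis using \<phi> V by blast
  qed
  then obtain \<phi> Q Q' where *: "\<And>g. g \<in> L \<Longrightarrow> \<phi> g \<in> \<Phi> \<and> Q g \<in> complex_base \<and> open (Q' g) \<and>
      \<phi> g x \<in> Q g \<and> \<phi> g g \<in> Q' g \<and> Q g \<inter> Q' g = {}" by metis
  define N where "N g = {y \<in> topspace T. \<phi> g y \<in> Q' g}" for g
  have "openin T (N g)" if "g \<in> L" for g
    unfolding N_def using *[OF that] by (intro openin_continuous_map_preimage[OF \<Phi>]) auto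
  moreover have "L \<subseteq> \<Union>(N ` L)"
    using * compactin_subset_topspace[OF L] by (auto simp: N_def)
  ultimately obtain \<F> where "finite \<F>" "\<F> \<subseteq> N ` L" "L \<subseteq> \<Union>\<F>"
    using compactinD[OF L, of "N ` L"] by blast
  then obtain D where D: "finite D" "D \<subseteq> L" "L \<subseteq> \<Union>(N ` D)" by (metis finite_subset_image)
  show ?thesis
  proof (intro exI[of _ "(\<lambda>g. \<phi> g -` Q g) ` D"] conjI ballI impI)
    show "(\<lambda>g. \<phi> g -` Q g) ` D \<subseteq> preimages \<Phi>" using * D(2) by (auto simp: preimages_def)
    show "x \<in> \<Inter>((\<lambda>g. \<phi> g -` Q g) ` D)" using * D(2) by auto
    fix g assume g: "g \<in> K" "g \<in> \<Inter>((\<lambda>g. \<phi> g -` Q g) ` D)"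
    show "g \<in> U"
    proof (rule ccontr)
      assume "g \<notin> U"
      then have "g \<in> L" using g compactin_subset_topspace[OF K] by (auto simp: L_def)
      then obtain d where "d \<in> D" "g \<in> N d" using D by blast
      then show False using g *[of d] D by (auto simp: N_def)
    qed
  qed (use D in simp)
qed

text \<open>Evaluation embeds \<open>T\<close> into a countable power of the complex plane, since a
  continuous injection of a compact space into a Hausdorff space is an embedding.\<close>

lemma countable_separating_metrizable:
  assumes T: "compact_space T" and \<Phi>: "countable \<Phi>" "\<And>\<phi>. \<phi> \<in> \<Phi> \<Longrightarrow> continuous_map T euclidean (\<phi> :: 'a \<Rightarrow> complex)"
    and sep: "\<And>x y. \<lbrakk>x \<in> topspace T; y \<in> topspace T; agree \<Phi> x y\<rbrakk> \<Longrightarrow> x = y"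
  shows "metrizable_space T"
proof -
  let ?P = "product_topology (\<lambda>_. euclidean :: complex topology) \<Phi>"
  let ?e = "\<lambda>x. \<lambda>\<phi>\<in>\<Phi>. \<phi> x"
  have c: "continuous_map T ?P ?e"
    using \<Phi>(2) by (auto simp: continuous_map_componentwise)
  have "inj_on ?e (topspace T)"
  proof (rule inj_onI)
    fix x y assume xy: "x \<in> topspace T" "y \<in> topspace T" "?e x = ?e y"
    have "agree \<Phi> x y" unfolding agree_def
    proof
      fix \<phi> assume "\<phi> \<in> \<Phi>"
      then show "\<phi> x = \<phi> y" using fun_cong[OF xy(3), of \<phi>] by simp
    qed
    then show "x = y" using sep xy by blast
  qed
  moreover have "Hausdorff_space ?P" by (simp add: Hausdorff_space_product_topology)
  ultimately have "embedding_map T ?P ?e"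
    using T c by (intro injective_closed_imp_embedding_map T1_Spaces.continuous_imp_closed_map)
  then have "T homeomorphic_space subtopology ?P (?e ` topspace T)"
    by (rule embedding_map_imp_homeomorphic_space)
  moreover have "metrizable_space ?P"
    unfolding metrizable_space_product_topology using \<Phi>(1)
    by (auto intro: countable_subset[of _ \<Phi>] metrizable_space_euclidean)
  ultimately show ?thesis
    using homeomorphic_metrizable_space metrizable_space_subtopology by blast
qed

section \<open>Dense sequences along chains of metrizable quotients\<close>

lemma inj_choice_infinite:
  assumes "\<And>k::nat. infinite (X k :: nat set)"
  shows "\<exists>f. inj f \<and> (\<forall>k. f k \<in> X k)"
proof -
  have "\<exists>f. \<forall>k. f k \<in> X k \<and> f k < f (Suc k)"
  proof (rule dependent_nat_choice)
    show "\<exists>x. x \<in> X 0" using assms infinite_imp_nonempty by blast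
    show "\<exists>y. y \<in> X (Suc k) \<and> x < y" for x k
      using assms[of "Suc k"] by (meson infinite_nat_iff_unbounded)
  qed
  then obtain f where f: "\<And>k. f k \<in> X k" "\<And>k. f k < f (Suc k)" by blast
  then have "strict_mono f" by (simp add: strict_mono_Suc_iff)
  then show ?thesis using f strict_mono_imp_inj_on by blast
qed

text \<open>Of the group only \<open>sat\<close> is left: saturations of open sets are open, that
  is, the quotient maps are open.\<close>

locale separating_family =
  fixes T :: "'a topology" and \<M> :: "'i set" and \<Phi> :: "'i \<Rightarrow> ('a \<Rightarrow> complex) set"
  assumes T: "compact_space T"
    and \<Phi>: "\<And>p. p \<in> \<M> \<Longrightarrow> countable (\<Phi> p)"
      "\<And>p \<phi>. \<lbrakk>p \<in> \<M>; \<phi> \<in> \<Phi> p\<rbrakk> \<Longrightarrow> continuous_map T euclidean \<phi>"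
    and sep: "\<And>x y. \<lbrakk>x \<in> topspace T; y \<in> topspace T; agree (\<Union>(\<Phi> ` \<M>)) x y\<rbrakk> \<Longrightarrow> x = y"
    and sat: "\<And>S U. \<lbrakk>S \<subseteq> \<M>; openin T U\<rbrakk> \<Longrightarrow> openin T {g \<in> topspace T. \<exists>y\<in>U. agree (\<Union>(\<Phi> ` S)) g y}"
    and not_metrizable: "\<not> metrizable_space T"
begin

abbreviation eqv :: "'i set \<Rightarrow> 'a \<Rightarrow> 'a \<Rightarrow> bool" where "eqv S \<equiv> agree (\<Union>(\<Phi> ` S))"

lemma eqv_mono: "\<lbrakk>S \<subseteq> S'; eqv S' x y\<rbrakk> \<Longrightarrow> eqv S x y"
  by (rule agree_mono[of "\<Union>(\<Phi> ` S)"]) auto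

definition cls :: "'i set \<Rightarrow> 'a \<Rightarrow> 'a set" where
  "cls S x = {g \<in> topspace T. eqv S g x}"

text \<open>Asking for infinitely many \<open>n\<close> leaves room to lift a dense sequence to a dense sequence of
  a finer metrizable quotient: distinct indices can be reserved for the members of a countable base.\<close>

definition inf_dense :: "(nat \<Rightarrow> 'a set) \<Rightarrow> bool" where
  "inf_dense s \<longleftrightarrow> (\<forall>U. openin T U \<and> U \<noteq> {} \<longrightarrow> infinite {n. s n \<inter> U \<noteq> {}})"

text \<open>By \<open>sat\<close> the saturation of \<open>U\<close> is an open set containing the
  whole class of \<open>x\<close>, so \<open>compact_preimages_nhd\<close> applies to it.\<close>

lemma nhd:
  assumes "S \<subseteq> \<M>" "openin T U" "x \<in> U"
  shows "\<exists>\<K>. finite \<K> \<and> \<K> \<subseteq> preimages (\<Union>(\<Phi> ` S)) \<and> x \<in> \<Inter>\<K> \<and>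
    (\<forall>g\<in>topspace T. g \<in> \<Inter>\<K> \<longrightarrow> (\<exists>y\<in>U. eqv S g y))"
proof -
  have "\<exists>\<K>. finite \<K> \<and> \<K> \<subseteq> preimages (\<Union>(\<Phi> ` S)) \<and> x \<in> \<Inter>\<K> \<and>
    (\<forall>g\<in>topspace T. g \<in> \<Inter>\<K> \<longrightarrow> g \<in> {g \<in> topspace T. \<exists>y\<in>U. eqv S g y})"
    by (rule compact_preimages_nhd[OF _ _ sat[OF assms(1,2)]])
      (use \<Phi> assms T in \<open>auto simp: compact_space_def\<close>)
  then show ?thesis by (elim exE conjE) (rule exI, intro conjI, assumption+, blast)
qed

text \<open>The sequence consists of classes and not of points: a refinement shrinks each class, so
  along a chain the \<open>n\<close>-th classes are nested closed sets and have a common point by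
  compactness.\<close>

definition stages :: "('i set \<times> (nat \<Rightarrow> 'a set)) set" where
  "stages = {(S, s). S \<subseteq> \<M> \<and> countable S \<and> (\<forall>n. \<exists>x\<in>topspace T. s n = cls S x) \<and> inf_dense s}"

definition refines :: "('i set \<times> (nat \<Rightarrow> 'a set)) \<Rightarrow> ('i set \<times> (nat \<Rightarrow> 'a set)) \<Rightarrow> bool" where
  "refines p q \<longleftrightarrow> fst p \<subseteq> fst q \<and> (\<forall>n. snd q n \<subseteq> snd p n)"

text \<open>The quotient by \<open>insert p S\<close> has a countable base, and each class
  \<open>s n\<close> has to be cut down to one finer class. Distinct indices \<open>f k\<close> are
  reserved for the members \<open>t k\<close> of the base, and \<open>s (f k)\<close> is cut down to
  the class of a point of \<open>t k\<close>.\<close>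

lemma stage_extend:
  assumes "(S, s) \<in> stages" and p: "p \<in> \<M>"
  shows "\<exists>s'. (insert p S, s') \<in> stages \<and> refines (S, s) (insert p S, s')"
proof -
  have S: "S \<subseteq> \<M>" "countable S" "inf_dense s" and "\<And>n. \<exists>x\<in>topspace T. s n = cls S x"
    using assms(1) by (auto simp: stages_def)
  then obtain x where x: "\<And>n. x n \<in> topspace T" "\<And>n. s n = cls S (x n)" by metis
  define S' where "S' = insert p S"
  have S': "S' \<subseteq> \<M>" "countable S'" using S p by (auto simp: S'_def)
  define \<Psi> where "\<Psi> = \<Union>(\<Phi> ` S')"
  have \<Psi>: "countable \<Psi>" "\<And>\<phi>. \<phi> \<in> \<Psi> \<Longrightarrow> continuous_map T euclidean \<phi>"
    using S' \<Phi> by (auto simp: \<Psi>_def)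
  \<comment> \<open>Nonempty finite intersections of preimages, a base for the finer
    quotient.\<close>
  define \<B> where "\<B> = (\<lambda>\<K>. topspace T \<inter> \<Inter>\<K>) ` {\<K>. finite \<K> \<and> \<K> \<subseteq> preimages \<Psi>} - {{}}"
  have \<B>: "countable \<B>" "\<And>B. B \<in> \<B> \<Longrightarrow> openin T B \<and> B \<noteq> {}"
    using countable_Collect_finite_subset[OF countable_preimages[OF \<Psi>(1)]] openin_preimages[OF \<Psi>(2)]
    by (auto simp: \<B>_def)
  have "topspace T \<noteq> {}" using x by blast
  then have "topspace T \<inter> \<Inter>{} \<in> \<B>" unfolding \<B>_def by blast
  then have \<B>ne: "\<B> \<times> (UNIV :: nat set) \<noteq> {}" by blast
  \<comment> \<open>Enumerating pairs with a natural number lists every member of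
    \<open>\<B>\<close> infinitely often; with \<open>f\<close> injective this gives the infinitely
    many indices that \<open>inf_dense\<close> asks for.\<close>
  define t where "t k = fst (from_nat_into (\<B> \<times> (UNIV :: nat set)) k)" for k
  have tB: "t k \<in> \<B>" for k
    using from_nat_into[OF \<B>ne, of k] by (auto simp: t_def)
  have t_inf: "infinite {k. t k = B}" if "B \<in> \<B>" for B
  proof -
    have "{B} \<times> (UNIV :: nat set) \<subseteq> from_nat_into (\<B> \<times> UNIV) ` {k. t k = B}"
    proof
      fix z assume z: "z \<in> {B} \<times> (UNIV :: nat set)"
      then have "z \<in> \<B> \<times> UNIV" using that by auto
      then obtain k where "from_nat_into (\<B> \<times> UNIV) k = z"
        using from_nat_into_surj[of "\<B> \<times> (UNIV :: nat set)" z] \<B>(1) by auto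
      then show "z \<in> from_nat_into (\<B> \<times> UNIV) ` {k. t k = B}"
        using z by (intro image_eqI[of _ _ k]) (auto simp: t_def)
    qed
    moreover have "infinite ({B} \<times> (UNIV :: nat set))" by (simp add: finite_cartesian_product_iff)
    ultimately show ?thesis using finite_surj by blast
  qed
  have "infinite {n. s n \<inter> t k \<noteq> {}}" for k
    using S(3) \<B>(2)[OF tB] unfolding inf_dense_def by blast
  then obtain f where f: "inj f" "\<And>k. s (f k) \<inter> t k \<noteq> {}"
    using inj_choice_infinite[of "\<lambda>k. {n. s n \<inter> t k \<noteq> {}}"] by auto
  then have "\<exists>y. y \<in> s (f k) \<inter> t k" for k by blast
  then obtain y where y: "\<And>k. y k \<in> s (f k) \<inter> t k" by metis
  define z where "z n = (if n \<in> range f then y (inv_into UNIV f n) else x n)" for n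
  have zf: "z (f k) = y k" for k using f(1) by (simp add: z_def)
  have z: "z n \<in> s n" for n
  proof (cases "n \<in> range f")
    case True
    then show ?thesis using y zf by auto
  next
    case False
    then show ?thesis using x by (simp add: z_def cls_def)
  qed
  have zT: "z n \<in> topspace T" for n using z[of n] x by (auto simp: cls_def)
  define s' where "s' n = cls S' (z n)" for n
  have "inf_dense s'"
    unfolding inf_dense_def
  proof (intro allI impI, elim conjE)
    fix U assume U: "openin T U" "U \<noteq> {}"
    then obtain u where u: "u \<in> U" by blast
    from nhd[OF S'(1) U(1) u] obtain \<K> where \<K>: "finite \<K>" "\<K> \<subseteq> preimages (\<Union>(\<Phi> ` S'))" "u \<in> \<Inter>\<K>"
        "\<forall>g\<in>topspace T. g \<in> \<Inter>\<K> \<longrightarrow> (\<exists>y\<in>U. eqv S' g y)"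
      by (elim exE conjE) (rule that)
    define B where "B = topspace T \<inter> \<Inter>\<K>"
    have "u \<in> B" using \<K>(3) u openin_subset[OF U(1)] by (auto simp: B_def)
    then have "B \<in> \<B>" unfolding \<B>_def B_def \<Psi>_def using \<K>(1,2) by blast
    then have "infinite (f ` {k. t k = B})"
      using t_inf f(1) by (simp add: finite_image_iff inj_on_def)
    moreover have "f ` {k. t k = B} \<subseteq> {n. s' n \<inter> U \<noteq> {}}"
    proof clarify
      fix k assume *: "B = t k" "s' (f k) \<inter> U = {}"
      then have "z (f k) \<in> B" using y zf by auto
      then obtain v where v: "v \<in> U" "eqv S' (z (f k)) v" using \<K>(4) unfolding B_def by (metis IntE)
      then have "v \<in> s' (f k)"
        using openin_subset[OF U(1)] agree_sym by (auto simp: s'_def cls_def)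
      then show False using * v by auto
    qed
    ultimately show "infinite {n. s' n \<inter> U \<noteq> {}}" using finite_subset by blast
  qed
  then have "(S', s') \<in> stages" using S' zT by (auto simp: stages_def s'_def)
  moreover have "s' n \<subseteq> s n" for n
  proof
    fix g assume "g \<in> s' n"
    then have g: "g \<in> topspace T" "eqv S' g (z n)" by (auto simp: s'_def cls_def)
    then have "eqv S g (z n)" using eqv_mono[of S S'] by (auto simp: S'_def)
    then show "g \<in> s n" using g z[of n] unfolding x(2) cls_def by (auto intro: agree_trans)
  qed
  ultimately show ?thesis unfolding refines_def S'_def by auto
qed

lemma topspace_nonempty: "topspace T \<noteq> {}"
proof
  assume "topspace T = {}"
  then have "T = trivial_topology" by simp
  then show False using not_metrizable by simp
qed

text \<open>\<open>A\<close> is the union of the index sets along a maximal chain. Were it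
  countable, the limit classes would form a stage above the chain; as \<open>T\<close> is not
  metrizable, that stage would have a proper extension, against maximality.\<close>

theorem uncountable_quotient_separable:
  "\<exists>A x. A \<subseteq> \<M> \<and> uncountable A \<and> (\<forall>n. x n \<in> topspace T) \<and>
    (\<forall>U. openin T U \<and> U \<noteq> {} \<longrightarrow> (\<exists>n::nat. \<exists>y\<in>U. eqv A y (x n)))"
proof -
  obtain C where "pred_on.maxchain stages refines C" using pred_on.Hausdorff by blast
  then have C_chain: "pred_on.chain stages refines C"
    and C_max: "\<And>D. pred_on.chain stages refines D \<Longrightarrow> \<not> C \<subset> D"
    unfolding pred_on.maxchain_def by auto
  have refl: "refines p p" for p by (simp add: refines_def)
  have "refines p q \<or> refines q p" if "p \<in> C" "q \<in> C" for p q
  proof -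
    have "refines\<^sup>=\<^sup>= p q \<or> refines\<^sup>=\<^sup>= q p" using C_chain that unfolding pred_on.chain_def by blast
    then show ?thesis using refl[of p] refl[of q] by auto
  qed
  moreover have "C \<subseteq> stages" using C_chain unfolding pred_on.chain_def by blast
  ultimately have C: "C \<subseteq> stages" "\<And>p q. \<lbrakk>p \<in> C; q \<in> C\<rbrakk> \<Longrightarrow> refines p q \<or> refines q p" by auto
  have trans: "refines p r" if "refines p q" "refines q r" for p q r
    using that unfolding refines_def by blast
  have maximum: "\<exists>p\<in>D. \<forall>q\<in>D. refines q p" if "finite D" "D \<noteq> {}" "D \<subseteq> C" for D
    using that
  proof (induction rule: finite_ne_induct)
    case (insert q D)
    then obtain p where p: "p \<in> D" "\<forall>q\<in>D. refines q p" by auto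
    have "refines p q \<or> refines q p" using C(2)[of p q] insert.prems p by blast
    then show ?case using p trans refl by (metis insertCI insertE)
  qed (simp add: refl)
  have C_ne: "C \<noteq> {}"
  proof
    assume "C = {}"
    obtain t where "t \<in> topspace T" using topspace_nonempty by (metis ex_in_conv)
    \<comment> \<open>With no functions there is a single class, the whole space.\<close>
    then have "({}, \<lambda>_. topspace T) \<in> stages"
      using openin_subset[of T]
      by (auto simp: stages_def cls_def inf_dense_def agree_def Int_absorb1)
    then have "pred_on.chain stages refines {({}, \<lambda>_. topspace T)}"
      unfolding pred_on.chain_def by (auto simp: refl)
    then show False using C_max \<open>C = {}\<close> by blast
  qed
  define A where "A = \<Union>(fst ` C)"
  have AM: "A \<subseteq> \<M>" using C(1) by (force simp: A_def stages_def)
  have cls_closed: "closedin T (cls S x)" if "S \<subseteq> \<M>" and "x \<in> topspace T" for S x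
  proof -
    have "closedin T (topspace T \<inter> \<Inter>((\<lambda>\<phi>. {g \<in> topspace T. \<phi> g \<in> {\<phi> x}}) ` \<Union>(\<Phi> ` S)))"
    proof (cases "\<Union>(\<Phi> ` S) = {}")
      case False
      have "closedin T {g \<in> topspace T. \<phi> g \<in> {\<phi> x}}" if "\<phi> \<in> \<Union>(\<Phi> ` S)" for \<phi>
        using \<Phi>(2) that \<open>S \<subseteq> \<M>\<close> by (intro closedin_continuous_map_preimage[of T euclidean]) auto
      then show ?thesis using False
        by (intro closedin_Int closedin_Inter) auto
    qed simp
    moreover have "topspace T \<inter> \<Inter>((\<lambda>\<phi>. {g \<in> topspace T. \<phi> g \<in> {\<phi> x}}) ` \<Union>(\<Phi> ` S)) = cls S x"
      by (auto simp: cls_def agree_def)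
    ultimately show ?thesis by simp
  qed
  have stage: "closedin T (snd p n)" "snd p n \<noteq> {}" if "p \<in> C" for p n
  proof -
    obtain S s where p: "p = (S, s)" by fastforce
    have "(S, s) \<in> stages" using that C(1) p by blast
    then obtain x where "S \<subseteq> \<M>" "x \<in> topspace T" "s n = cls S x" unfolding stages_def by blast
    then show "closedin T (snd p n)" "snd p n \<noteq> {}"
      using cls_closed p by (auto simp: cls_def)
  qed
  \<comment> \<open>A finite part of the chain has a finest member, whose \<open>n\<close>-th class
    lies in all the others; compactness extends this to the whole chain.\<close>
  have "\<Inter>((\<lambda>p. snd p n) ` C) \<noteq> {}" for n
  proof -
    have "\<Inter>\<F> \<noteq> {}" if \<F>: "finite \<F>" "\<F> \<subseteq> (\<lambda>p. snd p n) ` C" for \<F>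
    proof (cases "\<F> = {}")
      case False
      obtain D where D: "finite D" "D \<subseteq> C" "\<F> = (\<lambda>p. snd p n) ` D" using \<F> by (metis finite_subset_image)
      then obtain p where p: "p \<in> D" "\<forall>q\<in>D. refines q p" using maximum False by blast
      then have "snd p n \<subseteq> \<Inter>\<F>" unfolding D(3) by (auto simp: refines_def)
      then show ?thesis using stage(2) p D by blast
    qed simp
    then show ?thesis using T stage(1) unfolding compact_space_fip by (metis (no_types, lifting) imageE)
  qed
  then have "\<exists>y. \<forall>p\<in>C. y \<in> snd p n" for n by blast
  then obtain x where x: "\<And>n p. p \<in> C \<Longrightarrow> x n \<in> snd p n" by metis
  have xT: "x n \<in> topspace T" for n
    using C_ne x stage(1) closedin_subset by (metis ex_in_conv subsetD)
  have cls_C: "snd p n = cls (fst p) (x n)" if pC: "p \<in> C" for p n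
  proof -
    obtain S s where p: "p = (S, s)" by fastforce
    then obtain w where w: "w \<in> topspace T" "s n = cls S w" using pC C(1) unfolding stages_def by blast
    have "eqv S (x n) w" using x[OF pC, of n] w p by (simp add: cls_def)
    then have "eqv S g (x n) \<longleftrightarrow> eqv S g w" for g by (metis agree_sym agree_trans)
    then have "cls S (x n) = cls S w" by (simp add: cls_def)
    then show ?thesis using w p by simp
  qed
  have dense: "inf_dense (\<lambda>n. cls A (x n))"
    unfolding inf_dense_def
  proof (intro allI impI, elim conjE)
    fix U assume U: "openin T U" "U \<noteq> {}"
    then obtain u where u: "u \<in> U" by blast
    from nhd[OF AM U(1) u] obtain \<K> where \<K>: "finite \<K>" "\<K> \<subseteq> preimages (\<Union>(\<Phi> ` A))" "u \<in> \<Inter>\<K>"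
        "\<forall>g\<in>topspace T. g \<in> \<Inter>\<K> \<longrightarrow> (\<exists>y\<in>U. eqv A g y)"
      by (elim exE conjE) (rule that)
    \<comment> \<open>The finite set \<open>\<K>\<close> uses functions from finitely many stages,
      hence from a single stage \<open>p\<close> of the chain, and the density of that stage
      suffices.\<close>
    have "\<forall>B\<in>\<K>. \<exists>p\<in>C. B \<in> preimages (\<Union>(\<Phi> ` fst p))"
    proof
      fix B assume "B \<in> \<K>"
      then have "B \<in> preimages (\<Union>(\<Phi> ` A))" by (rule subsetD[OF \<K>(2)])
      then obtain a where a: "a \<in> A" "B \<in> preimages (\<Phi> a)" unfolding preimages_UN by (elim bexE)
      then obtain p where "p \<in> C" "a \<in> fst p" unfolding A_def by (elim UnionE imageE) simp
      then show "\<exists>p\<in>C. B \<in> preimages (\<Union>(\<Phi> ` fst p))"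
        unfolding preimages_UN using a(2) by (intro bexI[of _ p] bexI[of _ a])
    qed
    then obtain c where c: "\<And>B. B \<in> \<K> \<Longrightarrow> c B \<in> C \<and> B \<in> preimages (\<Union>(\<Phi> ` fst (c B)))" by metis
    obtain p0 where "p0 \<in> C" using C_ne by blast
    then have "\<exists>p\<in>insert p0 (c ` \<K>). \<forall>q\<in>insert p0 (c ` \<K>). refines q p"
      using \<K>(1) c by (intro maximum) auto
    then obtain p where p: "p \<in> insert p0 (c ` \<K>)" "\<And>B. B \<in> \<K> \<Longrightarrow> refines (c B) p"
      by (elim bexE) (rule that, auto simp only: insert_iff image_iff)
    have pC: "p \<in> C" using p(1) c \<open>p0 \<in> C\<close> by auto
    have \<K>p: "\<K> \<subseteq> preimages (\<Union>(\<Phi> ` fst p))"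
    proof
      fix B assume B: "B \<in> \<K>"
      then have "B \<in> preimages (\<Union>(\<Phi> ` fst (c B)))" using c by simp
      then obtain a where a: "a \<in> fst (c B)" "B \<in> preimages (\<Phi> a)" unfolding preimages_UN by (elim bexE)
      then have "a \<in> fst p" using p(2)[OF B] unfolding refines_def by (elim conjE) (rule subsetD)
      then show "B \<in> preimages (\<Union>(\<Phi> ` fst p))" unfolding preimages_UN using a(2) by (intro bexI[of _ a])
    qed
    have "p \<in> stages" using pC C(1) by blast
    then have pM: "fst p \<subseteq> \<M>" and p_dense: "inf_dense (snd p)" by (auto simp: stages_def)
    have "openin T (topspace T \<inter> \<Inter>\<K>)"
      using \<Phi>(2) pM by (intro openin_preimages[OF _ \<K>(1) \<K>p]) auto
    moreover have "topspace T \<inter> \<Inter>\<K> \<noteq> {}" using \<K>(3) u openin_subset[OF U(1)] by auto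
    ultimately have "infinite {n. snd p n \<inter> (topspace T \<inter> \<Inter>\<K>) \<noteq> {}}"
      using p_dense unfolding inf_dense_def by simp
    moreover have "{n. snd p n \<inter> (topspace T \<inter> \<Inter>\<K>) \<noteq> {}} \<subseteq> {n. cls A (x n) \<inter> U \<noteq> {}}"
    proof
      fix n assume "n \<in> {n. snd p n \<inter> (topspace T \<inter> \<Inter>\<K>) \<noteq> {}}"
      then obtain w where w: "w \<in> snd p n" "w \<in> \<Inter>\<K>" by auto
      have "eqv (fst p) w (x n)" using w(1) unfolding cls_C[OF pC] cls_def by simp
      \<comment> \<open>The members of \<open>\<K>\<close> are unions of classes of stage
        \<open>p\<close>, and \<open>w\<close> and \<open>x n\<close> lie in the same one.\<close>
      then have "x n \<in> \<Inter>\<K>" using agree_preimages[OF _ \<K>p] w(2) by blast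
      then obtain v where "v \<in> U" "eqv A (x n) v" using \<K>(4) xT by metis
      then have "v \<in> cls A (x n) \<inter> U" using openin_subset[OF U(1)] agree_sym[of _ "x n" v]
        unfolding cls_def by auto
      then show "n \<in> {n. cls A (x n) \<inter> U \<noteq> {}}" by blast
    qed
    ultimately show "infinite {n. cls A (x n) \<inter> U \<noteq> {}}" using finite_subset by blast
  qed
  have unc: "uncountable A"
  proof
    assume A: "countable A"
    have stage_A: "(A, \<lambda>n. cls A (x n)) \<in> stages" using AM A xT dense by (auto simp: stages_def)
    have above: "refines p (A, \<lambda>n. cls A (x n))" if "p \<in> C" for p
    proof -
      have "fst p \<subseteq> A" using that by (auto simp: A_def)
      then show ?thesis
        using eqv_mono[of "fst p" A] by (auto simp: refines_def cls_C[OF that] cls_def)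
    qed
    have "\<exists>a\<in>topspace T. \<exists>b\<in>topspace T. eqv A a b \<and> a \<noteq> b"
    proof (rule ccontr)
      assume "\<not> ?thesis"
      moreover have "countable (\<Union>(\<Phi> ` A))" using A AM \<Phi>(1) by (intro countable_UN) auto
      moreover have "continuous_map T euclidean \<phi>" if "\<phi> \<in> \<Union>(\<Phi> ` A)" for \<phi>
        using that AM \<Phi>(2) by auto
      ultimately have "metrizable_space T"
        by (intro countable_separating_metrizable[OF T, of "\<Union>(\<Phi> ` A)"]) auto
      then show False using not_metrizable by blast
    qed
    then obtain a b where ab: "a \<in> topspace T" "b \<in> topspace T" "eqv A a b" "\<not> eqv \<M> a b"
      using sep by blast
    then obtain p \<phi> where p: "p \<in> \<M>" "\<phi> \<in> \<Phi> p" "\<phi> a \<noteq> \<phi> b" by (auto simp: agree_def)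
    then have "p \<notin> A" using ab(3) by (auto simp: agree_def)
    obtain s' where s': "(insert p A, s') \<in> stages" "refines (A, \<lambda>n. cls A (x n)) (insert p A, s')"
      using stage_extend[OF stage_A p(1)] by blast
    have "pred_on.chain stages refines (insert (insert p A, s') C)"
      using C_chain s' trans[OF above s'(2)] unfolding pred_on.chain_def by auto
    moreover have "(insert p A, s') \<notin> C"
    proof
      assume "(insert p A, s') \<in> C"
      then have "insert p A \<subseteq> A" unfolding A_def by force
      then show False using \<open>p \<notin> A\<close> by blast
    qed
    ultimately show False using C_max by blast
  qed
  have meet: "\<exists>n. \<exists>y\<in>U. eqv A y (x n)" if U: "openin T U" "U \<noteq> {}" for U
  proof -
    have "{n. cls A (x n) \<inter> U \<noteq> {}} \<noteq> {}" using dense U unfolding inf_dense_def by (metis finite.emptyI)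
    then show ?thesis unfolding cls_def by blast
  qed
  show ?thesis
    by (intro exI[of _ A] exI[of _ x] conjI allI impI AM unc xT, elim conjE) (rule meet)
qed

end


section \<open>A dense subgroup with small compact subsets\<close>

text \<open>\<open>C\<close> meets only countably many classes, so countably many functions
  \<open>\<Psi>\<close> distinguish them. Each function in \<open>\<Phi>\<close> is then described
  on \<open>C\<close> up to \<open>e\<close> by a finite code from a countable set, and uncountably
  many members of \<open>V\<close> cannot all have different codes.\<close>

lemma close_pair_on_compact:
  fixes \<Phi> :: "('a \<Rightarrow> complex) set"
  assumes \<Phi>: "\<And>\<phi>. \<phi> \<in> \<Phi> \<Longrightarrow> continuous_map T euclidean \<phi>"
    and C: "compactin T C" and Q: "countable Q" "\<And>x. x \<in> C \<Longrightarrow> \<exists>q\<in>Q. agree \<Phi> x q"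
    and V: "uncountable V" and I: "finite I" and coef: "\<And>u i. \<lbrakk>u \<in> V; i \<in> I\<rbrakk> \<Longrightarrow> f u i \<in> \<Phi>"
    and e: "e > 0"
  shows "\<exists>u\<in>V. \<exists>v\<in>V. u \<noteq> v \<and> (\<forall>x\<in>C. \<forall>i\<in>I. cmod (f u i x - f v i x) < e)"
proof -
  have "\<forall>p\<in>{(q, q'). q \<in> Q \<and> q' \<in> Q \<and> \<not> agree \<Phi> q q'}. \<exists>\<phi>. \<phi> \<in> \<Phi> \<and> \<phi> (fst p) \<noteq> \<phi> (snd p)"
    by (auto simp: agree_def)
  then obtain s where s: "\<And>q q'. \<lbrakk>q \<in> Q; q' \<in> Q; \<not> agree \<Phi> q q'\<rbrakk> \<Longrightarrow> s (q, q') \<in> \<Phi> \<and> s (q, q') q \<noteq> s (q, q') q'"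
    by (subst (asm) bchoice_iff) auto
  \<comment> \<open>One separating function for each pair of points of \<open>Q\<close> in different
    classes.\<close>
  define \<Psi> where "\<Psi> = s ` {(q, q'). q \<in> Q \<and> q' \<in> Q \<and> \<not> agree \<Phi> q q'}"
  have "countable (Q \<times> Q)" using Q(1) by simp
  then have cnt: "countable \<Psi>"
    unfolding \<Psi>_def by (intro countable_image) (rule countable_subset, auto)
  have \<Psi>\<Phi>: "\<Psi> \<subseteq> \<Phi>" using s by (auto simp: \<Psi>_def)
  have \<Psi>_agree: "agree \<Phi> g h" if g: "g \<in> C" and h: "h \<in> C" and gh: "agree \<Psi> g h" for g h
  proof -
    obtain q q' where q: "q \<in> Q" "agree \<Phi> g q" "q' \<in> Q" "agree \<Phi> h q'" using Q(2) g h by blast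
    have "agree \<Psi> q q'"
      using agree_mono[OF \<Psi>\<Phi> q(2)] agree_mono[OF \<Psi>\<Phi> q(4)] gh by (metis agree_sym agree_trans)
    have "agree \<Phi> q q'"
    proof (rule ccontr)
      assume n: "\<not> agree \<Phi> q q'"
      then have "s (q, q') \<in> \<Psi>" using q by (auto simp: \<Psi>_def)
      then show False using \<open>agree \<Psi> q q'\<close> s[OF q(1,3) n] by (auto simp: agree_def)
    qed
    then show ?thesis using q by (metis agree_sym agree_trans)
  qed
  define \<S> where "\<S> = {P \<in> complex_base. \<forall>a\<in>P. \<forall>b\<in>P. cmod (a - b) < e}"
  define \<N> where "\<N> = {\<K>. finite \<K> \<and> \<K> \<subseteq> preimages \<Psi>}"
  have cS: "countable \<S>" unfolding \<S>_def using complex_base(1) by (rule countable_subset[rotated]) auto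
  have cN: "countable \<N>" unfolding \<N>_def by (intro countable_Collect_finite_subset countable_preimages cnt)
  define codes where "codes = {c. finite c \<and> c \<subseteq> \<N> \<times> \<S>}"
  have c_codes: "countable codes" unfolding codes_def using cS cN by (intro countable_Collect_finite_subset) auto
  \<comment> \<open>A code covers \<open>C\<close> by finitely many basic sets and attaches to each
    a set from \<open>\<S>\<close> containing the values taken there, so two functions sharing a
    code differ by less than \<open>e\<close> on \<open>C\<close>.\<close>
  define covers where "covers c \<phi> \<longleftrightarrow> (\<forall>x\<in>C. \<exists>p\<in>c. x \<in> \<Inter>(fst p)) \<and>
    (\<forall>p\<in>c. \<forall>g\<in>C. g \<in> \<Inter>(fst p) \<longrightarrow> \<phi> g \<in> snd p)" for c and \<phi> :: "'a \<Rightarrow> complex"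
  have ex_code: "\<exists>c. c \<in> codes \<and> covers c \<phi>" if \<phi>: "\<phi> \<in> \<Phi>" for \<phi>
  proof -
    have "\<exists>p. p \<in> \<N> \<times> \<S> \<and> x \<in> \<Inter>(fst p) \<and> (\<forall>g\<in>C. g \<in> \<Inter>(fst p) \<longrightarrow> \<phi> g \<in> snd p)" if x: "x \<in> C" for x
    proof -
      obtain P where P: "P \<in> complex_base" "\<phi> x \<in> P" "P \<subseteq> ball (\<phi> x) (e / 2)"
        using topological_basisE[OF complex_base(2), of "ball (\<phi> x) (e / 2)" "\<phi> x"] e by auto
      have PS: "P \<in> \<S>"
      proof -
        have "cmod (a - b) < e" if "a \<in> P" "b \<in> P" for a b
        proof -
          have "dist (\<phi> x) a < e / 2" "dist (\<phi> x) b < e / 2" using that P(3) by auto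
          then show ?thesis using dist_triangle_half_r by (metis dist_norm)
        qed
        then show ?thesis using P(1) by (simp add: \<S>_def)
      qed
      have openP: "openin T {g \<in> topspace T. \<phi> g \<in> P}"
        using topological_basis_open[OF complex_base(2) P(1)]
        by (intro openin_continuous_map_preimage[OF \<Phi>[OF \<phi>]]) simp
      have "g \<in> {g \<in> topspace T. \<phi> g \<in> P}" if "g \<in> C" "agree \<Psi> g x" for g
      proof -
        have "\<phi> g = \<phi> x" using \<Psi>_agree[OF that(1) x that(2)] \<phi> by (simp add: agree_def)
        then show ?thesis using P(2) that compactin_subset_topspace[OF C] by auto
      qed
      then have "\<exists>\<K>. finite \<K> \<and> \<K> \<subseteq> preimages \<Psi> \<and> x \<in> \<Inter>\<K> \<and>
          (\<forall>g\<in>C. g \<in> \<Inter>\<K> \<longrightarrow> g \<in> {g \<in> topspace T. \<phi> g \<in> P})"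
        using \<Psi>\<Phi> by (intro compact_preimages_nhd[OF \<Phi> C openP]) auto
      then obtain \<K> where \<K>: "finite \<K>" "\<K> \<subseteq> preimages \<Psi>" "x \<in> \<Inter>\<K>"
          "\<forall>g\<in>C. g \<in> \<Inter>\<K> \<longrightarrow> g \<in> {g \<in> topspace T. \<phi> g \<in> P}"
        by (elim exE conjE) (rule that)
      then show ?thesis using PS by (intro exI[of _ "(\<K>, P)"]) (auto simp: \<N>_def)
    qed
    then obtain p where p: "\<And>x. x \<in> C \<Longrightarrow> p x \<in> \<N> \<times> \<S> \<and> x \<in> \<Inter>(fst (p x)) \<and>
        (\<forall>g\<in>C. g \<in> \<Inter>(fst (p x)) \<longrightarrow> \<phi> g \<in> snd (p x))" by metis
    define N where "N x = topspace T \<inter> \<Inter>(fst (p x))" for x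
    have "openin T (N x)" if "x \<in> C" for x
    proof -
      have "fst (p x) \<in> \<N>" using p[OF that] by (auto simp: mem_Times_iff)
      then show ?thesis unfolding N_def using \<Phi> \<Psi>\<Phi> by (intro openin_preimages[of \<Psi>]) (auto simp: \<N>_def)
    qed
    moreover have "C \<subseteq> \<Union>(N ` C)"
      using p compactin_subset_topspace[OF C] unfolding N_def by blast
    ultimately obtain \<F> where "finite \<F>" "\<F> \<subseteq> N ` C" "C \<subseteq> \<Union>\<F>"
      using compactinD[OF C, of "N ` C"] by blast
    then obtain D where D: "finite D" "D \<subseteq> C" "C \<subseteq> \<Union>(N ` D)" by (metis finite_subset_image)
    have "covers (p ` D) \<phi>"
      unfolding covers_def
    proof (intro conjI ballI impI)
      fix x assume "x \<in> C"
      then obtain d where "d \<in> D" "x \<in> N d" using D(3) by blast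
      then show "\<exists>q\<in>p ` D. x \<in> \<Inter>(fst q)" by (intro bexI[of _ "p d"]) (auto simp: N_def)
    next
      fix q g assume "q \<in> p ` D" "g \<in> C" "g \<in> \<Inter>(fst q)"
      then show "\<phi> g \<in> snd q" using p D(2) by (metis image_iff subsetD)
    qed
    moreover have "p ` D \<in> codes"
      unfolding codes_def using D p by (intro CollectI conjI finite_imageI image_subsetI) auto
    ultimately show ?thesis by blast
  qed
  then obtain code where code: "\<And>\<phi>. \<phi> \<in> \<Phi> \<Longrightarrow> code \<phi> \<in> codes \<and> covers (code \<phi>) \<phi>" by metis
  define cd where "cd u = (\<lambda>i\<in>I. code (f u i))" for u
  have "cd ` V \<subseteq> (\<Pi>\<^sub>E i\<in>I. codes)"
    using code coef by (auto simp: cd_def)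
  moreover have "countable (\<Pi>\<^sub>E i\<in>I. codes)" using I c_codes by (intro countable_PiE)
  ultimately have "countable (cd ` V)" using countable_subset by blast
  then have "\<not> inj_on cd V" using V countable_image_inj_on by blast
  then obtain u v where uv: "u \<in> V" "v \<in> V" "u \<noteq> v" "cd u = cd v" by (auto simp: inj_on_def)
  have "cmod (f u i x - f v i x) < e" if x: "x \<in> C" and i: "i \<in> I" for x i
  proof -
    have eq: "code (f u i) = code (f v i)" using fun_cong[OF uv(4), of i] i by (simp add: cd_def)
    have cu: "code (f u i) \<in> codes" "covers (code (f u i)) (f u i)"
      and cv: "covers (code (f u i)) (f v i)"
      using code[OF coef[OF uv(1) i]] code[OF coef[OF uv(2) i]] by (simp_all add: eq)
    obtain p where p: "p \<in> code (f u i)" "x \<in> \<Inter>(fst p)" using cu(2) x unfolding covers_def by (metis (no_types))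
    have "f u i x \<in> snd p" using cu(2) p x unfolding covers_def by (metis (no_types))
    moreover have "f v i x \<in> snd p" using cv p x unfolding covers_def by (metis (no_types))
    moreover have "snd p \<in> \<S>" using p(1) cu(1) unfolding codes_def by auto
    ultimately show ?thesis unfolding \<S>_def by blast
  qed
  then show ?thesis using uv by blast
qed

lemma (in group) countable_generate:
  assumes "countable X" "X \<subseteq> carrier G"
  shows "countable (generate G X)"
proof -
  define B where "B = rec_nat (insert \<one> (X \<union> m_inv G ` X)) (\<lambda>_ Y. (\<lambda>(a, b). a \<otimes> b) ` (Y \<times> Y) \<union> Y)"
  have B0: "B 0 = insert \<one> (X \<union> m_inv G ` X)"
    and BS: "\<And>n. B (Suc n) = (\<lambda>(a, b). a \<otimes> b) ` (B n \<times> B n) \<union> B n"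
    by (simp_all add: B_def)
  have cnt: "countable (B n)" for n
    by (induction n) (simp_all add: B0 BS assms(1))
  have mono: "B m \<subseteq> B n" if "m \<le> n" for m n
    using that by (induction rule: dec_induct) (auto simp: BS)
  have "h \<in> (\<Union>n. B n)" if "h \<in> generate G X" for h
    using that
  proof (induction rule: generate.induct)
    case (eng h1 h2)
    then obtain m n where "h1 \<in> B m" "h2 \<in> B n" by blast
    then have "h1 \<in> B (max m n)" "h2 \<in> B (max m n)" using mono by (meson max.cobounded1 max.cobounded2 subsetD)+
    then have "h1 \<otimes> h2 \<in> B (Suc (max m n))" by (auto simp: BS)
    then show ?case by blast
  qed (use B0 in blast)+
  then have "generate G X \<subseteq> (\<Union>n. B n)" by blast
  then show ?thesis using cnt by (meson countable_UN countable_subset countableI_type)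
qed

fun coeffs :: "nat \<times> ('a \<Rightarrow> nat \<Rightarrow> nat \<Rightarrow> complex) \<Rightarrow> ('a \<Rightarrow> complex) set" where
  "coeffs (n, u) = {\<lambda>g. u g i j | i j. i < n \<and> j < n}"

lemma countable_coeffs: "countable (coeffs p)"
proof -
  obtain n u where p: "p = (n, u)" by fastforce
  have "coeffs p = (\<lambda>(i, j) g. u g i j) ` ({..<n} \<times> {..<n})" by (auto simp: p)
  then show ?thesis by (simp add: countable_finite)
qed

lemma agree_coeffs:
  "agree (\<Union>(coeffs ` S)) x y \<longleftrightarrow> (\<forall>n u i j. (n, u) \<in> S \<and> i < n \<and> j < n \<longrightarrow> u x i j = u y i j)"
proof (intro iffI allI impI; (elim conjE)?)
  fix n u i j assume a: "agree (\<Union>(coeffs ` S)) x y" and u: "(n, u) \<in> S" "i < n" "j < n"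
  have "(\<lambda>g. u g i j) \<in> \<Union>(coeffs ` S)" using u by (intro UN_I[of "(n, u)"]) auto
  from bspec[OF a[unfolded agree_def] this] show "u x i j = u y i j" .
next
  assume *: "\<forall>n u i j. (n, u) \<in> S \<and> i < n \<and> j < n \<longrightarrow> u x i j = u y i j"
  show "agree (\<Union>(coeffs ` S)) x y"
    unfolding agree_def
  proof
    fix \<phi> assume "\<phi> \<in> \<Union>(coeffs ` S)"
    then obtain p where "p \<in> S" "\<phi> \<in> coeffs p" by blast
    then show "\<phi> x = \<phi> y" using * by (cases p) auto
  qed
qed

section \<open>Common kernels and a maximal orthogonal family\<close>

context compact_group
begin

text \<open>Degree 0 is excluded because such a representation would be \<open>coeff_orth\<close> to
  itself, contrary to \<open>not_coeff_orth_self\<close>.\<close>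

definition mrep_set :: "(nat \<times> ('a \<Rightarrow> nat \<Rightarrow> nat \<Rightarrow> complex)) set \<Rightarrow> bool" where
  "mrep_set S \<longleftrightarrow> (\<forall>n u. (n, u) \<in> S \<longrightarrow> n \<ge> 1 \<and> mrep G T {..<n} u)"

lemma mrep_set_subset: "\<lbrakk>mrep_set S; S' \<subseteq> S\<rbrakk> \<Longrightarrow> mrep_set S'"
  unfolding mrep_set_def by blast

lemma agree_mult:
  assumes S: "mrep_set S" and carrier: "g \<in> carrier G" "h \<in> carrier G" "g' \<in> carrier G" "h' \<in> carrier G"
    and gh: "agree (\<Union>(coeffs ` S)) g g'" "agree (\<Union>(coeffs ` S)) h h'"
  shows "agree (\<Union>(coeffs ` S)) (g \<otimes> h) (g' \<otimes> h')"
  unfolding agree_coeffs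
proof (intro allI impI, elim conjE)
  fix n u i j assume u: "(n, u) \<in> S" and ij: "i < n" "j < n"
  have m: "mrep G T {..<n} u" using S u by (simp add: mrep_set_def)
  have "(\<Sum>k<n. u g i k * u h k j) = (\<Sum>k<n. u g' i k * u h' k j)"
    using gh u ij unfolding agree_coeffs by (intro sum.cong refl arg_cong2[where f="(*)"]) auto
  then show "u (g \<otimes> h) i j = u (g' \<otimes> h') i j"
    using mrepD(3)[OF m carrier(1,2), of i j] mrepD(3)[OF m carrier(3,4), of i j] ij by simp
qed

lemma agree_inv:
  assumes S: "mrep_set S" and carrier: "g \<in> carrier G" "g' \<in> carrier G"
    and gg: "agree (\<Union>(coeffs ` S)) g g'"
  shows "agree (\<Union>(coeffs ` S)) (inv g) (inv g')"
  unfolding agree_coeffs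
proof (intro allI impI, elim conjE)
  fix n u i j assume u: "(n, u) \<in> S" and ij: "i < n" "j < n"
  have m: "mrep G T {..<n} u" using S u by (simp add: mrep_set_def)
  have "u g j i = u g' j i" using gg u ij unfolding agree_coeffs by blast
  then show "u (inv g) i j = u (inv g') i j"
    using mrepD(5)[OF m carrier(1), of i j] mrepD(5)[OF m carrier(2), of i j] ij by simp
qed

text \<open>The saturation is the union of the right translates of \<open>U\<close> by elements
  \<open>m\<close> of the common kernel; \<open>m = inv y \<otimes> g\<close> is the one taking
  \<open>y\<close> to \<open>g\<close>.\<close>

lemma saturation_open:
  assumes S: "mrep_set S" and U: "openin T U"
  shows "openin T {g \<in> topspace T. \<exists>y\<in>U. agree (\<Union>(coeffs ` S)) g y}"
proof -
  let ?E = "agree (\<Union>(coeffs ` S))"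
  have UG: "U \<subseteq> carrier G" using openin_subset[OF U] topspace_eq by blast
  have "{g \<in> topspace T. \<exists>y\<in>U. ?E g y} =
      \<Union>((\<lambda>m. {h \<in> topspace T. h \<otimes> inv m \<in> U}) ` {m \<in> carrier G. ?E m \<one>})"
  proof (intro equalityI subsetI)
    fix g assume "g \<in> {g \<in> topspace T. \<exists>y\<in>U. ?E g y}"
    then obtain y where g: "g \<in> carrier G" and y: "y \<in> U" "?E g y" by (auto simp: topspace_eq)
    have yG: "y \<in> carrier G" using y UG by blast
    define m where "m = inv y \<otimes> g"
    have "?E m (inv y \<otimes> y)" unfolding m_def using g yG y by (intro agree_mult[OF S]) auto
    then have m: "m \<in> carrier G" "?E m \<one>" using g yG by (auto simp: m_def)
    have "g \<otimes> inv m = g \<otimes> (inv g \<otimes> y)" using g yG by (simp add: m_def inv_mult_group)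
    then have "g \<otimes> inv m = y" using g yG by (simp add: m_assoc[symmetric])
    then show "g \<in> \<Union>((\<lambda>m. {h \<in> topspace T. h \<otimes> inv m \<in> U}) ` {m \<in> carrier G. ?E m \<one>})"
      using m y g by (intro UN_I[of m]) (auto simp: topspace_eq)
  next
    fix g assume "g \<in> \<Union>((\<lambda>m. {h \<in> topspace T. h \<otimes> inv m \<in> U}) ` {m \<in> carrier G. ?E m \<one>})"
    then obtain m where m: "m \<in> carrier G" "?E m \<one>" and g: "g \<in> carrier G" "g \<otimes> inv m \<in> U"
      by (auto simp: topspace_eq)
    have "?E (g \<otimes> \<one>) (g \<otimes> inv m)"
      using agree_inv[OF S m(1) one_closed m(2)] m g by (intro agree_mult[OF S]) (auto intro: agree_sym)
    then show "g \<in> {g \<in> topspace T. \<exists>y\<in>U. ?E g y}" using g by (auto simp: topspace_eq)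
  qed
  moreover have "openin T {h \<in> topspace T. h \<otimes> inv m \<in> U}" if "m \<in> carrier G" for m
    using that by (intro openin_continuous_map_preimage[OF continuous_map_rtrans U]) simp
  ultimately show ?thesis by auto
qed

lemma coeff_orth_sym:
  assumes "mrep G T {..<n} u" "mrep G T {..<m} v" "coeff_orth G (n, u) (m, v)"
  shows "coeff_orth G (m, v) (n, u)"
  unfolding coeff_orth_def prod.case
proof (intro allI impI)
  fix i j k l assume ij: "i < m" "j < m" and kl: "k < n" "l < n"
  have "continuous_map T euclidean (\<lambda>g. u g k l * cnj (v g i j))"
    using mrepD(2)[OF assms(1)] mrepD(2)[OF assms(2)] ij kl by (intro cip_cont) auto
  from mean_cnj[OF this] have "mean G (\<lambda>g. v g i j * cnj (u g k l)) = cnj (mean G (\<lambda>g. u g k l * cnj (v g i j)))"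
    by (simp add: mult.commute)
  then show "mean G (\<lambda>g. v g i j * cnj (u g k l)) = 0"
    using assms(3) ij kl by (simp add: coeff_orth_def)
qed

text \<open>A row of a unitary matrix has norm 1, so the means of the squared moduli in row 0 add up
  to 1 and cannot all vanish.\<close>

lemma not_coeff_orth_self:
  assumes "mrep G T {..<n} u" "n \<ge> 1"
  shows "\<not> coeff_orth G (n, u) (n, u)"
proof
  assume o: "coeff_orth G (n, u) (n, u)"
  have cont: "continuous_map T euclidean (\<lambda>g. u g 0 k * cnj (u g 0 k))" if "k < n" for k
    using mrepD(2)[OF assms(1)] that assms(2) by (intro cip_cont) auto
  have "mean G (\<lambda>g. \<Sum>k<n. u g 0 k * cnj (u g 0 k)) = mean G (\<lambda>g. 1)"
  proof (rule mean_cong)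
    fix g assume g: "g \<in> carrier G"
    have "(\<Sum>k<n. u g 0 k * cnj (u g 0 k)) = (\<Sum>k<n. u g 0 k * u (inv g) k 0)"
      using mrepD(5)[OF assms(1) g] assms(2) by (intro sum.cong) auto
    also have "\<dots> = u (g \<otimes> inv g) 0 0"
      using mrepD(3)[OF assms(1) g inv_closed[OF g], of 0 0] assms(2) by simp
    finally show "(\<Sum>k<n. u g 0 k * cnj (u g 0 k)) = 1"
      using mrepD(4)[OF assms(1), of 0 0] assms(2) g by simp
  qed
  moreover have "mean G (\<lambda>g. \<Sum>k<n. u g 0 k * cnj (u g 0 k)) = (\<Sum>k<n. mean G (\<lambda>g. u g 0 k * cnj (u g 0 k)))"
    using cont by (intro mean_sum) auto
  ultimately show False using o assms(2) by (simp add: coeff_orth_def)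
qed

text \<open>A maximal orthogonal family, by Zorn's lemma. If it failed to separate some
  \<open>x\<close> from \<open>\<one>\<close>, \<open>coeff_orth_mrep_exists\<close> would give a
  representation orthogonal to all members; it cannot be a member, as it is not orthogonal to
  itself.\<close>

lemma orthogonal_family_exists:
  "\<exists>\<M>. mrep_set \<M> \<and> pairwise (coeff_orth G) \<M> \<and>
    (\<forall>x\<in>carrier G. agree (\<Union>(coeffs ` \<M>)) x \<one> \<longrightarrow> x = \<one>)"
proof -
  define \<A> where "\<A> = {F. mrep_set F \<and> pairwise (coeff_orth G) F}"
  have "\<exists>M\<in>\<A>. \<forall>X\<in>\<A>. M \<subseteq> X \<longrightarrow> X = M"
  proof (rule subset_Zorn')
    fix c assume c: "subset.chain \<A> c"
    then have "\<And>F. F \<in> c \<Longrightarrow> mrep_set F \<and> pairwise (coeff_orth G) F"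
      and ch: "\<And>F F'. \<lbrakk>F \<in> c; F' \<in> c\<rbrakk> \<Longrightarrow> F \<subseteq> F' \<or> F' \<subseteq> F"
      unfolding subset_chain_def \<A>_def by auto
    then show "\<Union>c \<in> \<A>"
      unfolding \<A>_def mrep_set_def pairwise_def by (simp, meson subsetD)
  qed
  then obtain M where M: "mrep_set M" "pairwise (coeff_orth G) M"
      and max: "\<And>X. \<lbrakk>mrep_set X; pairwise (coeff_orth G) X; M \<subseteq> X\<rbrakk> \<Longrightarrow> X = M"
    unfolding \<A>_def by blast
  have Mm: "mrep G T {..<m} v" if "(m, v) \<in> M" for m v using M(1) that by (simp add: mrep_set_def)
  have "x = \<one>" if x: "x \<in> carrier G" "agree (\<Union>(coeffs ` M)) x \<one>" for x
  proof (rule ccontr)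
    assume "x \<noteq> \<one>"
    then obtain n u where u: "n \<ge> 1" "mrep G T {..<n} u" "\<And>p. p \<in> M \<Longrightarrow> coeff_orth G (n, u) p"
      using coeff_orth_mrep_exists[of M x] Mm x unfolding agree_coeffs by blast
    have "mrep_set (insert (n, u) M)" using M(1) u by (auto simp: mrep_set_def)
    moreover have "coeff_orth G p (n, u)" if "p \<in> M" for p
      using that u(3)[OF that] coeff_orth_sym[OF u(2)] Mm by (cases p) auto
    then have "pairwise (coeff_orth G) (insert (n, u) M)"
      using M(2) u(3) by (simp add: pairwise_insert)
    ultimately have "insert (n, u) M = M" using max by blast
    then show False using not_coeff_orth_self[OF u(2,1)] u(3) by blast
  qed
  then show ?thesis using M by blast
qed

text \<open>The preimage of the image of \<open>Q\<close> in the quotient by the common kernel of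
  \<open>A\<close>.\<close>

definition saturated_subgroup :: "(nat \<times> ('a \<Rightarrow> nat \<Rightarrow> nat \<Rightarrow> complex)) set \<Rightarrow> 'a set \<Rightarrow> 'a set" where
  "saturated_subgroup A Q = {g \<in> carrier G. \<exists>q\<in>Q. agree (\<Union>(coeffs ` A)) g q}"

lemma subgroup_saturated:
  assumes A: "mrep_set A" and Q: "subgroup Q G"
  shows "subgroup (saturated_subgroup A Q) G"
proof (rule subgroupI)
  have QG: "Q \<subseteq> carrier G" using Q by (rule subgroup.subset)
  show "saturated_subgroup A Q \<noteq> {}"
    using subgroup.one_closed[OF Q] by (auto simp: saturated_subgroup_def intro!: exI[of _ \<one>] bexI[of _ \<one>])
  fix g assume "g \<in> saturated_subgroup A Q"
  then obtain q where g: "g \<in> carrier G" "q \<in> Q" "agree (\<Union>(coeffs ` A)) g q"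
    by (auto simp: saturated_subgroup_def)
  then show "inv g \<in> saturated_subgroup A Q"
    using agree_inv[OF A g(1) _ g(3)] QG subgroup.m_inv_closed[OF Q g(2)]
    by (auto simp: saturated_subgroup_def intro!: bexI[of _ "inv q"])
  fix h assume "h \<in> saturated_subgroup A Q"
  then obtain r where h: "h \<in> carrier G" "r \<in> Q" "agree (\<Union>(coeffs ` A)) h r"
    by (auto simp: saturated_subgroup_def)
  then show "g \<otimes> h \<in> saturated_subgroup A Q"
    using agree_mult[OF A g(1) h(1) _ _ g(3) h(3)] g QG subgroup.m_closed[OF Q g(2) h(2)]
    by (auto simp: saturated_subgroup_def intro!: bexI[of _ "q \<otimes> r"])
qed (auto simp: saturated_subgroup_def)

text \<open>The degree \<open>n\<close> is chosen before \<open>C\<close> and \<open>e\<close>: as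
  \<open>A\<close> is uncountable, some degree occurs in it uncountably often. Every point of
  \<open>D\<close> lies in the class of a point of the countable \<open>Q\<close>, so
  \<open>close_pair_on_compact\<close> applies to each compact \<open>C\<close> in
  \<open>D\<close>.\<close>

theorem dense_subgroup_close_pairs:
  assumes nm: "\<not> metrizable_space T"
  shows "\<exists>D n. subgroup D G \<and> T closure_of D = topspace T \<and>
    (\<forall>C e. compactin T C \<and> C \<subseteq> D \<and> e > 0 \<longrightarrow> (\<exists>u v. mrep G T {..<n::nat} u \<and> mrep G T {..<n} v \<and> n \<ge> 1 \<and>
      coeff_orth G (n, u) (n, v) \<and> (\<forall>x\<in>C. \<forall>i<n. \<forall>j<n. cmod (u x i j - v x i j) < e)))"
proof -
  obtain \<M> where \<M>: "mrep_set \<M>" "pairwise (coeff_orth G) \<M>"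
      and sep: "\<And>x. \<lbrakk>x \<in> carrier G; agree (\<Union>(coeffs ` \<M>)) x \<one>\<rbrakk> \<Longrightarrow> x = \<one>"
    using orthogonal_family_exists by blast
  have cont: "continuous_map T euclidean \<phi>" if "p \<in> \<M>" "\<phi> \<in> coeffs p" for p \<phi>
  proof -
    obtain n u where p: "p = (n, u)" by fastforce
    then have "mrep G T {..<n} u" using that \<M>(1) by (simp add: mrep_set_def)
    then show ?thesis using mrepD(2) that(2) unfolding p by fastforce
  qed
  interpret S: separating_family T \<M> coeffs
  proof
    show "x = y" if xy: "x \<in> topspace T" "y \<in> topspace T" "agree (\<Union>(coeffs ` \<M>)) x y" for x y
    proof -
      have G: "x \<in> carrier G" "y \<in> carrier G" using xy topspace_eq by auto
      have "agree (\<Union>(coeffs ` \<M>)) (inv y \<otimes> x) (inv y \<otimes> y)"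
        using G xy by (intro agree_mult[OF \<M>(1)]) auto
      then have "inv y \<otimes> x = \<one>" using sep[of "inv y \<otimes> x"] G by simp
      then show ?thesis using G by (metis inv_closed inv_inv inv_unique' l_inv r_inv inv_equality)
    qed
    show "openin T {g \<in> topspace T. \<exists>y\<in>U. agree (\<Union>(coeffs ` S)) g y}" if "S \<subseteq> \<M>" "openin T U" for S U
      using that saturation_open mrep_set_subset[OF \<M>(1)] by blast
  qed (use compact nm cont countable_coeffs in auto)
  obtain A x where A: "A \<subseteq> \<M>" "uncountable A" and x: "\<And>n::nat. x n \<in> topspace T"
      and dense: "\<And>U. \<lbrakk>openin T U; U \<noteq> {}\<rbrakk> \<Longrightarrow> \<exists>n. \<exists>y\<in>U. agree (\<Union>(coeffs ` A)) y (x n)"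
    using S.uncountable_quotient_separable by (elim exE conjE) (metis (no_types, lifting))
  have Am: "mrep_set A" using mrep_set_subset[OF \<M>(1) A(1)] .
  define Q where "Q = generate G (range x)"
  have xG: "range x \<subseteq> carrier G" using x topspace_eq by auto
  have Q: "countable Q" "subgroup Q G" "range x \<subseteq> Q"
    using countable_generate[OF _ xG] generate_is_subgroup[OF xG] generate.incl[of _ "range x" G]
    by (simp_all add: Q_def subsetI)
  define D where "D = saturated_subgroup A Q"
  have D: "subgroup D G" unfolding D_def by (rule subgroup_saturated[OF Am Q(2)])
  have Dd: "T closure_of D = topspace T"
  proof -
    have "D \<inter> U \<noteq> {}" if U: "openin T U" "U \<noteq> {}" for U
    proof -
      obtain n y where y: "y \<in> U" "agree (\<Union>(coeffs ` A)) y (x n)" using dense[OF U] by blast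
      moreover have "x n \<in> Q" using Q(3) by auto
      moreover have "y \<in> carrier G" using openin_subset[OF U(1)] topspace_eq y by auto
      ultimately have "y \<in> D \<inter> U" unfolding D_def saturated_subgroup_def by blast
      then show ?thesis by blast
    qed
    then show ?thesis by (simp add: dense_intersects_open)
  qed
  have "\<exists>n. uncountable {u. (n, u) \<in> A}"
  proof (rule ccontr)
    assume "\<not> ?thesis"
    then have "countable (\<Union>n. Pair n ` {u. (n, u) \<in> A})" by (intro countable_UN countable_image) auto
    moreover have "A \<subseteq> (\<Union>n. Pair n ` {u. (n, u) \<in> A})" by auto
    ultimately show False using A(2) countable_subset by blast
  qed
  then obtain n where n: "uncountable {u. (n, u) \<in> A}" by blast
  have pairs: "\<exists>u v. mrep G T {..<n} u \<and> mrep G T {..<n} v \<and> n \<ge> 1 \<and>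
      coeff_orth G (n, u) (n, v) \<and> (\<forall>x\<in>C. \<forall>i<n. \<forall>j<n. cmod (u x i j - v x i j) < e)"
    if C: "compactin T C" "C \<subseteq> D" and e: "e > 0" for C e
  proof -
    have "\<exists>u\<in>{u. (n, u) \<in> A}. \<exists>v\<in>{u. (n, u) \<in> A}. u \<noteq> v \<and>
        (\<forall>x\<in>C. \<forall>p\<in>{..<n} \<times> {..<n}. cmod ((\<lambda>g. u g (fst p) (snd p)) x - (\<lambda>g. v g (fst p) (snd p)) x) < e)"
    proof (rule close_pair_on_compact[where \<Phi> = "\<Union>(coeffs ` A)" and Q = Q, OF _ C(1) Q(1) _ n _ _ e])
      show "continuous_map T euclidean \<phi>" if "\<phi> \<in> \<Union>(coeffs ` A)" for \<phi> using cont that A(1) by blast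
      show "\<exists>q\<in>Q. agree (\<Union>(coeffs ` A)) x q" if "x \<in> C" for x
        using that C(2) unfolding D_def saturated_subgroup_def by blast
      show "(\<lambda>g. u g (fst p) (snd p)) \<in> \<Union>(coeffs ` A)" if "u \<in> {u. (n, u) \<in> A}" "p \<in> {..<n} \<times> {..<n}" for u p
      proof (rule UN_I[of "(n, u)"])
        show "(\<lambda>g. u g (fst p) (snd p)) \<in> coeffs (n, u)"
          unfolding coeffs.simps
          by (intro CollectI exI[of _ "fst p"] exI[of _ "snd p"]) (use that in \<open>simp add: mem_Times_iff\<close>)
      qed (use that in simp)
    qed simp
    then obtain u v where uv: "(n, u) \<in> A" "(n, v) \<in> A" "u \<noteq> v"
        "\<And>x i j. \<lbrakk>x \<in> C; i < n; j < n\<rbrakk> \<Longrightarrow> cmod (u x i j - v x i j) < e"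
      by auto
    have "coeff_orth G (n, u) (n, v)" using \<M>(2) uv(1-3) A(1) unfolding pairwise_def by blast
    then show ?thesis using uv Am by (intro exI[of _ u] exI[of _ v]) (auto simp: mrep_set_def)
  qed
  show ?thesis
    by (intro exI[of _ D] exI[of _ n] conjI allI impI D Dd, elim conjE) (rule pairs)
qed

end


section \<open>Almost fixed vectors and irreducible subrepresentations\<close>

text \<open>Passing from an invariant subspace to an invariant summand lowers the dimension and loses at
  most a factor of two, since one of the two components of a vector has at least half its norm.\<close>

lemma (in fun_ip) almost_fixed_minimal:
  assumes act: "\<And>x f. \<lbrakk>x \<in> X; f \<in> S\<rbrakk> \<Longrightarrow> act x f \<in> S"
    and act_add: "\<And>x f g. \<lbrakk>x \<in> X; f \<in> S; g \<in> S\<rbrakk> \<Longrightarrow> act x (\<lambda>t. f t + g t) = (\<lambda>t. act x f t + act x g t)"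
    and adj: "\<And>x. x \<in> X \<Longrightarrow> \<exists>y\<in>X. \<forall>f\<in>S. \<forall>g\<in>S. ip (act x f) g = ip f (act y g)"
    and onb0: "onb N e0 S" and v0: "v0 \<in> S" "v0 \<noteq> (\<lambda>_. 0)" and C: "C \<subseteq> X" and \<delta>: "\<delta> \<ge> 0"
    and near: "\<And>x. x \<in> C \<Longrightarrow> nrm (\<lambda>t. act x v0 t - v0 t) \<le> \<delta> * nrm v0"
  shows "\<exists>E k e v. csub E \<and> E \<subseteq> S \<and> (\<forall>x\<in>X. act x ` E \<subseteq> E) \<and> onb k e E \<and> v \<in> E \<and> v \<noteq> (\<lambda>_. 0) \<and>
    (\<forall>x\<in>C. nrm (\<lambda>t. act x v t - v t) \<le> 2 ^ N * \<delta> * nrm v) \<and>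
    (\<forall>F. csub F \<and> F \<subseteq> E \<and> (\<forall>x\<in>X. act x ` F \<subseteq> F) \<longrightarrow> F = {\<lambda>_. 0} \<or> F = E)"
proof -
  \<comment> \<open>The constant doubles at most once for each drop in the dimension
    \<open>k\<close>, whence \<open>2 ^ (N - k)\<close>; the least possible \<open>k\<close> yields
    the minimal subspace.\<close>
  define good where "good k E v \<longleftrightarrow> k \<le> N \<and> csub E \<and> E \<subseteq> S \<and> (\<forall>x\<in>X. act x ` E \<subseteq> E) \<and> (\<exists>e. onb k e E) \<and>
    v \<in> E \<and> v \<noteq> (\<lambda>_. 0) \<and> (\<forall>x\<in>C. nrm (\<lambda>t. act x v t - v t) \<le> 2 ^ (N - k) * \<delta> * nrm v)" for k E v
  have "good N S v0"
    unfolding good_def using csub_S act onb0 v0 near by auto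
  then have "\<exists>k. \<exists>E v. good k E v" by blast
  then obtain k where k: "\<exists>E v. good k E v" and min: "\<And>m. m < k \<Longrightarrow> \<not> (\<exists>E v. good m E v)"
    using exists_least_iff[of "\<lambda>k. \<exists>E v. good k E v"] by blast
  then obtain E v where "good k E v" by blast
  then have kN: "k \<le> N" and E: "csub E" "E \<subseteq> S" and inv: "\<And>x f. \<lbrakk>x \<in> X; f \<in> E\<rbrakk> \<Longrightarrow> act x f \<in> E"
    and ex: "\<exists>e. onb k e E" and v: "v \<in> E" "v \<noteq> (\<lambda>_. 0)"
    and vn: "\<And>x. x \<in> C \<Longrightarrow> nrm (\<lambda>t. act x v t - v t) \<le> 2 ^ (N - k) * \<delta> * nrm v"
    unfolding good_def by auto
  obtain e where e: "onb k e E" using ex by blast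
  have vS: "v \<in> S" using v E by blast
  have "F = {\<lambda>_. 0} \<or> F = E" if F: "csub F" "F \<subseteq> E" "\<forall>x\<in>X. act x ` F \<subseteq> F" for F
  proof (rule ccontr)
    assume "\<not> ?thesis"
    then have ne: "F \<noteq> {\<lambda>_. 0}" and FE: "F \<subset> E" using F by auto
    have FS: "F \<subseteq> S" using F E by auto
    have F_inv: "act x f \<in> F" if "x \<in> X" "f \<in> F" for x f using F(3) that by blast
    obtain m d where d: "m < k" "onb m d F" using onb_subspace[OF e E(2,1) F(1) FE] by blast
    have dd: "ons m d" "\<And>i. i < m \<Longrightarrow> d i \<in> F" using d(2) by (auto simp: onb_def)
    \<comment> \<open>The orthogonal complement of \<open>F\<close> in \<open>E\<close>, invariant
      because each action has its adjoint among the actions of \<open>X\<close>.\<close>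
    define P where "P = {f \<in> E. \<forall>g\<in>F. ip f g = 0}"
    have P: "csub P"
      unfolding csub_def P_def
      using csub_zero[OF E(1)] csub_add[OF E(1)] csub_scale[OF E(1)] E(2) FS
      by (auto simp: ip_add ip_scale ip_zero subset_iff)
    have P_inv: "act x f \<in> P" if xf: "x \<in> X" "f \<in> P" for x f
    proof -
      obtain y where "y \<in> X" "\<forall>f\<in>S. \<forall>g\<in>S. ip (act x f) g = ip f (act y g)" using adj[OF xf(1)] by blast
      then show ?thesis using xf inv F_inv FS E(2) by (auto simp: P_def subset_iff)
    qed
    have "P \<subset> E"
    proof -
      obtain g where g: "g \<in> F" "g \<noteq> (\<lambda>_. 0)" using ne csub_zero[OF F(1)] by blast
      then have "g \<notin> P" using ip_definite[of g] FS by (auto simp: P_def)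
      then show ?thesis using g FE by (auto simp: P_def)
    qed
    then obtain m' d' where d': "m' < k" "onb m' d' P" using onb_subspace[OF e E(2,1) P] by blast
    define v1 where "v1 = proj m d v"
    define v2 where "v2 = (\<lambda>t. v t - v1 t)"
    have v1: "v1 \<in> F" unfolding v1_def proj_def using dd(2) by (intro csub_sum[OF F(1)]) auto
    have v2E: "v2 \<in> E" unfolding v2_def using v v1 F(2) by (intro csub_diff[OF E(1)]) auto
    have "ip v2 g = 0" if "g \<in> F" for g
    proof -
      have "g = proj m d g" using d(2) that by (simp add: onb_def)
      then show ?thesis using ip_diff_proj_proj[OF dd(1) vS, of g] by (simp add: v2_def v1_def)
    qed
    then have v2: "v2 \<in> P" using v2E by (simp add: P_def)
    have orth: "Re (ip (\<lambda>t. a t + b t) (\<lambda>t. a t + b t)) = Re (ip a a) + Re (ip b b)" if "a \<in> F" "b \<in> P" for a b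
    proof -
      have S: "a \<in> S" "b \<in> S" using that FS E(2) by (auto simp: P_def)
      have "ip b a = 0" "ip a b = 0" using that ip_cnj[OF S] by (auto simp: P_def)
      then show ?thesis using S csub_add[OF csub_S S] by (simp add: ip_add ip_add_right)
    qed
    have vv: "v = (\<lambda>t. v1 t + v2 t)" by (simp add: v2_def)
    have Sv: "v1 \<in> S" "v2 \<in> S" using v1 v2 FS E(2) by (auto simp: P_def)
    have sq: "(nrm v)\<^sup>2 = (nrm v1)\<^sup>2 + (nrm v2)\<^sup>2"
      using orth[OF v1 v2] ip_nonneg[OF vS] ip_nonneg[OF Sv(1)] ip_nonneg[OF Sv(2)] by (simp add: vv[symmetric])
    \<comment> \<open>The displacement of \<open>v\<close> is the orthogonal sum of the displacement
      of \<open>v1\<close> in \<open>F\<close> and that of \<open>v2\<close> in \<open>P\<close>, so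
      neither is longer than it.\<close>
    have part: "nrm (\<lambda>t. act x v1 t - v1 t) \<le> nrm (\<lambda>t. act x v t - v t)"
      "nrm (\<lambda>t. act x v2 t - v2 t) \<le> nrm (\<lambda>t. act x v t - v t)" if x: "x \<in> C" for x
    proof -
      have xX: "x \<in> X" using x C by auto
      define a b where "a = (\<lambda>t. act x v1 t - v1 t)" and "b = (\<lambda>t. act x v2 t - v2 t)"
      have ab: "a \<in> F" "b \<in> P" unfolding a_def b_def
        using csub_diff[OF F(1) F_inv[OF xX v1] v1] csub_diff[OF P P_inv[OF xX v2] v2] by auto
      then have "a \<in> S" "b \<in> S" using FS E(2) by (auto simp: P_def)
      have "act x v = (\<lambda>t. act x v1 t + act x v2 t)"
        using act_add[OF xX Sv] vv[symmetric] by simp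
      then have "(\<lambda>t. act x v t - v t) = (\<lambda>t. a t + b t)"
        by (simp add: a_def b_def v2_def fun_eq_iff)
      then show "nrm (\<lambda>t. act x v1 t - v1 t) \<le> nrm (\<lambda>t. act x v t - v t)"
        "nrm (\<lambda>t. act x v2 t - v2 t) \<le> nrm (\<lambda>t. act x v t - v t)"
        using orth[OF ab] ip_nonneg[OF \<open>a \<in> S\<close>] ip_nonneg[OF \<open>b \<in> S\<close>]
        by (simp_all flip: a_def b_def)
    qed
    have step: "2 ^ (N - k) * \<delta> * nrm v \<le> 2 ^ (N - j) * \<delta> * nrm w" if "j < k" "nrm v \<le> 2 * nrm w" for j w
    proof -
      have "(2::real) ^ (N - k) * 2 \<le> 2 ^ (N - j)"
      proof -
        have "Suc (N - k) \<le> N - j" using that(1) kN by arith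
        from power_increasing[OF this, of "2::real"] show ?thesis by (simp add: mult.commute)
      qed
      have "2 ^ (N - k) * \<delta> * nrm v \<le> 2 ^ (N - k) * \<delta> * (2 * nrm w)"
        using that(2) \<delta> by (intro mult_left_mono) auto
      also have "\<dots> = (2 ^ (N - k) * 2) * (\<delta> * nrm w)" by simp
      also have "\<dots> \<le> 2 ^ (N - j) * (\<delta> * nrm w)"
      proof (rule mult_right_mono)
        have "0 \<le> nrm v" using ip_nonneg[OF vS] by simp
        then show "0 \<le> \<delta> * nrm w" using that(2) \<delta> by (intro mult_nonneg_nonneg) linarith+
      qed fact
      finally show ?thesis by simp
    qed
    have nv: "nrm v > 0" using nrm_eq_0[OF vS] v ip_nonneg[OF vS] by (simp add: less_le)
    \<comment> \<open>By \<open>sq\<close> the squared norms of \<open>v1\<close> and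
      \<open>v2\<close> add up to that of \<open>v\<close>; with both norms below half of
      \<open>nrm v\<close> they would give less than half of it.\<close>
    have "nrm v \<le> 2 * nrm v1 \<or> nrm v \<le> 2 * nrm v2"
    proof (rule ccontr)
      assume "\<not> ?thesis"
      then have "2 * nrm v1 < nrm v" "2 * nrm v2 < nrm v" by auto
      moreover have "4 * a\<^sup>2 < b\<^sup>2" if "0 \<le> a" "2 * a < b" for a b :: real
        using power_strict_mono[OF that(2), of 2] that(1) by (simp add: power_mult_distrib)
      ultimately have "4 * (nrm v1)\<^sup>2 < (nrm v)\<^sup>2" "4 * (nrm v2)\<^sup>2 < (nrm v)\<^sup>2"
        using ip_nonneg[OF Sv(1)] ip_nonneg[OF Sv(2)] real_sqrt_ge_zero by blast+
      then show False using sq nv zero_le_power2[of "nrm v"] by linarith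
    qed
    then show False
    proof
      assume le: "nrm v \<le> 2 * nrm v1"
      then have "v1 \<noteq> (\<lambda>_. 0)" using nv nrm_eq_0[OF Sv(1)] by auto
      then have "good m F v1"
        unfolding good_def using d kN F FS v1 order_trans[OF part(1) order_trans[OF vn step[OF d(1) le]]] by auto
      then show False using min d(1) by blast
    next
      assume le: "nrm v \<le> 2 * nrm v2"
      then have "v2 \<noteq> (\<lambda>_. 0)" using nv nrm_eq_0[OF Sv(2)] by auto
      moreover have "P \<subseteq> S" using E(2) by (auto simp: P_def)
      ultimately have "good m' P v2"
        unfolding good_def using d' kN P P_inv v2 order_trans[OF part(2) order_trans[OF vn step[OF d'(1) le]]]
        by auto
      then show False using min d'(1) by blast
    qed
  qed
  moreover have "nrm (\<lambda>t. act x v t - v t) \<le> 2 ^ N * \<delta> * nrm v" if "x \<in> C" for x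
  proof -
    have "2 ^ (N - k) * \<delta> * nrm v \<le> 2 ^ N * \<delta> * nrm v"
      using \<delta> ip_nonneg[OF vS] by (intro mult_right_mono power_increasing) auto
    then show ?thesis using vn[OF that] by linarith
  qed
  ultimately show ?thesis using E inv e v by (intro exI[of _ E] exI[of _ k] exI[of _ e] exI[of _ v]) auto
qed


section \<open>Coordinate spaces and subrepresentations\<close>

definition CI :: "'i set \<Rightarrow> ('i \<Rightarrow> complex) set" where
  "CI I = {f. \<forall>i. i \<notin> I \<longrightarrow> f i = 0}"

definition ipI :: "'i set \<Rightarrow> ('i \<Rightarrow> complex) \<Rightarrow> ('i \<Rightarrow> complex) \<Rightarrow> complex" where
  "ipI I f g = (\<Sum>i\<in>I. f i * cnj (g i))"

lemma ipI_self: "ipI I f f = of_real (\<Sum>i\<in>I. (cmod (f i))\<^sup>2)"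
  unfolding ipI_def of_real_sum by (intro sum.cong) (auto simp: complex_norm_square simp del: of_real_power)

lemma fun_ip_CI: "finite I \<Longrightarrow> fun_ip (CI I) (ipI I)"
proof
  assume I: "finite I"
  show "csub (CI I)" by (auto simp: csub_def CI_def)
  fix f g h c
  show "ipI I (\<lambda>x. f x + g x) h = ipI I f h + ipI I g h" by (simp add: ipI_def distrib_right sum.distrib)
  show "ipI I (\<lambda>x. c * f x) h = c * ipI I f h" by (simp add: ipI_def sum_distrib_left mult.assoc)
  show "ipI I f g = cnj (ipI I g f)" by (simp add: ipI_def mult.commute)
  show "0 \<le> Re (ipI I f f)" by (simp add: ipI_self sum_nonneg)
  assume f: "f \<in> CI I" and "ipI I f f = 0"
  then have "(\<Sum>i\<in>I. (cmod (f i))\<^sup>2) = 0" unfolding ipI_self by (simp only: of_real_eq_0_iff)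
  then have "\<forall>i\<in>I. f i = 0" using I by (subst (asm) sum_nonneg_eq_0_iff) auto
  then show "f = (\<lambda>_. 0)" using f by (auto simp: CI_def)
qed

text \<open>Bessel's inequality for the unit vectors \<open>\<delta> i\<close>, summed over
  \<open>I\<close>, bounds the length of orthonormal systems by \<open>card I\<close>, and
  \<open>onb_exists\<close> does the rest.\<close>

lemma CI_onb:
  assumes I: "finite I"
  shows "\<exists>n e. fun_ip.onb (CI I) (ipI I) n e (CI I)"
proof -
  interpret fun_ip "CI I" "ipI I" by (rule fun_ip_CI[OF I])
  have "m \<le> card I" if b: "ons m b" "\<forall>k<m. b k \<in> CI I" for m b
  proof -
    define \<delta> where "\<delta> i = (\<lambda>j. if j = i then 1 else 0 :: complex)" for i :: 'a
    have \<delta>: "\<delta> i \<in> CI I" "ipI I (\<delta> i) (\<delta> i) = 1" "\<And>f. ipI I (\<delta> i) f = cnj (f i)" if "i \<in> I" for i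
      using that I by (auto simp: \<delta>_def CI_def ipI_def if_distrib[of "\<lambda>x. x * _"] cong: if_cong)
    have "real m = (\<Sum>k<m. Re (ipI I (b k) (b k)))" using b by (simp add: ons_def)
    also have "\<dots> = (\<Sum>k<m. \<Sum>i\<in>I. (cmod (ipI I (\<delta> i) (b k)))\<^sup>2)"
      using \<delta>(3) by (intro sum.cong) (auto simp: ipI_self)
    also have "\<dots> = (\<Sum>i\<in>I. \<Sum>k<m. (cmod (ipI I (\<delta> i) (b k)))\<^sup>2)" by (rule sum.swap)
    also have "\<dots> \<le> (\<Sum>i\<in>I. Re (ipI I (\<delta> i) (\<delta> i)))"
      using \<delta>(1) by (intro sum_mono bessel[OF b(1)])
    also have "\<dots> = real (card I)" using \<delta>(2) by simp
    finally show ?thesis by simp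
  qed
  then show ?thesis using onb_exists[OF csub_S] by blast
qed

definition act :: "'i set \<Rightarrow> ('a \<Rightarrow> 'i \<Rightarrow> 'i \<Rightarrow> complex) \<Rightarrow> 'a \<Rightarrow> ('i \<Rightarrow> complex) \<Rightarrow> 'i \<Rightarrow> complex" where
  "act I w g f = (\<lambda>i. if i \<in> I then \<Sum>j\<in>I. w g i j * f j else 0)"

lemma act_CI: "act I w g f \<in> CI I"
  by (simp add: act_def CI_def)

lemma act_linear:
  "act I w g (\<lambda>t. f t + h t) = (\<lambda>t. act I w g f t + act I w g h t)"
  "act I w g (\<lambda>t. c * f t) = (\<lambda>t. c * act I w g f t)"
  by (auto simp: act_def distrib_left sum.distrib sum_distrib_left mult_ac)

context compact_group
begin

lemma act_one:
  assumes w: "mrep G T I w" and f: "f \<in> CI I"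
  shows "act I w \<one> f = f"
proof
  fix i
  show "act I w \<one> f i = f i"
  proof (cases "i \<in> I")
    case True
    have "(\<Sum>j\<in>I. w \<one> i j * f j) = (\<Sum>j\<in>I. if j = i then f j else 0)"
      using mrepD(4)[OF w True] by (intro sum.cong) auto
    then show ?thesis using True mrepD(1)[OF w] by (simp add: act_def)
  qed (use f in \<open>simp add: act_def CI_def\<close>)
qed

lemma act_mult:
  assumes w: "mrep G T I w" and gh: "g \<in> carrier G" "h \<in> carrier G"
  shows "act I w (g \<otimes> h) f = act I w g (act I w h f)"
proof
  fix i
  show "act I w (g \<otimes> h) f i = act I w g (act I w h f) i"
  proof (cases "i \<in> I")
    case True
    have "(\<Sum>j\<in>I. w (g \<otimes> h) i j * f j) = (\<Sum>j\<in>I. \<Sum>k\<in>I. w g i k * (w h k j * f j))"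
      using mrepD(3)[OF w gh True] by (intro sum.cong refl) (simp add: sum_distrib_right mult.assoc)
    also have "\<dots> = (\<Sum>k\<in>I. \<Sum>j\<in>I. w g i k * (w h k j * f j))" by (rule sum.swap)
    finally show ?thesis using True by (simp add: act_def sum_distrib_left)
  qed (simp add: act_def)
qed

lemma act_adjoint:
  assumes w: "mrep G T I w" and g: "g \<in> carrier G"
  shows "ipI I (act I w g f) h = ipI I f (act I w (inv g) h)"
proof -
  have "ipI I (act I w g f) h = (\<Sum>i\<in>I. \<Sum>j\<in>I. f j * (w g i j * cnj (h i)))"
    by (simp add: ipI_def act_def sum_distrib_left sum_distrib_right mult_ac)
  also have "\<dots> = (\<Sum>j\<in>I. \<Sum>i\<in>I. f j * (w g i j * cnj (h i)))" by (rule sum.swap)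
  also have "\<dots> = ipI I f (act I w (inv g) h)"
    using mrepD(5)[OF w g] by (simp add: ipI_def act_def sum_distrib_left)
  finally show ?thesis .
qed

lemma act_isometry:
  assumes w: "mrep G T I w" and g: "g \<in> carrier G" and h: "h \<in> CI I"
  shows "ipI I (act I w g f) (act I w g h) = ipI I f h"
  using act_mult[OF w inv_closed[OF g] g, of h] g h by (simp add: act_adjoint[OF w g] act_one[OF w])

lemma act_continuous:
  assumes w: "mrep G T I w" and i: "i \<in> I"
  shows "continuous_map T euclidean (\<lambda>g. act I w g f i)"
  unfolding act_def using i mrepD(1,2)[OF w]
  by (auto intro!: continuous_map_sum continuous_map_complex_mult)

text \<open>Orbit maps are continuous because the distance is the root of a finite sum of continuous
  functions of \<open>g\<close>. Completeness comes from the finite orthonormal basis.\<close>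

lemma subrep:
  assumes w: "mrep G T I w" and D: "subgroup D G"
    and E: "csub E" "E \<subseteq> CI I" and inv: "\<And>g f. \<lbrakk>g \<in> D; f \<in> E\<rbrakk> \<Longrightarrow> act I w g f \<in> E"
    and onb: "fun_ip.onb (CI I) (ipI I) n e E"
  shows "unitary_rep (G\<lparr>carrier := D\<rparr>) (subtopology T D) (hilb E (ipI I)) (\<lambda>g. restrict (act I w g) E)"
proof -
  let ?V = "hilb E (ipI I)" and ?\<rho> = "\<lambda>g. restrict (act I w g) E"
  have DG: "D \<subseteq> carrier G" using D by (rule subgroup.subset)
  interpret S: fun_ip "CI I" "ipI I" by (rule fun_ip_CI[OF mrepD(1)[OF w]])
  interpret E: fun_ip E "ipI I" by (rule S.fun_ip_sub[OF E])
  have ons_eq: "E.ons n e"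
    using onb unfolding S.onb_def S.ons_def E.ons_def by blast
  then have "E.onb n e E"
    using onb unfolding S.onb_def E.onb_def S.proj_def E.proj_def by blast
  then have V: "hilbert_space ?V" by (rule E.hilbert_space_hilb)
  have unit: "?\<rho> g \<in> carrier (unitary_group ?V)" if g: "g \<in> D" for g
  proof -
    have gG: "g \<in> carrier G" "inv g \<in> D" using g DG subgroup.m_inv_closed[OF D g] by auto
    have "act I w (inv g) (act I w g f) = f" "act I w g (act I w (inv g) f) = f" if "f \<in> E" for f
      using that E(2) gG act_mult[OF w, of "inv g" g f] act_mult[OF w, of g "inv g" f] act_one[OF w, of f]
      by auto
    then have "bij_betw (?\<rho> g) E E"
      using inv g gG by (intro bij_betw_byWitness[where f' = "act I w (inv g)"]) auto
    moreover have "ipI I (act I w g f) (act I w g h) = ipI I f h" if "f \<in> E" "h \<in> E" for f h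
      using that E(2) gG by (intro act_isometry[OF w]) auto
    ultimately have "unitary_iso ?V ?V (?\<rho> g)"
      unfolding unitary_iso_def
      using csub_add[OF E(1)] csub_scale[OF E(1)] by (simp add: act_linear)
    then show ?thesis by (simp add: carrier_unitary_group)
  qed
  have "?\<rho> \<in> hom (G\<lparr>carrier := D\<rparr>) (unitary_group ?V)"
  proof (rule homI)
    fix g h assume "g \<in> carrier (G\<lparr>carrier := D\<rparr>)" "h \<in> carrier (G\<lparr>carrier := D\<rparr>)"
    then have gh: "g \<in> D" "h \<in> D" by auto
    have "act I w (g \<otimes> h) f = act I w g (act I w h f)" for f
      using gh DG by (intro act_mult[OF w]) auto
    then show "?\<rho> (g \<otimes>\<^bsub>G\<lparr>carrier := D\<rparr>\<^esub> h) = ?\<rho> g \<otimes>\<^bsub>unitary_group ?V\<^esub> ?\<rho> h"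
      using gh inv unit[OF gh(1)] unit[OF gh(2)]
      by (subst mult_unitary_group) (auto simp: compose_def fun_eq_iff restrict_def)
  qed (use unit in simp)
  moreover have "continuous_map (subtopology T D) (norm_topology ?V) (\<lambda>g. ?\<rho> g f)" if f: "f \<in> E" for f
  proof -
    interpret M: Metric_space E "hdist ?V" using E.V.Metric_space_hdist by simp
    have top: "topspace (subtopology T D) = D" using DG topspace_eq by auto
    have fD: "act I w g f \<in> E" if "g \<in> D" for g using inv f that by blast
    have "\<exists>U. openin (subtopology T D) U \<and> g0 \<in> U \<and> (\<forall>g\<in>U. act I w g f \<in> M.mball (act I w g0 f) \<epsilon>)"
      if g0: "g0 \<in> D" and \<epsilon>: "\<epsilon> > 0" for g0 \<epsilon>
    proof -
      define q where "q g = (\<Sum>i\<in>I. (cmod (act I w g0 f i - act I w g f i))\<^sup>2)" for g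
      have "continuous_map T euclideanreal q"
        unfolding q_def[abs_def]
        by (intro continuous_map_sum mrepD(1)[OF w] continuous_map_real_pow continuous_map_norm
            continuous_map_diff act_continuous[OF w]) auto
      then have "continuous_map (subtopology T D) euclideanreal q"
        by (rule continuous_map_from_subtopology)
      from openin_continuous_map_preimage[OF this, of "{..<\<epsilon>\<^sup>2}"]
      have "openin (subtopology T D) {g \<in> D. q g < \<epsilon>\<^sup>2}" by (simp add: top del: topspace_subtopology)
      moreover have "act I w g f \<in> M.mball (act I w g0 f) \<epsilon>" if "g \<in> D" "q g < \<epsilon>\<^sup>2" for g
      proof -
        have "hdist ?V (act I w g0 f) (act I w g f) = sqrt (q g)"
          using fD g0 that by (simp add: E.hdist_hilb ipI_self q_def)
        also have "\<dots> < \<epsilon>" using that \<epsilon> by (simp add: real_less_lsqrt)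
        finally show ?thesis using fD g0 that by (simp add: M.in_mball)
      qed
      moreover have "q g0 < \<epsilon>\<^sup>2" using \<epsilon> by (simp add: q_def)
      ultimately show ?thesis using g0 by (intro exI[of _ "{g \<in> D. q g < \<epsilon>\<^sup>2}"]) auto
    qed
    then have "continuous_map (subtopology T D) M.mtopology (\<lambda>g. act I w g f)"
      unfolding M.continuous_map_to_metric top by blast
    then show ?thesis using f by (simp add: norm_topology_def)
  qed
  ultimately show ?thesis
    using V unit by (simp add: unitary_rep_iff)
qed

text \<open>\<open>S.almost_fixed_minimal\<close> is applied with acting set \<open>D\<close>, where
  adjoints are given by inverses. A closed invariant subspace is in particular an invariant
  \<open>csub\<close> in \<open>E\<close>, so minimality gives irreducibility.\<close>

lemma almost_fixed_irreducible:
  assumes w: "mrep G T I w" and D: "subgroup D G"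
    and onb0: "fun_ip.onb (CI I) (ipI I) N e0 (CI I)"
    and v0: "v0 \<in> CI I" "v0 \<noteq> (\<lambda>_. 0)" and C: "C \<subseteq> D" and \<delta>: "\<delta> \<ge> 0"
    and near: "\<And>x. x \<in> C \<Longrightarrow> fun_ip.nrm (ipI I) (\<lambda>t. act I w x v0 t - v0 t) \<le> \<delta> * fun_ip.nrm (ipI I) v0"
  shows "\<exists>E v. E \<subseteq> CI I \<and> csub E \<and> v \<in> E \<and> v \<noteq> (\<lambda>_. 0) \<and>
    (\<forall>x\<in>C. fun_ip.nrm (ipI I) (\<lambda>t. act I w x v t - v t) \<le> 2 ^ N * \<delta> * fun_ip.nrm (ipI I) v) \<and>
    irreducible_rep (G\<lparr>carrier := D\<rparr>) (subtopology T D) (hilb E (ipI I)) (\<lambda>g. restrict (act I w g) E)"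
proof -
  interpret S: fun_ip "CI I" "ipI I" by (rule fun_ip_CI[OF mrepD(1)[OF w]])
  have DG: "D \<subseteq> carrier G" using D by (rule subgroup.subset)
  have adj: "\<exists>y\<in>D. \<forall>f\<in>CI I. \<forall>g\<in>CI I. ipI I (act I w x f) g = ipI I f (act I w y g)" if "x \<in> D" for x
    using that DG act_adjoint[OF w] subgroup.m_inv_closed[OF D that] by (intro bexI[of _ "inv x"]) auto
  have "\<exists>E k e v. csub E \<and> E \<subseteq> CI I \<and> (\<forall>x\<in>D. act I w x ` E \<subseteq> E) \<and> S.onb k e E \<and> v \<in> E \<and> v \<noteq> (\<lambda>_. 0) \<and>
      (\<forall>x\<in>C. S.nrm (\<lambda>t. act I w x v t - v t) \<le> 2 ^ N * \<delta> * S.nrm v) \<and>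
      (\<forall>F. csub F \<and> F \<subseteq> E \<and> (\<forall>x\<in>D. act I w x ` F \<subseteq> F) \<longrightarrow> F = {\<lambda>_. 0} \<or> F = E)"
    by (rule S.almost_fixed_minimal[OF _ _ adj onb0 v0 C \<delta> near]) (simp_all add: act_CI act_linear(1))
  then obtain E k e v where E: "csub E" "E \<subseteq> CI I" "\<forall>x\<in>D. act I w x ` E \<subseteq> E" "S.onb k e E" "v \<in> E" "v \<noteq> (\<lambda>_. 0)"
      "\<forall>x\<in>C. S.nrm (\<lambda>t. act I w x v t - v t) \<le> 2 ^ N * \<delta> * S.nrm v"
      and irr: "\<forall>F. csub F \<and> F \<subseteq> E \<and> (\<forall>x\<in>D. act I w x ` F \<subseteq> F) \<longrightarrow> F = {\<lambda>_. 0} \<or> F = E"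
    by (elim exE conjE) (rule that)
  let ?V = "hilb E (ipI I)"
  interpret E: fun_ip E "ipI I" by (rule S.fun_ip_sub[OF E(1,2)])
  have rep: "unitary_rep (G\<lparr>carrier := D\<rparr>) (subtopology T D) ?V (\<lambda>g. restrict (act I w g) E)"
    using E(3) by (intro subrep[OF w D E(1,2) _ E(4)]) auto
  have "F = {\<lambda>_. 0} \<or> F = E" if F: "closed_invariant_subspace (G\<lparr>carrier := D\<rparr>) ?V (\<lambda>g. restrict (act I w g) E) F" for F
  proof -
    have sub: "submodule F complex_ring ?V" and Finv: "\<And>g. g \<in> D \<Longrightarrow> restrict (act I w g) E ` F \<subseteq> F"
      using F by (auto simp: closed_invariant_subspace_def)
    note sE = E.V.submoduleE[OF sub]
    have FE: "F \<subseteq> E" using sE(1) by simp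
    have sc: "(\<lambda>x. c * f x) \<in> F" if "f \<in> F" for f c using sE(4)[of c f] that by simp
    obtain f where "f \<in> F" using sE(2) by blast
    then have "(\<lambda>_. 0) \<in> F" using sc[of f 0] by simp
    then have "csub F" unfolding csub_def using sE(5) sc by simp
    moreover have "act I w g ` F \<subseteq> F" if "g \<in> D" for g
      using Finv[OF that] FE by auto
    ultimately show ?thesis using irr FE by blast
  qed
  then have "irreducible_rep (G\<lparr>carrier := D\<rparr>) (subtopology T D) ?V (\<lambda>g. restrict (act I w g) E)"
    unfolding irreducible_rep_def using rep E(5,6) by auto
  then show ?thesis using E by (intro exI[of _ E] exI[of _ v]) simp
qed

end


section \<open>The dual of the dense subgroup\<close>

context compact_group
begin

text \<open>The map taking a matrix \<open>A\<close> to \<open>u(g) A\<close> times the adjoint of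
  \<open>v(g)\<close>, written in matrix units; its entries are the products occurring in
  \<open>coeff_orth\<close>.\<close>

definition tensor :: "('a \<Rightarrow> 'i \<Rightarrow> 'i \<Rightarrow> complex) \<Rightarrow> ('a \<Rightarrow> 'j \<Rightarrow> 'j \<Rightarrow> complex) \<Rightarrow>
    'a \<Rightarrow> 'i \<times> 'j \<Rightarrow> 'i \<times> 'j \<Rightarrow> complex" where
  "tensor u v g p q = u g (fst p) (fst q) * cnj (v g (snd p) (snd q))"

lemma mrep_tensor:
  assumes u: "mrep G T I u" and v: "mrep G T J v"
  shows "mrep G T (I \<times> J) (tensor u v)"
  unfolding mrep_def
proof (intro conjI ballI)
  show "finite (I \<times> J)" using mrepD(1)[OF u] mrepD(1)[OF v] by simp
  fix p q assume p: "p \<in> I \<times> J" and q: "q \<in> I \<times> J"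
  show "continuous_map T euclidean (\<lambda>g. tensor u v g p q)"
    unfolding tensor_def using p q mrepD(2)[OF u] mrepD(2)[OF v] by (intro cip_cont) auto
  show "tensor u v \<one> p q = (if p = q then 1 else 0)"
    using p q mrepD(4)[OF u] mrepD(4)[OF v] by (auto simp: tensor_def prod_eq_iff)
  fix g assume g: "g \<in> carrier G"
  show "tensor u v (inv g) p q = cnj (tensor u v g q p)"
    using p q mrepD(5)[OF u g] mrepD(5)[OF v g] by (auto simp: tensor_def)
next
  fix g h p q assume g: "g \<in> carrier G" and h: "h \<in> carrier G" and p: "p \<in> I \<times> J" and q: "q \<in> I \<times> J"
  have "tensor u v (g \<otimes> h) p q = (\<Sum>k\<in>I. u g (fst p) k * u h k (fst q)) *
      (\<Sum>l\<in>J. cnj (v g (snd p) l) * cnj (v h l (snd q)))"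
    using mrepD(3)[OF u g h, of "fst p" "fst q"] mrepD(3)[OF v g h, of "snd p" "snd q"] p q
    by (auto simp: tensor_def)
  also have "\<dots> = (\<Sum>r\<in>I \<times> J. tensor u v g p r * tensor u v h r q)"
    unfolding sum_product sum.cartesian_product
    by (intro sum.cong refl) (auto simp: tensor_def mult_ac)
  finally show "tensor u v (g \<otimes> h) p q = (\<Sum>r\<in>I \<times> J. tensor u v g p r * tensor u v h r q)" .
qed

text \<open>A vector fixed by the dense set \<open>D\<close> is fixed by the whole group, its orbit
  map being continuous. Averaging the fixed-point equation then expresses \<open>f i\<close> through
  the vanishing means of the entries.\<close>

lemma mean_eq_zero_imp_no_fixed:
  assumes w: "mrep G T I w" and orth: "\<And>i j. \<lbrakk>i \<in> I; j \<in> I\<rbrakk> \<Longrightarrow> mean G (\<lambda>g. w g i j) = 0"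
    and D: "T closure_of D = topspace T"
    and f: "f \<in> CI I" "\<And>g. g \<in> D \<Longrightarrow> act I w g f = f"
  shows "f = (\<lambda>_. 0)"
proof
  fix i
  show "f i = 0"
  proof (cases "i \<in> I")
    case i: True
    have cont: "continuous_map T euclidean (\<lambda>g. act I w g f i)" by (rule act_continuous[OF w i])
    have "closedin T {g \<in> topspace T. act I w g f i \<in> {f i}}"
      by (rule closedin_continuous_map_preimage[OF cont]) simp
    moreover have "topspace T \<inter> D \<subseteq> {g \<in> topspace T. act I w g f i \<in> {f i}}" using f(2) by auto
    ultimately have "T closure_of (topspace T \<inter> D) \<subseteq> {g \<in> topspace T. act I w g f i \<in> {f i}}"
      by (intro closure_of_minimal)
    then have "topspace T \<subseteq> {g \<in> topspace T. act I w g f i \<in> {f i}}"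
      using D by (metis closure_of_restrict)
    then have all: "act I w g f i = f i" if "g \<in> carrier G" for g using that topspace_eq by blast
    have "f i = mean G (\<lambda>g. f i)" by simp
    also have "\<dots> = mean G (\<lambda>g. \<Sum>j\<in>I. f j * w g i j)"
      using all i by (intro mean_cong) (simp add: act_def mult.commute)
    also have "\<dots> = (\<Sum>j\<in>I. mean G (\<lambda>g. f j * w g i j))"
      using mrepD(1,2)[OF w] i by (intro mean_sum continuous_map_complex_mult) auto
    also have "\<dots> = (\<Sum>j\<in>I. 0)"
      using mrepD(2)[OF w] i orth by (intro sum.cong refl) (simp add: mean_scale)
    finally show ?thesis by simp
  qed (use f in \<open>simp add: CI_def\<close>)
qed

lemma mrep_row:
  assumes u: "mrep G T I u" and g: "g \<in> carrier G" and ij: "i \<in> I" "j \<in> I"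
  shows "(\<Sum>k\<in>I. u g i k * cnj (u g j k)) = (if i = j then 1 else 0)"
proof -
  have "(\<Sum>k\<in>I. u g i k * cnj (u g j k)) = (\<Sum>k\<in>I. u g i k * u (inv g) k j)"
    using mrepD(5)[OF u g] ij by (intro sum.cong) auto
  also have "\<dots> = u (g \<otimes> inv g) i j" using mrepD(3)[OF u g inv_closed[OF g] ij] by simp
  finally show ?thesis using mrepD(4)[OF u ij] g by simp
qed

lemma mrep_entry_le_1:
  assumes u: "mrep G T I u" and g: "g \<in> carrier G" and ij: "i \<in> I" "j \<in> I"
  shows "cmod (u g i j) \<le> 1"
proof -
  have "complex_of_real (\<Sum>k\<in>I. (cmod (u g i k))\<^sup>2) = 1"
    using mrep_row[OF u g ij(1) ij(1)] unfolding of_real_sum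
    by (simp add: complex_norm_square del: of_real_power)
  then have "(\<Sum>k\<in>I. (cmod (u g i k))\<^sup>2) = 1" by (simp only: of_real_eq_1_iff)
  moreover have "(cmod (u g i j))\<^sup>2 \<le> (\<Sum>k\<in>I. (cmod (u g i k))\<^sup>2)"
    using mrepD(1)[OF u] ij by (intro member_le_sum) auto
  ultimately have "(cmod (u g i j))\<^sup>2 \<le> 1\<^sup>2" by simp
  then show ?thesis by (rule power2_le_imp_le) simp
qed

text \<open>The identity matrix as a vector of the tensor space.\<close>

definition diag :: "nat \<Rightarrow> nat \<times> nat \<Rightarrow> complex" where
  "diag n p = (if fst p < n \<and> snd p = fst p then 1 else 0)"

lemma diag_CI: "diag n \<in> CI ({..<n} \<times> {..<n})"
  by (auto simp: CI_def diag_def)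

lemma diag_nrm: "Re (ipI ({..<n} \<times> {..<n}) (diag n) (diag n)) = real n"
proof -
  have "ipI ({..<n} \<times> {..<n}) (diag n) (diag n) = (\<Sum>i<n. \<Sum>j<n. if j = i then 1 else 0)"
    unfolding ipI_def sum.cartesian_product by (intro sum.cong) (auto simp: diag_def)
  also have "\<dots> = of_nat n" by simp
  finally show ?thesis by simp
qed

text \<open>With the identity written as \<open>v(g)\<close> times its adjoint, the displacement is
  \<open>u(g) - v(g)\<close> times the adjoint of \<open>v(g)\<close>. It has \<open>n * n\<close>
  entries of modulus at most \<open>n * e\<close>, so its norm is at most
  \<open>n * n * e\<close>.\<close>

lemma diag_almost_fixed:
  assumes u: "mrep G T {..<n} u" and v: "mrep G T {..<n} v" and n: "n \<ge> 1"
    and g: "g \<in> carrier G" and close: "\<And>i j. \<lbrakk>i < n; j < n\<rbrakk> \<Longrightarrow> cmod (u g i j - v g i j) < e"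
  defines "I \<equiv> {..<n} \<times> {..<n}"
  shows "fun_ip.nrm (ipI I) (\<lambda>t. act I (tensor u v) g (diag n) t - diag n t) \<le>
    real n * real n * e * fun_ip.nrm (ipI I) (diag n)"
proof -
  interpret S: fun_ip "CI I" "ipI I" by (rule fun_ip_CI) (simp add: I_def)
  have e: "0 \<le> e" using close[of 0 0] n norm_ge_zero by (meson less_le_trans le_less_trans less_imp_le zero_less_one)
  let ?d = "\<lambda>t. act I (tensor u v) g (diag n) t - diag n t"
  have bound: "cmod (?d p) \<le> real n * e" if "p \<in> I" for p
  proof -
    obtain i j where p: "p = (i, j)" "i < n" "j < n" using \<open>p \<in> I\<close> by (auto simp: I_def)
    have "act I (tensor u v) g (diag n) p = (\<Sum>k<n. \<Sum>l<n. if l = k then u g i k * cnj (v g j k) else 0)"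
      using p unfolding act_def I_def sum.cartesian_product
      by (simp, intro sum.cong) (auto simp: tensor_def diag_def)
    also have "\<dots> = (\<Sum>k<n. u g i k * cnj (v g j k))" by simp
    finally have "?d p = (\<Sum>k<n. u g i k * cnj (v g j k)) - (\<Sum>k<n. v g i k * cnj (v g j k))"
      using mrep_row[OF v g, of i j] p by (auto simp: diag_def)
    also have "\<dots> = (\<Sum>k<n. (u g i k - v g i k) * cnj (v g j k))"
      by (simp add: sum_subtractf left_diff_distrib)
    also have "cmod \<dots> \<le> (\<Sum>k<n. e)"
    proof (rule sum_norm_le)
      fix k assume "k \<in> {..<n}"
      then have "cmod (u g i k - v g i k) \<le> e" "cmod (v g j k) \<le> 1"
        using close[of i k] p mrep_entry_le_1[OF v g, of j k] by auto
      then show "cmod ((u g i k - v g i k) * cnj (v g j k)) \<le> e"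
        using mult_mono[of "cmod (u g i k - v g i k)" e "cmod (v g j k)" 1] e by (simp add: norm_mult)
    qed
    finally show ?thesis by simp
  qed
  have "Re (ipI I ?d ?d) = (\<Sum>p\<in>I. (cmod (?d p))\<^sup>2)" by (simp add: ipI_self)
  also have "\<dots> \<le> (\<Sum>p\<in>I. (real n * e)\<^sup>2)" using bound by (intro sum_mono power_mono) auto
  also have "\<dots> = (real n * real n * e)\<^sup>2" by (simp add: I_def power2_eq_square)
  finally have "S.nrm ?d \<le> real n * real n * e" using e by (intro real_le_lsqrt) auto
  \<comment> \<open>The norm of \<open>diag n\<close> is the square root of \<open>n\<close>, hence
    at least 1.\<close>
  also have "\<dots> \<le> real n * real n * e * S.nrm (diag n)"
  proof -
    have "1 \<le> S.nrm (diag n)" using diag_nrm[of n] n by (simp add: I_def)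
    then show ?thesis using e mult_left_mono[of 1 "S.nrm (diag n)" "real n * real n * e"] by simp
  qed
  finally show ?thesis .
qed

end

section \<open>The Fell topology at the trivial class\<close>

lemma elementary_imp_pos_def_funs:
  assumes "f \<in> elementary_pos_def_funs G \<pi>"
  shows "f \<in> pos_def_funs G \<pi>"
proof -
  have "f = (\<lambda>g\<in>carrier G. \<Sum>i<1. (\<lambda>_::nat. f) i g)"
    using assms by (auto simp: elementary_pos_def_funs_def case_prod_unfold fun_eq_iff)
  then show ?thesis
    unfolding pos_def_funs_def using assms by (intro CollectI exI[of _ "1::nat"] exI[of _ "\<lambda>_. f"]) auto
qed

text \<open>Hence a basic Fell neighbourhood of the trivial class is described by finitely many
  nonnegative constants.\<close>

lemma trivial_pos_def_funs:
  assumes "complex_inner_space V" and triv: "\<And>g x. \<lbrakk>g \<in> carrier G; x \<in> carrier V\<rbrakk> \<Longrightarrow> \<rho> g x = x"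
    and f: "f \<in> pos_def_funs G (V, \<rho>)"
  shows "\<exists>c\<ge>0. \<forall>g\<in>carrier G. f g = complex_of_real c"
proof -
  interpret V: complex_inner_space V by fact
  obtain n :: nat and p where n: "f = (\<lambda>g\<in>carrier G. \<Sum>i<n. p i g)" "\<And>i. i < n \<Longrightarrow> p i \<in> elementary_pos_def_funs G (V, \<rho>)"
    using f unfolding pos_def_funs_def by (elim CollectE exE conjE) (rule that, assumption, simp)
  have "\<exists>c\<ge>0. \<forall>g\<in>carrier G. p i g = complex_of_real c" if i: "i < n" for i
  proof -
    obtain x where x: "x \<in> carrier V" "p i = (\<lambda>g\<in>carrier G. hinner V (\<rho> g x) x)"
      using n(2)[OF i] by (auto simp: elementary_pos_def_funs_def)
    then show ?thesis
      using triv V.hinner_self[OF x(1)] V.hinner_nonneg[OF x(1)]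
      by (intro exI[of _ "Re (hinner V x x)"]) auto
  qed
  then obtain c where c: "\<And>i. i < n \<Longrightarrow> c i \<ge> 0" "\<And>i g. \<lbrakk>i < n; g \<in> carrier G\<rbrakk> \<Longrightarrow> p i g = complex_of_real (c i)"
    by metis
  show ?thesis
    using c n(1) by (intro exI[of _ "\<Sum>i<n. c i"]) (auto intro: sum_nonneg)
qed

lemma trivial_unitarily_equivalent:
  assumes "unitarily_equivalent G V \<rho> W \<sigma>" and "\<And>g x. \<lbrakk>g \<in> carrier G; x \<in> carrier V\<rbrakk> \<Longrightarrow> \<rho> g x = x"
    and "g \<in> carrier G" "y \<in> carrier W"
  shows "\<sigma> g y = y"
proof -
  obtain u where u: "unitary_iso V W u" "\<forall>g\<in>carrier G. \<forall>x\<in>carrier V. u (\<rho> g x) = \<sigma> g (u x)"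
    using assms(1) unfolding unitarily_equivalent_def by blast
  have "y \<in> u ` carrier V" using u(1) assms(4) by (simp add: unitary_iso_def bij_betw_def)
  then obtain x where "x \<in> carrier V" "y = u x" by blast
  then show ?thesis using u(2) assms(2,3) by metis
qed

text \<open>In a discrete dual the trivial class \<open>c0\<close> would have a basic neighbourhood
  inside \<open>{c0}\<close>. A unit vector almost fixed on \<open>C\<close>, scaled by the square
  root of \<open>c i\<close>, has a positive definite function close to the constant
  \<open>c i\<close>, so the nontrivial class supplied by \<open>near\<close> lies in that
  neighbourhood. \<open>irreducible_rep_small\<close> moves the representations into the carrier
  type of the dual.\<close>

lemma not_discrete_dual_space:
  fixes K :: "('g, 'm) monoid_scheme" and V0 :: "'v hilbert"
  assumes K: "group K" and triv: "irreducible_rep K S V0 \<rho>0" "\<And>g x. \<lbrakk>g \<in> carrier K; x \<in> carrier V0\<rbrakk> \<Longrightarrow> \<rho>0 g x = x"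
    and near: "\<And>C e. \<lbrakk>compactin S C; e > 0\<rbrakk> \<Longrightarrow> \<exists>(V :: 'w hilbert) \<rho> v. irreducible_rep K S V \<rho> \<and>
      v \<in> carrier V \<and> hinner V v v = 1 \<and> (\<exists>g\<in>carrier K. \<exists>x\<in>carrier V. \<rho> g x \<noteq> x) \<and>
      (\<forall>x\<in>C. cmod (1 - hinner V (\<rho> x v) v) \<le> e)"
    and SK: "topspace S \<subseteq> carrier K"
  shows "dual_space K S \<noteq> discrete_topology (dual_object K S)"
proof
  assume discrete: "dual_space K S = discrete_topology (dual_object K S)"
  obtain W0 :: "('g \<Rightarrow> complex) hilbert" and \<sigma>0 where W0: "irreducible_rep K S W0 \<sigma>0" "unitarily_equivalent K V0 \<rho>0 W0 \<sigma>0"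
    using irreducible_rep_small[OF K triv(1)] by blast
  have W0t: "\<sigma>0 g x = x" if "g \<in> carrier K" "x \<in> carrier W0" for g x
    using trivial_unitarily_equivalent[OF W0(2) triv(2) that] .
  have repW0: "unitary_rep K S W0 \<sigma>0" using W0(1) by (simp add: irreducible_rep_def)
  then have W0i: "complex_inner_space W0" by (simp add: unitary_rep_def hilbert_space_def)
  define c0 where "c0 = rep_rel K S `` {(W0, \<sigma>0)}"
  have "c0 \<in> dual_object K S" unfolding c0_def dual_object_def using W0(1) by (intro quotientI) simp
  then have "openin (dual_space K S) {c0}" unfolding discrete by simp
  then have "\<exists>n f C e. (\<forall>i<n. f i \<in> class_pos_def_funs K c0) \<and> compactin S C \<and> e > 0 \<and>
      fell_nbhd K (dual_object K S) n f C e \<subseteq> {c0}"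
    unfolding openin_fell_topology by (elim conjE) (drule bspec[OF _ singletonI], assumption)
  then obtain n f C e where f: "\<forall>i<n. f i \<in> class_pos_def_funs K c0" and C: "compactin S C" and e: "e > 0"
      and nb: "fell_nbhd K (dual_object K S) n f C e \<subseteq> {c0}"
    by (elim exE conjE) (rule that)
  have CK: "C \<subseteq> carrier K" using compactin_subset_topspace[OF C] SK by blast
  have "\<exists>c\<ge>0. \<forall>g\<in>carrier K. f i g = complex_of_real c" if "i < n" for i
  proof (rule trivial_pos_def_funs[OF W0i, of K \<sigma>0])
    show "f i \<in> pos_def_funs K (W0, \<sigma>0)"
      using f that class_pos_def_funs_eq[OF repW0] by (simp add: c0_def)
  qed (rule W0t)
  then obtain c where c: "\<And>i. i < n \<Longrightarrow> c i \<ge> 0" "\<And>i g. \<lbrakk>i < n; g \<in> carrier K\<rbrakk> \<Longrightarrow> f i g = complex_of_real (c i)"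
    by metis
  \<comment> \<open>A common bound for the constants; the added 1 makes it positive, and the 2 in
    \<open>e / (2 * B)\<close> makes the final inequality strict.\<close>
  define B where "B = (\<Sum>i<n. c i) + 1"
  have cB: "c i \<le> B" if "i < n" for i
    using c(1) that member_le_sum[of i "{..<n}" c] by (auto simp: B_def)
  have B: "B > 0" using c(1) by (auto simp: B_def intro!: add_nonneg_pos sum_nonneg)
  have "e / (2 * B) > 0" using e B by simp
  from near[OF C this] obtain V :: "'w hilbert" and \<rho> v where V: "irreducible_rep K S V \<rho>" "v \<in> carrier V" "hinner V v v = 1"
      "\<exists>g\<in>carrier K. \<exists>x\<in>carrier V. \<rho> g x \<noteq> x" "\<forall>x\<in>C. cmod (1 - hinner V (\<rho> x v) v) \<le> e / (2 * B)"
    by (elim exE conjE) (rule that)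
  have repV: "unitary_rep K S V \<rho>" using V(1) by (simp add: irreducible_rep_def)
  then interpret V: complex_inner_space V by (simp add: unitary_rep_def hilbert_space_def)
  obtain W :: "('g \<Rightarrow> complex) hilbert" and \<sigma> where W: "irreducible_rep K S W \<sigma>" "unitarily_equivalent K V \<rho> W \<sigma>"
    using irreducible_rep_small[OF K V(1)] by blast
  have repW: "unitary_rep K S W \<sigma>" using W(1) by (simp add: irreducible_rep_def)
  define c1 where "c1 = rep_rel K S `` {(W, \<sigma>)}"
  have c1: "c1 \<in> dual_object K S" unfolding c1_def dual_object_def using W(1) by (intro quotientI) simp
  define h where "h i = (\<lambda>g\<in>carrier K. hinner V (\<rho> g (sqrt (c i) \<odot>\<^bsub>V\<^esub> v)) (sqrt (c i) \<odot>\<^bsub>V\<^esub> v))" for i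
  have h_el: "h i \<in> elementary_pos_def_funs K (V, \<rho>)" for i
    unfolding elementary_pos_def_funs_def h_def using V.scale_closed[OF V(2)] by auto
  have h_class: "h i \<in> class_pos_def_funs K c1" for i
    unfolding c1_def class_pos_def_funs_eq[OF repW]
    using elementary_imp_pos_def_funs[OF h_el] pos_def_funs_mono[OF repV W(2)] by blast
  have h_eq: "h i g = complex_of_real (c i) * hinner V (\<rho> g v) v" if i: "i < n" and g: "g \<in> carrier K" for i g
  proof -
    have "unitary_iso V V (\<rho> g)"
      using repV g by (auto simp: unitary_rep_def hom_def carrier_unitary_group)
    then have "\<rho> g (sqrt (c i) \<odot>\<^bsub>V\<^esub> v) = sqrt (c i) \<odot>\<^bsub>V\<^esub> \<rho> g v" using V(2) by (simp add: unitary_iso_def)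
    then have "h i g = (complex_of_real (sqrt (c i)) * complex_of_real (sqrt (c i))) * hinner V (\<rho> g v) v"
      using g V(2) unitary_rep_closed[OF repV g V(2)]
      by (simp add: h_def V.hinner_scale_left V.hinner_scale_right V.scale_closed)
    also have "complex_of_real (sqrt (c i)) * complex_of_real (sqrt (c i)) = complex_of_real (c i)"
      using c(1)[OF i] by (simp flip: of_real_mult)
    finally show ?thesis .
  qed
  have "c1 \<in> fell_nbhd K (dual_object K S) n f C e"
    unfolding fell_nbhd_def
  proof (intro CollectI conjI c1 exI[of _ h] allI impI ballI h_class)
    fix x i assume x: "x \<in> C" and i: "i < n"
    have xK: "x \<in> carrier K" using x CK by blast
    have "f i x - h i x = complex_of_real (c i) * (1 - hinner V (\<rho> x v) v)"
      using c(2)[OF i xK] h_eq[OF i xK] by (simp add: algebra_simps)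
    then have "cmod (f i x - h i x) = c i * cmod (1 - hinner V (\<rho> x v) v)"
      using c(1)[OF i] by (simp add: norm_mult)
    also have "\<dots> \<le> B * (e / (2 * B))"
      using cB[OF i] c(1)[OF i] bspec[OF V(5) x] B by (intro mult_mono) auto
    also have "\<dots> < e" using B e by simp
    finally show "cmod (f i x - h i x) < e" .
  qed
  then have "c1 = c0" using nb by blast
  moreover have "(W, \<sigma>) \<in> c1"
    using repW unitarily_equivalent_refl by (auto simp: c1_def rep_rel_def)
  ultimately have "unitarily_equivalent K W0 \<sigma>0 W \<sigma>" by (auto simp: c0_def rep_rel_def)
  then have "unitarily_equivalent K W0 \<sigma>0 V \<rho>"
    using unitarily_equivalent_trans unitarily_equivalent_sym[OF repV W(2)] by blast
  then have "\<rho> g x = x" if "g \<in> carrier K" "x \<in> carrier V" for g x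
    using trivial_unitarily_equivalent[of K W0 \<sigma>0 V \<rho> g x] W0t that by blast
  then show False using V(4) by blast
qed

context compact_group
begin

lemma dense_subgroup_dual_not_discrete:
  assumes D: "subgroup D G" and dense: "T closure_of D = topspace T"
    and pairs: "\<And>C e. \<lbrakk>compactin T C; C \<subseteq> D; e > 0\<rbrakk> \<Longrightarrow> \<exists>u v. mrep G T {..<n::nat} u \<and> mrep G T {..<n} v \<and> n \<ge> 1 \<and>
      coeff_orth G (n, u) (n, v) \<and> (\<forall>x\<in>C. \<forall>i<n. \<forall>j<n. cmod (u x i j - v x i j) < e)"
  shows "dual_space (G\<lparr>carrier := D\<rparr>) (subtopology T D) \<noteq>
    discrete_topology (dual_object (G\<lparr>carrier := D\<rparr>) (subtopology T D))"
proof -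
  let ?K = "G\<lparr>carrier := D\<rparr>" and ?S = "subtopology T D"
  have DG: "D \<subseteq> carrier G" using D by (rule subgroup.subset)
  have K: "group ?K" using D by (rule subgroup.subgroup_is_group) (rule is_group)
  define t where "t = (\<lambda>(g::'a) (i::nat \<times> nat) (j::nat \<times> nat). 1 :: complex)"
  define I0 where "I0 = {(0::nat, 0::nat)}"
  have t: "mrep G T I0 t" by (simp add: mrep_def t_def I0_def)
  obtain N0 e0 where N0: "fun_ip.onb (CI I0) (ipI I0) N0 e0 (CI I0)" using CI_onb[of I0] by (auto simp: I0_def)
  have t_act: "act I0 t g f = f" if "f \<in> CI I0" for f g
    using that by (auto simp: act_def t_def I0_def CI_def)
  define v0 where "v0 = (\<lambda>p. if p \<in> I0 then 1 else 0 :: complex)"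
  have v0: "v0 \<in> CI I0" "v0 \<noteq> (\<lambda>_. 0)" by (auto simp: v0_def CI_def I0_def fun_eq_iff)
  \<comment> \<open>With \<open>C\<close> empty and the constant 0,
    \<open>almost_fixed_irreducible\<close> just provides an irreducible subrepresentation, here of
    the trivial character.\<close>
  obtain E0 where E0: "E0 \<subseteq> CI I0" "irreducible_rep ?K ?S (hilb E0 (ipI I0)) (\<lambda>g. restrict (act I0 t g) E0)"
    using almost_fixed_irreducible[OF t D N0 v0, of "{}" 0] by auto
  show ?thesis
  proof (rule not_discrete_dual_space[OF K E0(2)])
    show "restrict (act I0 t g) E0 x = x" if "g \<in> carrier ?K" "x \<in> carrier (hilb E0 (ipI I0))" for g x
      using that E0(1) t_act by auto
    show "topspace ?S \<subseteq> carrier ?K" by simp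
    fix C and e :: real assume C: "compactin ?S C" and e: "e > 0"
    have C': "compactin T C" "C \<subseteq> D" using C by (auto simp: compactin_subtopology)
    define I where "I = {..<n} \<times> {..<n}"
    have fI: "finite I" by (simp add: I_def)
    interpret S: fun_ip "CI I" "ipI I" by (rule fun_ip_CI[OF fI])
    obtain N b where Nb: "S.onb N b (CI I)" using CI_onb[OF fI] by blast
    \<comment> \<open>Compensates the factor \<open>n * n\<close> of
      \<open>diag_almost_fixed\<close> and the factor \<open>2 ^ N\<close> of the passage to an
      irreducible constituent, both determined without reference to \<open>C\<close>; the added 1
      keeps the denominator positive.\<close>
    define \<eta> where "\<eta> = e / (2 ^ N * (real n * real n + 1))"
    have \<eta>: "\<eta> > 0" unfolding \<eta>_def using e by (intro divide_pos_pos mult_pos_pos) (auto intro: add_nonneg_pos)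
    obtain u v where uv: "mrep G T {..<n} u" "mrep G T {..<n} v" "n \<ge> 1" "coeff_orth G (n, u) (n, v)"
        "\<forall>x\<in>C. \<forall>i<n. \<forall>j<n. cmod (u x i j - v x i j) < \<eta>"
      using pairs[OF C' \<eta>] by blast
    define w where "w = tensor u v"
    have w: "mrep G T I w" unfolding w_def I_def by (rule mrep_tensor[OF uv(1,2)])
    have dn: "diag n \<in> CI I" unfolding I_def by (rule diag_CI)
    have "S.nrm (diag n) \<noteq> 0" using diag_nrm[of n] uv(3) by (simp add: I_def)
    then have dn0: "diag n \<noteq> (\<lambda>_. 0)" using S.nrm_eq_0[OF dn] by blast
    have near: "S.nrm (\<lambda>t. act I w x (diag n) t - diag n t) \<le> (real n * real n * \<eta>) * S.nrm (diag n)" if "x \<in> C" for x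
      using diag_almost_fixed[OF uv(1-3), of x \<eta>] that uv(5) C'(2) DG unfolding I_def w_def by blast
    have \<eta>0: "0 \<le> real n * real n * \<eta>" using \<eta> by simp
    have "\<exists>E v. E \<subseteq> CI I \<and> csub E \<and> v \<in> E \<and> v \<noteq> (\<lambda>_. 0) \<and>
        (\<forall>x\<in>C. S.nrm (\<lambda>t. act I w x v t - v t) \<le> 2 ^ N * (real n * real n * \<eta>) * S.nrm v) \<and>
        irreducible_rep ?K ?S (hilb E (ipI I)) (\<lambda>g. restrict (act I w g) E)"
      by (rule almost_fixed_irreducible[OF w D Nb dn dn0 C'(2) \<eta>0 near])
    then obtain E x where E: "E \<subseteq> CI I" "csub E" and x: "x \<in> E" "x \<noteq> (\<lambda>_. 0)"
        and xn: "\<forall>y\<in>C. S.nrm (\<lambda>t. act I w y x t - x t) \<le> 2 ^ N * (real n * real n * \<eta>) * S.nrm x"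
        and irr: "irreducible_rep ?K ?S (hilb E (ipI I)) (\<lambda>g. restrict (act I w g) E)"
      by (elim exE conjE) (rule that)
    have xS: "x \<in> CI I" using x E by blast
    have nx: "S.nrm x > 0" using S.nrm_eq_0[OF xS] x S.ip_nonneg[OF xS] by (simp add: less_le)
    define c where "c = complex_of_real (1 / S.nrm x)"
    define y where "y = (\<lambda>t. c * x t)"
    have y: "y \<in> E" unfolding y_def by (rule csub_scale[OF E(2) x(1)])
    then have yS: "y \<in> CI I" using E by blast
    have "S.nrm y = cmod c * S.nrm x" unfolding y_def by (rule S.nrm_scale[OF xS])
    also have "\<dots> = 1" using nx by (simp add: c_def norm_divide)
    finally have ny: "S.nrm y = 1" .
    have yy: "ipI I y y = 1" using S.ip_self[OF yS] ny by simp
    have "2 ^ N * (real n * real n * \<eta>) \<le> 2 ^ N * ((real n * real n + 1) * \<eta>)"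
      using \<eta> by (intro mult_left_mono mult_right_mono) auto
    also have "\<dots> = e"
    proof -
      have "real n * real n + 1 \<noteq> 0" by (metis add_nonneg_pos less_irrefl mult_nonneg_nonneg of_nat_0_le_iff zero_less_one)
      then show ?thesis by (simp add: \<eta>_def)
    qed
    finally have small: "2 ^ N * (real n * real n * \<eta>) \<le> e" .
    have close: "cmod (1 - ipI I (act I w z y) y) \<le> e" if z: "z \<in> C" for z
    proof -
      have zx: "act I w z x \<in> CI I" "act I w z y \<in> CI I" by (rule act_CI)+
      have "(\<lambda>t. act I w z y t - y t) = (\<lambda>t. c * (act I w z x t - x t))"
        unfolding y_def act_linear(2) by (simp add: right_diff_distrib)
      then have "S.nrm (\<lambda>t. act I w z y t - y t) = cmod c * S.nrm (\<lambda>t. act I w z x t - x t)"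
        using S.nrm_scale[OF S.S_diff[OF zx(1) xS], of c] by simp
      also have "\<dots> \<le> cmod c * (e * S.nrm x)"
      proof (rule mult_left_mono)
        have "S.nrm (\<lambda>t. act I w z x t - x t) \<le> 2 ^ N * (real n * real n * \<eta>) * S.nrm x" using xn z by blast
        also have "\<dots> \<le> e * S.nrm x" using small nx by (intro mult_right_mono) auto
        finally show "S.nrm (\<lambda>t. act I w z x t - x t) \<le> e * S.nrm x" .
      qed simp
      also have "\<dots> = e" using nx by (simp add: c_def norm_divide)
      finally have d: "S.nrm (\<lambda>t. act I w z y t - y t) \<le> e" .
      have "ipI I (act I w z y) y - 1 = ipI I (\<lambda>t. act I w z y t - y t) y"
        using zx yS yy by (simp add: S.ip_diff)
      then have "cmod (1 - ipI I (act I w z y) y) = cmod (ipI I (\<lambda>t. act I w z y t - y t) y)"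
        by (metis norm_minus_commute)
      also have "\<dots> \<le> S.nrm (\<lambda>t. act I w z y t - y t) * S.nrm y"
        using zx yS S.S_diff by (intro S.ip_cauchy_schwarz) auto
      finally show ?thesis using d ny by simp
    qed
    \<comment> \<open>Otherwise \<open>x\<close> would be a nonzero vector fixed by
      \<open>D\<close>, which orthogonality excludes: the entries of \<open>w\<close> have mean
      0.\<close>
    have "\<exists>g\<in>D. \<exists>z\<in>E. act I w g z \<noteq> z"
    proof (rule ccontr)
      assume "\<not> ?thesis"
      then have "x = (\<lambda>_. 0)"
        using x(1)
      proof (intro mean_eq_zero_imp_no_fixed[OF w _ dense xS])
        show "mean G (\<lambda>g. w g p q) = 0" if "p \<in> I" "q \<in> I" for p q
          using that uv(4) by (auto simp: w_def tensor_def coeff_orth_def I_def)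
      qed auto
      then show False using x(2) by blast
    qed
    then show "\<exists>(V :: (nat \<times> nat \<Rightarrow> complex) hilbert) \<rho> v. irreducible_rep ?K ?S V \<rho> \<and>
        v \<in> carrier V \<and> hinner V v v = 1 \<and> (\<exists>g\<in>carrier ?K. \<exists>x\<in>carrier V. \<rho> g x \<noteq> x) \<and>
        (\<forall>x\<in>C. cmod (1 - hinner V (\<rho> x v) v) \<le> e)"
      using irr y yy close
      by (intro exI[of _ "hilb E (ipI I)"] exI[of _ "\<lambda>g. restrict (act I w g) E"] exI[of _ y]) auto
  qed
qed

end

theorem theorem5p2:
  fixes H :: "('a, 'm) monoid_scheme" and T :: "'a topology"
  assumes "topological_group H T"
    and "compact_space T"
    and "\<not> metrizable_space T"
  shows "\<exists>G. subgroup G H \<and> T closure_of G = topspace T \<and>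
    dual_space (H\<lparr>carrier := G\<rparr>) (subtopology T G) \<noteq>
      discrete_topology (dual_object (H\<lparr>carrier := G\<rparr>) (subtopology T G))"
proof -
  interpret compact_group H T
    using assms by (simp add: compact_group_def compact_group_axioms_def)
  obtain D n where D: "subgroup D H" "T closure_of D = topspace T"
      and pairs: "\<forall>C e. compactin T C \<and> C \<subseteq> D \<and> e > 0 \<longrightarrow> (\<exists>u v. mrep H T {..<n::nat} u \<and> mrep H T {..<n} v \<and> n \<ge> 1 \<and>
        coeff_orth H (n, u) (n, v) \<and> (\<forall>x\<in>C. \<forall>i<n. \<forall>j<n. cmod (u x i j - v x i j) < e))"
    using dense_subgroup_close_pairs[OF assms(3)] by (elim exE conjE) (rule that)
  have "dual_space (H\<lparr>carrier := D\<rparr>) (subtopology T D) \<noteq>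
      discrete_topology (dual_object (H\<lparr>carrier := D\<rparr>) (subtopology T D))"
    by (rule dense_subgroup_dual_not_discrete[OF D, of n]) (use pairs in simp)
  then show ?thesis using D by blast
qed

end
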